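(* Let $(\mathcal S,D,L)$ be an integration by parts (IbP) framework on a probability space $(\Omega,\mathcal F,\mathbb P)$ with separable Hilbert space $\mathcal H$, and let $\mathcal D_\infty$ be the associated space of smooth functionals (see context). Fix $q,d\in\mathbb N$ and $\kappa,p\ge1$. Suppose that $F\in\mathcal D_\infty^d$ is such that $\|F\|_{L,q+2,(4d+1)q}<\infty$. Consider also an auxiliary random variable $Q\in\mathcal D_\infty^d$ such that $\Sigma_\kappa(Q):=\mathbb E\big[(1/\det\sigma_Q)^{\kappa}\big]<\infty$. Then there exists a constant $C$ depending on $p,q,\kappa$ and $d$ (but not on $Q$) such that for any $\eta>0$ and $\delta>0$, and for any function $f\in C_b^q(\mathbb R^d)$, $$\big|\mathbb E(f(F))-\mathbb E(f_\delta(F))\big|\le C\|f\|_\infty\Big(\frac{\delta^q}{\eta^{2q}}+\eta^{-p}\,\mathbb E\big(|\det\sigma_F-\det\sigma_Q|^p\big)+\eta^\kappa\,\mathbb E\big(|\det\sigma_Q|^{-\kappa}\big)\Big).$$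
   Context: $C_p^\infty(\mathbb R^d)$ (resp. $C^q_p(\mathbb R^d)$) denotes smooth (resp. $q$-times differentiable) functions which together with all their derivatives have polynomial growth; $C_b^q(\mathbb R^d)$ denotes bounded $q$-times differentiable functions with bounded derivatives up to order $q$. IbP framework. $\mathcal S\subset\bigcap_{p\ge1}L^p(\Omega;\mathbb R)$ is a linear subspace such that $\phi(F)\in\mathcal S$ for all $\phi\in C_p^\infty(\mathbb R^d)$, $F\in\mathcal S^d$. $D:\mathcal S\to\bigcap_{p\ge1}L^p(\Omega;\mathcal H)$ is linear with $D_hF:=\langle DF,h\rangle_{\mathcal H}\in\mathcal S$ for all $h\in\mathcal H$, and $D\phi(F)=\sum_{i=1}^d\partial_i\phi(F)DF_i$ for $\phi\in C^1_p(\mathbb R^d)$, $F\in\mathcal S^d$. Higher derivatives $D^q:\mathcal S\to\bigcap_pL^p(\Omega;\mathcal H^{\otimes q})$ are defined by $\langle D^qF,\otimes_{i=1}^qh_i\rangle=D_{h_q}\cdots D_{h_1}F$. $L:\mathcal S\to\mathcal S$ is linear with $\mathbb E\langle DF,DG\rangle_{\mathcal H}=\mathbb E(F\,LG)=\mathbb E(G\,LF)$ for $F,G\in\mathcal S$ and $L\phi(F)=\sum_i\partial_i\phi(F)LF_i-\sum_{i,j}\partial_i\partial_j\phi(F)\langle DF_i,DF_j\rangle_{\mathcal H}$ for $\phi\in C_p^2(\mathbb R^d)$, $F\in\mathcal S^d$. Finally, each $D^q:\mathcal S\subset L^2(\Omega)\to L^2(\Omega;\mathcal H^{\otimes q})$,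 $q\ge1$, is closable. Norms. For $F\in\mathcal S$: $|F|_{1,l}=\sum_{q=1}^l|D^qF|_{\mathcal H^{\otimes q}}$, $|F|_l=|F|+|F|_{1,l}$, $|F|_0=|F|$, $|F|_l=0$ for $l<0$; for $F\in\mathcal S^d$, sum over components. $\|F\|_{l,p}=(\mathbb E|F|_l^p)^{1/p}$ and $\|F\|_{L,l,p}=\|F\|_{l,p}+\|LF\|_{l-2,p}$. $\mathcal D_{l,p}$ is the closure of $\mathcal S$ in $\|\cdot\|_{L,l,p}$, $\mathcal D_\infty=\bigcap_{l\ge1}\bigcap_{p\ge1}\mathcal D_{l,p}$; $D^q$, $L$ and the norms are extended to $\mathcal D_\infty$ by closure. Covariance matrix: for $F\in\mathcal D_\infty^d$, $\sigma_F=(\langle DF_i,DF_j\rangle_{\mathcal H})_{1\le i,j\le d}$. Super kernel: a fixed function $\phi$ in the Schwartz space on $\mathbb R^d$ with $\int\phi=1$, $\int y^{a}\phi(y)dy=0$ for every multi-index $|a|\ge1$, and $\int|y|^m|\partial^{b}\phi(y)|dy<\infty$ for all $m\in\mathbb N$ and multi-indices $b$. $\phi_\delta(y)=\delta^{-d}\phi(y/\delta)$, $f_\delta=f*\phi_\delta$.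
   Formalization: The constant C may depend on the fixed F (and on the framework and super kernel), not only on p, q, κ and d; a constant uniform in F is impossible, as F = Q = λG with G Gaussian and λ large shows. *)

theory Defs
  imports "HOL-Probability.Probability"
begin

section \<open>Partial derivatives and function classes\<close>

text \<open>
  The axioms of an integration by parts framework quantify over functions of \<open>d\<close> variables for
  all \<open>d\<close> at once, so there \<open>\<real>\<^sup>d\<close> cannot be \<open>real ^ 'd\<close>: a function of \<open>n\<close> variables is a function
  on \<open>nat \<Rightarrow> real\<close> (product topology) depending on the coordinates \<open>i < n\<close> only. To have one notion of
  partial derivative for both representations, it is parametrised by the map \<open>sh\<close>, where
  \<open>sh i t x\<close> translates \<open>x\<close> by \<open>t\<close> in the \<open>i\<close>-th coordinate direction.
\<close>

definition seq_shift :: "nat \<Rightarrow> real \<Rightarrow> (nat \<Rightarrow> real) \<Rightarrow> (nat \<Rightarrow> real)" where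
  "seq_shift i t x = x(i := x i + t)"

definition vec_shift :: "'d::finite \<Rightarrow> real \<Rightarrow> real ^ 'd \<Rightarrow> real ^ 'd" where
  "vec_shift i t x = x + t *\<^sub>R axis i 1"

primrec pderivs ::
  "('i \<Rightarrow> real \<Rightarrow> 'x \<Rightarrow> 'x) \<Rightarrow> 'i list \<Rightarrow> ('x \<Rightarrow> real) \<Rightarrow> 'x \<Rightarrow> real" where
  "pderivs sh [] f = f"
| "pderivs sh (i # is) f = (\<lambda>x. deriv (\<lambda>t. pderivs sh is f (sh i t x)) 0)"

text \<open>The class \<open>C\<^sup>k\<close>: all iterated partial derivatives up to order \<open>k\<close> exist and are continuous.\<close>

definition Ck_on ::
  "('i \<Rightarrow> real \<Rightarrow> 'x \<Rightarrow> 'x) \<Rightarrow> 'i set \<Rightarrow> nat \<Rightarrow> ('x::topological_space \<Rightarrow> real) \<Rightarrow> bool" where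
  "Ck_on sh I k f \<longleftrightarrow>
     (\<forall>is. set is \<subseteq> I \<and> length is \<le> k \<longrightarrow> continuous_on UNIV (pderivs sh is f)) \<and>
     (\<forall>is. \<forall>i\<in>I. \<forall>x. set is \<subseteq> I \<and> length is < k \<longrightarrow>
        (\<lambda>t. pderivs sh is f (sh i t x)) differentiable (at 0))"

definition Cp :: "nat \<Rightarrow> nat \<Rightarrow> ((nat \<Rightarrow> real) \<Rightarrow> real) \<Rightarrow> bool" where
  "Cp n k f \<longleftrightarrow>
     (\<forall>x y. (\<forall>i<n. x i = y i) \<longrightarrow> f x = f y) \<and>
     Ck_on seq_shift {..<n} k f \<and>
     (\<forall>is. set is \<subseteq> {..<n} \<and> length is \<le> k \<longrightarrow>
        (\<exists>C m. \<forall>x. \<bar>pderivs seq_shift is f x\<bar> \<le> C * (1 + (\<Sum>i<n. \<bar>x i\<bar>)) ^ m))"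

definition Cp_inf :: "nat \<Rightarrow> ((nat \<Rightarrow> real) \<Rightarrow> real) \<Rightarrow> bool" where
  "Cp_inf n f \<longleftrightarrow> (\<forall>k. Cp n k f)"

definition Cb :: "nat \<Rightarrow> (real ^ 'd::finite \<Rightarrow> real) \<Rightarrow> bool" where
  "Cb k f \<longleftrightarrow> Ck_on vec_shift UNIV k f \<and>
     (\<forall>is. length is \<le> k \<longrightarrow> bounded (range (pderivs vec_shift is f)))"

definition sup_norm :: "('x \<Rightarrow> real) \<Rightarrow> real" where
  "sup_norm f = (SUP x. \<bar>f x\<bar>)"


section \<open>Super kernels and regularisation\<close>

definition schwartz :: "(real ^ 'd::finite \<Rightarrow> real) \<Rightarrow> bool" where
  "schwartz \<phi> \<longleftrightarrow> (\<forall>k. Ck_on vec_shift UNIV k \<phi>) \<and>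
     (\<forall>m is. \<exists>C. \<forall>y. norm y ^ m * \<bar>pderivs vec_shift is \<phi> y\<bar> \<le> C)"

definition super_kernel :: "(real ^ 'd::finite \<Rightarrow> real) \<Rightarrow> bool" where
  "super_kernel \<phi> \<longleftrightarrow> schwartz \<phi> \<and>
     (\<integral>y. \<phi> y \<partial>lborel) = 1 \<and>
     (\<forall>a::'d \<Rightarrow> nat. (\<Sum>i\<in>UNIV. a i) \<ge> 1 \<longrightarrow>
        (\<integral>y. (\<Prod>i\<in>UNIV. (y $ i) ^ a i) * \<phi> y \<partial>lborel) = 0) \<and>
     (\<forall>m is. integrable lborel (\<lambda>y. norm y ^ m * \<bar>pderivs vec_shift is \<phi> y\<bar>))"

definition scaled :: "(real ^ 'd::finite \<Rightarrow> real) \<Rightarrow> real \<Rightarrow> real ^ 'd \<Rightarrow> real" where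
  "scaled \<phi> \<delta> y = \<phi> ((1 / \<delta>) *\<^sub>R y) / \<delta> ^ CARD('d)"

definition regularise ::
  "(real ^ 'd::finite \<Rightarrow> real) \<Rightarrow> real \<Rightarrow> (real ^ 'd \<Rightarrow> real) \<Rightarrow> real ^ 'd \<Rightarrow> real" where
  "regularise \<phi> \<delta> f x = (\<integral>y. f (x - y) * scaled \<phi> \<delta> y \<partial>lborel)"


section \<open>Moments, and Hilbert tensor powers\<close>

definition Lp_norm :: "'w measure \<Rightarrow> real \<Rightarrow> ('w \<Rightarrow> real) \<Rightarrow> ennreal" where
  "Lp_norm M p g =
     (let I = \<integral>\<^sup>+ \<omega>. ennreal (\<bar>g \<omega>\<bar> powr p) \<partial>M
      in if I = \<infinity> then \<infinity> else ennreal (enn2real I powr (1 / p)))"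

definition in_Lp :: "'w measure \<Rightarrow> real \<Rightarrow> ('w \<Rightarrow> 'b::real_normed_vector) \<Rightarrow> bool" where
  "in_Lp M p X \<longleftrightarrow> X \<in> borel_measurable M \<and> Lp_norm M p (\<lambda>\<omega>. norm (X \<omega>)) < \<infinity>"

text \<open>
  The Hilbert tensor power \<open>H\<^sup>\<otimes>\<^sup>q\<close> is realised as the space of Hilbert-Schmidt \<open>q\<close>-linear forms
  on \<open>H\<close>, where \<open>T [h\<^sub>1, \<dots>, h\<^sub>q]\<close> is the inner product of \<open>T\<close> with \<open>h\<^sub>1 \<otimes> \<dots> \<otimes> h\<^sub>q\<close>. The squared norm
  is the sum of \<open>T(e\<^sub>i\<^sub>1, \<dots>, e\<^sub>i\<^sub>q)\<^sup>2\<close> over an orthonormal basis, written without choosing a basis as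
  the supremum over finite orthonormal sets. Values of \<open>T\<close> on lists of other lengths are irrelevant.
\<close>

definition hs_sums :: "nat \<Rightarrow> ('h::real_inner list \<Rightarrow> real) \<Rightarrow> real set" where
  "hs_sums q T = {\<Sum>hs\<in>{hs. set hs \<subseteq> B \<and> length hs = q}. (T hs)\<^sup>2 | B.
     finite B \<and> pairwise orthogonal B \<and> (\<forall>b\<in>B. norm b = 1)}"

definition hs_tensor :: "nat \<Rightarrow> ('h::real_inner list \<Rightarrow> real) \<Rightarrow> bool" where
  "hs_tensor q T \<longleftrightarrow>
     (\<forall>hs i. length hs = q \<and> i < q \<longrightarrow> linear (\<lambda>h. T (hs[i := h]))) \<and> bdd_above (hs_sums q T)"

definition hs_norm :: "nat \<Rightarrow> ('h::real_inner list \<Rightarrow> real) \<Rightarrow> real" where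
  "hs_norm q T = sqrt (Sup (hs_sums q T))"

text \<open>
  Elements of \<open>L\<^sup>p(\<Omega>; H\<^sup>\<otimes>\<^sup>q)\<close>; as \<open>H\<^sup>\<otimes>\<^sup>q\<close> is separable, measurability is the same as measurability of
  the inner products with all elementary tensors.
\<close>

definition tensor_Lp ::
  "'w measure \<Rightarrow> nat \<Rightarrow> real \<Rightarrow> ('w \<Rightarrow> 'h::real_inner list \<Rightarrow> real) \<Rightarrow> bool" where
  "tensor_Lp M q p X \<longleftrightarrow>
     (\<forall>\<omega>. hs_tensor q (X \<omega>)) \<and>
     (\<forall>hs. length hs = q \<longrightarrow> (\<lambda>\<omega>. X \<omega> hs) \<in> borel_measurable M) \<and>
     Lp_norm M p (\<lambda>\<omega>. hs_norm q (X \<omega>)) < \<infinity>"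


section \<open>Integration by parts frameworks\<close>

text \<open>\<open>iter_D D [h\<^sub>1, \<dots>, h\<^sub>q] F\<close> is \<open>D\<^bsub>h\<^sub>q\<^esub> \<dots> D\<^bsub>h\<^sub>1\<^esub> F\<close>.\<close>

primrec iter_D ::
  "(('w \<Rightarrow> real) \<Rightarrow> 'w \<Rightarrow> 'h::real_inner) \<Rightarrow> 'h list \<Rightarrow> ('w \<Rightarrow> real) \<Rightarrow> 'w \<Rightarrow> real" where
  "iter_D D [] F = F"
| "iter_D D (h # hs) F = iter_D D hs (\<lambda>\<omega>. D F \<omega> \<bullet> h)"

text \<open>
  \<open>Dq M D q F\<close> is the tensor determined by its inner products with elementary tensors; it is unique
  up to null sets because \<open>H\<close> is separable.
\<close>

definition is_Dq ::
  "'w measure \<Rightarrow> (('w \<Rightarrow> real) \<Rightarrow> 'w \<Rightarrow> 'h::real_inner) \<Rightarrow> nat \<Rightarrow> ('w \<Rightarrow> real)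
    \<Rightarrow> ('w \<Rightarrow> 'h list \<Rightarrow> real) \<Rightarrow> bool" where
  "is_Dq M D q F X \<longleftrightarrow> (\<forall>p\<ge>1. tensor_Lp M q p X) \<and>
     (\<forall>hs. length hs = q \<longrightarrow> (AE \<omega> in M. X \<omega> hs = iter_D D hs F \<omega>))"

definition Dq ::
  "'w measure \<Rightarrow> (('w \<Rightarrow> real) \<Rightarrow> 'w \<Rightarrow> 'h::real_inner) \<Rightarrow> nat \<Rightarrow> ('w \<Rightarrow> real)
    \<Rightarrow> 'w \<Rightarrow> 'h list \<Rightarrow> real" where
  "Dq M D q F = (SOME X. is_Dq M D q F X)"

text \<open>
  Random variables are represented by measurable functions, and \<open>S\<close> is the set of all
  representatives of the almost sure equivalence classes it stands for; all identities are
  almost sure. The chain rules for \<open>C\<^sup>1\<^sub>p\<close> and \<open>C\<^sup>2\<^sub>p\<close> are required only where \<open>\<phi>(F)\<close> lies in the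
  domain \<open>S\<close> of the operators.
\<close>

locale ibp_framework = prob_space M for M :: "'w measure" +
  fixes S :: "('w \<Rightarrow> real) set"
    and D :: "('w \<Rightarrow> real) \<Rightarrow> 'w \<Rightarrow> 'h::{real_inner, banach, second_countable_topology}"
    and L :: "('w \<Rightarrow> real) \<Rightarrow> 'w \<Rightarrow> real"
  assumes S_Lp: "\<And>F p. F \<in> S \<Longrightarrow> 1 \<le> p \<Longrightarrow> in_Lp M p F"
    and S_AE: "\<And>F G. F \<in> S \<Longrightarrow> G \<in> borel_measurable M \<Longrightarrow> (AE \<omega> in M. F \<omega> = G \<omega>) \<Longrightarrow> G \<in> S"
    and S_zero: "(\<lambda>_. 0) \<in> S"
    and S_lin: "\<And>F G a b. F \<in> S \<Longrightarrow> G \<in> S \<Longrightarrow> (\<lambda>\<omega>. a * F \<omega> + b * G \<omega>) \<in> S"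
    and S_smooth: "\<And>n F \<phi>. (\<And>i. i < n \<Longrightarrow> F i \<in> S) \<Longrightarrow> Cp_inf n \<phi> \<Longrightarrow> (\<lambda>\<omega>. \<phi> (\<lambda>i. F i \<omega>)) \<in> S"
    and D_Lp: "\<And>F p. F \<in> S \<Longrightarrow> 1 \<le> p \<Longrightarrow> in_Lp M p (D F)"
    and D_AE: "\<And>F G. F \<in> S \<Longrightarrow> G \<in> S \<Longrightarrow> (AE \<omega> in M. F \<omega> = G \<omega>) \<Longrightarrow> (AE \<omega> in M. D F \<omega> = D G \<omega>)"
    and D_lin: "\<And>F G a b. F \<in> S \<Longrightarrow> G \<in> S \<Longrightarrow>
      (AE \<omega> in M. D (\<lambda>\<omega>. a * F \<omega> + b * G \<omega>) \<omega> = a *\<^sub>R D F \<omega> + b *\<^sub>R D G \<omega>)"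
    and D_dir: "\<And>F h. F \<in> S \<Longrightarrow> (\<lambda>\<omega>. D F \<omega> \<bullet> h) \<in> S"
    and D_chain: "\<And>n F \<phi>. (\<And>i. i < n \<Longrightarrow> F i \<in> S) \<Longrightarrow> Cp n 1 \<phi> \<Longrightarrow>
      (\<lambda>\<omega>. \<phi> (\<lambda>i. F i \<omega>)) \<in> S \<Longrightarrow>
      (AE \<omega> in M. D (\<lambda>\<omega>. \<phi> (\<lambda>i. F i \<omega>)) \<omega> =
         (\<Sum>i<n. pderivs seq_shift [i] \<phi> (\<lambda>i. F i \<omega>) *\<^sub>R D (F i) \<omega>))"
    and Dq_exists: "\<And>F q. F \<in> S \<Longrightarrow> 1 \<le> q \<Longrightarrow> \<exists>X. is_Dq M D q F X"
    and L_S: "\<And>F. F \<in> S \<Longrightarrow> L F \<in> S"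
    and L_AE: "\<And>F G. F \<in> S \<Longrightarrow> G \<in> S \<Longrightarrow> (AE \<omega> in M. F \<omega> = G \<omega>) \<Longrightarrow> (AE \<omega> in M. L F \<omega> = L G \<omega>)"
    and L_lin: "\<And>F G a b. F \<in> S \<Longrightarrow> G \<in> S \<Longrightarrow>
      (AE \<omega> in M. L (\<lambda>\<omega>. a * F \<omega> + b * G \<omega>) \<omega> = a * L F \<omega> + b * L G \<omega>)"
    and L_dual: "\<And>F G. F \<in> S \<Longrightarrow> G \<in> S \<Longrightarrow>
      expectation (\<lambda>\<omega>. D F \<omega> \<bullet> D G \<omega>) = expectation (\<lambda>\<omega>. F \<omega> * L G \<omega>)"
      "\<And>F G. F \<in> S \<Longrightarrow> G \<in> S \<Longrightarrow>
      expectation (\<lambda>\<omega>. F \<omega> * L G \<omega>) = expectation (\<lambda>\<omega>. G \<omega> * L F \<omega>)"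
    and L_chain: "\<And>n F \<phi>. (\<And>i. i < n \<Longrightarrow> F i \<in> S) \<Longrightarrow> Cp n 2 \<phi> \<Longrightarrow>
      (\<lambda>\<omega>. \<phi> (\<lambda>i. F i \<omega>)) \<in> S \<Longrightarrow>
      (AE \<omega> in M. L (\<lambda>\<omega>. \<phi> (\<lambda>i. F i \<omega>)) \<omega> =
         (\<Sum>i<n. pderivs seq_shift [i] \<phi> (\<lambda>i. F i \<omega>) * L (F i) \<omega>)
         - (\<Sum>i<n. \<Sum>j<n. pderivs seq_shift [i, j] \<phi> (\<lambda>i. F i \<omega>) * (D (F i) \<omega> \<bullet> D (F j) \<omega>)))"
    and Dq_closable: "\<And>q G X. 1 \<le> q \<Longrightarrow> (\<And>n. G n \<in> S) \<Longrightarrow> tensor_Lp M q 2 X \<Longrightarrow>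
      (\<lambda>n. Lp_norm M 2 (G n)) \<longlonglongrightarrow> 0 \<Longrightarrow>
      (\<lambda>n. Lp_norm M 2 (\<lambda>\<omega>. hs_norm q (\<lambda>hs. Dq M D q (G n) \<omega> hs - X \<omega> hs))) \<longlonglongrightarrow> 0 \<Longrightarrow>
      (AE \<omega> in M. hs_norm q (X \<omega>) = 0)"


section \<open>Norms and the space of smooth functionals\<close>

text \<open>
  The norms are parametrised by the derivative operators \<open>DD\<close> (order \<open>q\<close> in the first argument) and
  \<open>LL\<close>, so that the same definitions serve on \<open>S\<close> and, with the closed operators, on \<open>\<D>\<^sub>\<infinity>\<close>.
\<close>

definition abs_l ::
  "(nat \<Rightarrow> ('w \<Rightarrow> real) \<Rightarrow> 'w \<Rightarrow> 'h::real_inner list \<Rightarrow> real) \<Rightarrow> nat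
    \<Rightarrow> ('i::finite \<Rightarrow> 'w \<Rightarrow> real) \<Rightarrow> 'w \<Rightarrow> real" where
  "abs_l DD l F \<omega> = (\<Sum>i\<in>UNIV. \<bar>F i \<omega>\<bar> + (\<Sum>q=1..l. hs_norm q (DD q (F i) \<omega>)))"

definition norm_L ::
  "'w measure \<Rightarrow> (nat \<Rightarrow> ('w \<Rightarrow> real) \<Rightarrow> 'w \<Rightarrow> 'h::real_inner list \<Rightarrow> real)
    \<Rightarrow> (('w \<Rightarrow> real) \<Rightarrow> 'w \<Rightarrow> real) \<Rightarrow> nat \<Rightarrow> real \<Rightarrow> ('i::finite \<Rightarrow> 'w \<Rightarrow> real) \<Rightarrow> ennreal" where
  "norm_L M DD LL l p F = Lp_norm M p (abs_l DD l F) +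
     (if l < 2 then 0 else Lp_norm M p (abs_l DD (l - 2) (\<lambda>i. LL (F i))))"

text \<open>
  \<open>\<D>\<^bsub>l,p\<^esub>\<close>: limits in \<open>L\<^sup>p\<close> of sequences in \<open>S\<close> that are Cauchy for the norm of order \<open>l, p\<close>.
  The index type \<open>unit\<close> is the scalar case \<open>d = 1\<close>.
\<close>

definition D_lp ::
  "'w measure \<Rightarrow> ('w \<Rightarrow> real) set \<Rightarrow> (('w \<Rightarrow> real) \<Rightarrow> 'w \<Rightarrow> 'h::real_inner)
    \<Rightarrow> (('w \<Rightarrow> real) \<Rightarrow> 'w \<Rightarrow> real) \<Rightarrow> nat \<Rightarrow> real \<Rightarrow> ('w \<Rightarrow> real) set" where
  "D_lp M S D L l p = {F. F \<in> borel_measurable M \<and> (\<exists>G. (\<forall>n. G n \<in> S) \<and>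
     (\<lambda>n. Lp_norm M p (\<lambda>\<omega>. G n \<omega> - F \<omega>)) \<longlonglongrightarrow> 0 \<and>
     (\<forall>e>0. \<exists>N. \<forall>m\<ge>N. \<forall>n\<ge>N.
        norm_L M (Dq M D) L l p (\<lambda>_::unit. \<lambda>\<omega>. G m \<omega> - G n \<omega>) < ennreal e))}"

definition D_inf ::
  "'w measure \<Rightarrow> ('w \<Rightarrow> real) set \<Rightarrow> (('w \<Rightarrow> real) \<Rightarrow> 'w \<Rightarrow> 'h::real_inner)
    \<Rightarrow> (('w \<Rightarrow> real) \<Rightarrow> 'w \<Rightarrow> real) \<Rightarrow> ('w \<Rightarrow> real) set" where
  "D_inf M S D L = (\<Inter>l\<in>{1..}. \<Inter>p\<in>{1..}. D_lp M S D L l p)"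

text \<open>The operators extended by closure in \<open>L\<^sup>2\<close>; the values are unique up to null sets.\<close>

definition Dq_bar ::
  "'w measure \<Rightarrow> ('w \<Rightarrow> real) set \<Rightarrow> (('w \<Rightarrow> real) \<Rightarrow> 'w \<Rightarrow> 'h::real_inner)
    \<Rightarrow> nat \<Rightarrow> ('w \<Rightarrow> real) \<Rightarrow> 'w \<Rightarrow> 'h list \<Rightarrow> real" where
  "Dq_bar M S D q F = (SOME X. tensor_Lp M q 2 X \<and> (\<exists>G. (\<forall>n. G n \<in> S) \<and>
     (\<lambda>n. Lp_norm M 2 (\<lambda>\<omega>. G n \<omega> - F \<omega>)) \<longlonglongrightarrow> 0 \<and>
     (\<lambda>n. Lp_norm M 2 (\<lambda>\<omega>. hs_norm q (\<lambda>hs. Dq M D q (G n) \<omega> hs - X \<omega> hs))) \<longlonglongrightarrow> 0))"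

definition D_bar ::
  "'w measure \<Rightarrow> ('w \<Rightarrow> real) set \<Rightarrow> (('w \<Rightarrow> real) \<Rightarrow> 'w \<Rightarrow> 'h::real_inner)
    \<Rightarrow> ('w \<Rightarrow> real) \<Rightarrow> 'w \<Rightarrow> 'h" where
  "D_bar M S D F = (SOME X. in_Lp M 2 X \<and> (\<exists>G. (\<forall>n. G n \<in> S) \<and>
     (\<lambda>n. Lp_norm M 2 (\<lambda>\<omega>. G n \<omega> - F \<omega>)) \<longlonglongrightarrow> 0 \<and>
     (\<lambda>n. Lp_norm M 2 (\<lambda>\<omega>. norm (D (G n) \<omega> - X \<omega>))) \<longlonglongrightarrow> 0))"

definition L_bar ::
  "'w measure \<Rightarrow> ('w \<Rightarrow> real) set \<Rightarrow> (('w \<Rightarrow> real) \<Rightarrow> 'w \<Rightarrow> real)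
    \<Rightarrow> ('w \<Rightarrow> real) \<Rightarrow> 'w \<Rightarrow> real" where
  "L_bar M S L F = (SOME Y. in_Lp M 2 Y \<and> (\<exists>G. (\<forall>n. G n \<in> S) \<and>
     (\<lambda>n. Lp_norm M 2 (\<lambda>\<omega>. G n \<omega> - F \<omega>)) \<longlonglongrightarrow> 0 \<and>
     (\<lambda>n. Lp_norm M 2 (\<lambda>\<omega>. L (G n) \<omega> - Y \<omega>)) \<longlonglongrightarrow> 0))"

definition cov_matrix ::
  "'w measure \<Rightarrow> ('w \<Rightarrow> real) set \<Rightarrow> (('w \<Rightarrow> real) \<Rightarrow> 'w \<Rightarrow> 'h::real_inner)
    \<Rightarrow> ('d::finite \<Rightarrow> 'w \<Rightarrow> real) \<Rightarrow> 'w \<Rightarrow> real ^ 'd ^ 'd" where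
  "cov_matrix M S D F \<omega> = (\<chi> i j. D_bar M S D (F i) \<omega> \<bullet> D_bar M S D (F j) \<omega>)"

text \<open>\<open>\<Sigma>\<^sub>\<kappa>(Q) = E[(1 / det \<sigma>\<^sub>Q)\<^sup>\<kappa>]\<close>, with \<open>1 / 0 = \<infinity>\<close>; the determinant is nonnegative.\<close>

definition Sigma_inv ::
  "'w measure \<Rightarrow> ('w \<Rightarrow> real) set \<Rightarrow> (('w \<Rightarrow> real) \<Rightarrow> 'w \<Rightarrow> 'h::real_inner)
    \<Rightarrow> real \<Rightarrow> ('d::finite \<Rightarrow> 'w \<Rightarrow> real) \<Rightarrow> ennreal" where
  "Sigma_inv M S D \<kappa> Q = (\<integral>\<^sup>+ \<omega>.
     (if det (cov_matrix M S D Q \<omega>) = 0 then \<infinity>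
      else ennreal (\<bar>det (cov_matrix M S D Q \<omega>)\<bar> powr (- \<kappa>))) \<partial>M)"

end

theory Submission
  imports Defs
begin

text \<open>
  Write \<open>\<Delta>\<close> for the determinant of the covariance matrix of \<open>F\<close> and split with the smooth cutoff
  \<open>\<Psi>(\<Delta>) = \<Delta>\<^sup>m / (\<Delta>\<^sup>m + \<eta>\<^sup>m)\<close>, \<open>m\<close> even and large. The part weighted by \<open>1 - \<Psi>\<close> is bounded by
  comparing \<open>\<Delta>\<close> with the determinant for \<open>Q\<close>. In the other part, Taylor's formula and the vanishing
  moments of the kernel leave derivatives of \<open>f\<close> of order \<open>q\<close>, which are removed by integrating by
  parts \<open>q\<close> times; each step costs \<open>\<eta>\<^sup>-\<^sup>2\<close>. Since \<open>\<Psi>\<close> is rational and vanishes to order \<open>m\<close> at \<open>0\<close>,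
  every weight occurring is a functional independent of \<open>\<eta>\<close> times some \<open>\<Delta>\<^sup>a / (\<Delta>\<^sup>m + \<eta>\<^sup>m)\<^sup>b\<close>.

  It suffices to take for \<open>f\<close> trigonometric polynomials, which map \<open>S\<close> into \<open>S\<close>, and to work on \<open>S\<close>
  with constants depending only on Sobolev norms: a functional in \<open>\<D>\<^sub>\<infinity>\<close> is reached along a sequence
  in \<open>S\<close> that is bounded in these norms, so no extended operator except \<open>D\<close> itself is needed. The
  weights involve iterated derivatives in the directions \<open>DF\<^sub>j\<close>. Their moments are estimated by duality:
  truncating each inner product of \<open>H\<close> to a finite orthonormal set gives finite sums to which
  Leibniz' rule applies, and passing to the limit only requires weak convergence tested against \<open>S\<close>.
\<close>


section \<open>Smooth functions of polynomial growth\<close>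

text \<open>Only C_p^\<infinity> functions are guaranteed to map \<open>S\<close> into
  \<open>S\<close>, so neither a function in C_b^q nor an arbitrary cutoff may be composed with
  elements of \<open>S\<close>. Cosines and the rational cutoffs qualify: each lies in a family of
  polynomially growing functions closed under differentiation, and evenness of \<open>m\<close>
  keeps the denominator positive at every real argument. By the addition theorem cosines also factor
  under translation, which turns translated expectations into explicit trigonometric polynomials of
  the translation.

  After an integration by parts the term in which the cutoff is not differentiated carries one more
  power of \<eta> than the others, so it is dominated by them only while \<eta> stays below some
  \<open>\<eta>0\<close>. This bound is chosen from the law of \<Delta> so that \<Psi>(\<Delta>) has
  expectation below 1/2; for larger \<eta> the weight 1 - \<Psi> has mass at least 1/2 and the
  supremum bound on \<open>f\<close> suffices. \<open>Q\<close> enters only through a pointwise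
  comparison of 1 - \<Psi> with the two error terms, made after all constants depending on
  \<open>F\<close> and the kernel are fixed.\<close>

lemma Cp_inf_if_closed:
  fixes \<G> :: "((nat \<Rightarrow> real) \<Rightarrow> real) set"
  assumes dep: "\<And>g x y. g \<in> \<G> \<Longrightarrow> (\<forall>i<n. x i = y i) \<Longrightarrow> g x = g y"
    and cont: "\<And>g. g \<in> \<G> \<Longrightarrow> continuous_on UNIV g"
    and growth: "\<And>g. g \<in> \<G> \<Longrightarrow> \<exists>C m. \<forall>x. \<bar>g x\<bar> \<le> C * (1 + (\<Sum>i<n. \<bar>x i\<bar>)) ^ m"
    and deriv: "\<And>g i. g \<in> \<G> \<Longrightarrow> i < n \<Longrightarrow>
      \<exists>g'\<in>\<G>. \<forall>x. ((\<lambda>t. g (seq_shift i t x)) has_real_derivative g' x) (at 0)"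
    and g: "g \<in> \<G>"
  shows "Cp_inf n g"
proof -
  \<comment> \<open>Closure under one partial derivative keeps every iterated one in
    \<open>\<G>\<close>, so continuity and growth of the members settle all orders at once.\<close>
  have pd: "pderivs seq_shift is g \<in> \<G>" if "set is \<subseteq> {..<n}" for "is"
    using that
  proof (induction "is")
    case Nil
    then show ?case using g by simp
  next
    case (Cons i "is")
    then have "pderivs seq_shift is g \<in> \<G>" "i < n" by auto
    from deriv[OF this] obtain g' where g': "g' \<in> \<G>"
      "\<And>x. ((\<lambda>t. pderivs seq_shift is g (seq_shift i t x)) has_real_derivative g' x) (at 0)"
      by auto
    have "pderivs seq_shift (i # is) g = g'"
      by (rule ext) (use DERIV_imp_deriv[OF g'(2)] in simp)
    then show ?case using g' by simp
  qed
  show ?thesis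
    unfolding Cp_inf_def Cp_def Ck_on_def
    using pd dep[OF g] cont growth deriv by (auto simp: differentiable_def has_field_derivative_def; meson)
qed

text \<open>A certificate for C_p^\<infinity> in one variable: stability under differentiation makes
  every member smooth, and the growth condition then holds for all its derivatives because they are
  members too.\<close>

definition smooth_class :: "(real \<Rightarrow> real) set \<Rightarrow> bool" where
  "smooth_class \<G> \<longleftrightarrow> (\<forall>g\<in>\<G>. (\<exists>g'\<in>\<G>. \<forall>x. (g has_real_derivative g' x) (at x)) \<and>
     (\<exists>C m. \<forall>x. \<bar>g x\<bar> \<le> C * (1 + \<bar>x\<bar>) ^ m))"

lemma seq_shift_deriv:
  assumes "(g has_real_derivative c) (at (x 0))"
  shows "((\<lambda>t. g (seq_shift 0 t x 0)) has_real_derivative c) (at 0)"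
proof -
  have "((\<lambda>t. x 0 + t) has_real_derivative 1) (at 0)"
    by (auto intro!: derivative_eq_intros)
  then show ?thesis using DERIV_chain2[of g c "\<lambda>t. x 0 + t" 0 1 UNIV] assms
    by (simp add: seq_shift_def)
qed

lemma Cp_inf_one:
  assumes cl: "smooth_class \<G>" and g: "g \<in> \<G>"
  shows "Cp_inf 1 (\<lambda>x. g (x 0))"
proof (rule Cp_inf_if_closed[where \<G> = "(\<lambda>g x. g (x 0)) ` \<G>"])
  fix f assume "f \<in> (\<lambda>g (x::nat\<Rightarrow>real). g (x 0)) ` \<G>"
  then obtain h where h: "h \<in> \<G>" "f = (\<lambda>x. h (x 0))" by auto
  obtain h' where h': "h' \<in> \<G>" "\<And>x. (h has_real_derivative h' x) (at x)"
    using cl h(1) unfolding smooth_class_def by blast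
  have "continuous_on UNIV h" using h'(2) by (meson DERIV_continuous_on has_field_derivative_at_within)
  moreover have "continuous_on UNIV (\<lambda>x::nat\<Rightarrow>real. x 0)" by simp
  ultimately show "continuous_on UNIV f" unfolding h(2)
    by (rule continuous_on_compose2) auto
  show "\<exists>C m. \<forall>x. \<bar>f x\<bar> \<le> C * (1 + (\<Sum>i<1. \<bar>x i\<bar>)) ^ m"
    using cl h unfolding smooth_class_def by simp blast
  fix i :: nat assume "i < 1"
  then show "\<exists>g'\<in>(\<lambda>g x. g (x 0)) ` \<G>. \<forall>x. ((\<lambda>t. f (seq_shift i t x)) has_real_derivative g' x) (at 0)"
    using h' seq_shift_deriv[OF h'(2)] unfolding h(2)
    by (intro bexI[of _ "\<lambda>x. h' (x 0)"]) auto
qed (use g in auto)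

lemma pderivs_one:
  assumes "\<And>x. (g has_real_derivative g' x) (at x)"
  shows "pderivs seq_shift [0] (\<lambda>x. g (x 0)) x = g' (x 0)"
  using DERIV_imp_deriv[OF seq_shift_deriv[OF assms]] by simp

text \<open>The product is the two-variable function that makes \<open>S\<close> an algebra and,
  through the chain rules for \<open>D\<close> and \<open>L\<close>, gives Leibniz' rule and the
  carre du champ. Its derivatives form a finite explicit family.\<close>

lemma Cp_inf_mult: "Cp_inf 2 (\<lambda>x. x 0 * x 1)"
proof (rule Cp_inf_if_closed[where \<G> = "{\<lambda>x. x 0 * x 1, \<lambda>x. x 0, \<lambda>x. x 1, \<lambda>x. 1, \<lambda>x. 0}"], goal_cases)
  case (2 g)
  then show ?case by (auto intro!: continuous_intros)
next
  case (3 g)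
  have "\<bar>g x\<bar> \<le> 1 * (1 + (\<Sum>i<2. \<bar>x i\<bar>)) ^ 2" for x
  proof -
    have "(1 + (\<Sum>i<2. \<bar>x i\<bar>)) ^ 2 = 1 + 2 * \<bar>x 0\<bar> + 2 * \<bar>x 1\<bar> + \<bar>x 0\<bar>\<^sup>2 + \<bar>x 1\<bar>\<^sup>2 + 2 * (\<bar>x 0\<bar> * \<bar>x 1\<bar>)"
      by (simp add: numeral_2_eq_2 power2_eq_square algebra_simps)
    moreover have "0 \<le> \<bar>x 0\<bar>\<^sup>2" "0 \<le> \<bar>x 1\<bar>\<^sup>2" "0 \<le> \<bar>x 0\<bar> * \<bar>x 1\<bar>" by simp_all
    moreover have "\<bar>g x\<bar> \<in> {\<bar>x 0\<bar> * \<bar>x 1\<bar>, \<bar>x 0\<bar>, \<bar>x 1\<bar>, 1, 0}"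
      using 3 by (auto simp: abs_mult)
    ultimately show ?thesis by force
  qed
  then show ?case by blast
next
  case (4 g i)
  then have i: "i = 0 \<or> i = 1" by auto
  have d: "((\<lambda>t. x i + t) has_real_derivative 1) (at 0)" "((\<lambda>t. x i) has_real_derivative 0) (at 0)"
     "((\<lambda>t. (x i + t) * x j) has_real_derivative x j) (at 0)"
     "((\<lambda>t. x j * (x i + t)) has_real_derivative x j) (at 0)" for x :: "nat \<Rightarrow> real" and i j
    by (auto intro!: derivative_eq_intros)
  from 4(1) i show ?case
    by (auto simp: seq_shift_def d DERIV_const)
qed auto

lemma pderivs_mult:
  "pderivs seq_shift [0] (\<lambda>x. x 0 * x (Suc 0)) x = x (Suc 0)"
  "pderivs seq_shift [Suc 0] (\<lambda>x. x 0 * x (Suc 0)) x = x 0"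
  "pderivs seq_shift [0, 0] (\<lambda>x. x 0 * x (Suc 0)) x = 0"
  "pderivs seq_shift [0, Suc 0] (\<lambda>x. x 0 * x (Suc 0)) x = 1"
  "pderivs seq_shift [Suc 0, 0] (\<lambda>x. x 0 * x (Suc 0)) x = 1"
  "pderivs seq_shift [Suc 0, Suc 0] (\<lambda>x. x 0 * x (Suc 0)) x = 0"
proof -
  have 0: "deriv (\<lambda>t. (x 0 + t) * x (Suc 0)) 0 = x (Suc 0)" "deriv (\<lambda>t. x 0 * (x (Suc 0) + t)) 0 = x 0"
    for x :: "nat \<Rightarrow> real"
    by (auto intro!: DERIV_imp_deriv derivative_eq_intros)
  have 1: "deriv (\<lambda>t. c + t) 0 = 1" for c :: real
    by (auto intro!: DERIV_imp_deriv derivative_eq_intros)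
  show "pderivs seq_shift [0] (\<lambda>x. x 0 * x (Suc 0)) x = x (Suc 0)"
  "pderivs seq_shift [Suc 0] (\<lambda>x. x 0 * x (Suc 0)) x = x 0"
  "pderivs seq_shift [0, 0] (\<lambda>x. x 0 * x (Suc 0)) x = 0"
  "pderivs seq_shift [0, Suc 0] (\<lambda>x. x 0 * x (Suc 0)) x = 1"
  "pderivs seq_shift [Suc 0, 0] (\<lambda>x. x 0 * x (Suc 0)) x = 1"
  "pderivs seq_shift [Suc 0, Suc 0] (\<lambda>x. x 0 * x (Suc 0)) x = 0"
    by (simp_all add: seq_shift_def 0 1)
qed

section \<open>The algebra of simple functionals\<close>

lemma in_Lp_finite:
  assumes "in_Lp M p X"
  shows "X \<in> borel_measurable M" "(\<integral>\<^sup>+ \<omega>. ennreal (norm (X \<omega>) powr p) \<partial>M) < \<infinity>"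
  using assms unfolding in_Lp_def Lp_norm_def Let_def
  by (auto simp: less_top split: if_splits)

lemma in_Lp_integrable_power:
  assumes "in_Lp M (real k) X" "k > 0"
  shows "integrable M (\<lambda>\<omega>. norm (X \<omega>) ^ k)"
proof -
  have [measurable]: "X \<in> borel_measurable M" by (rule in_Lp_finite[OF assms(1)])
  have "norm (X \<omega>) powr real k = norm (X \<omega>) ^ k" for \<omega>
    using assms(2) by (cases "norm (X \<omega>) = 0") (auto simp: powr_realpow)
  then show ?thesis
    using in_Lp_finite(2)[OF assms(1)] by (intro integrableI_bounded) auto
qed

context ibp_framework
begin

lemma S_borel [measurable]: "F \<in> S \<Longrightarrow> F \<in> borel_measurable M"
  using S_Lp[of F 1] in_Lp_finite(1) by auto

lemma D_borel [measurable]: "F \<in> S \<Longrightarrow> D F \<in> borel_measurable M"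
  using D_Lp[of F 1] in_Lp_finite(1) by auto

lemma S_integrable: "F \<in> S \<Longrightarrow> integrable M F"
  using S_Lp[of F 1] in_Lp_integrable_power[of M 1 F]
  by (auto intro: integrable_norm_cancel)

lemma S_scale: "F \<in> S \<Longrightarrow> (\<lambda>\<omega>. c * F \<omega>) \<in> S"
  using S_lin[of F F c 0] by simp

lemma S_add: "F \<in> S \<Longrightarrow> G \<in> S \<Longrightarrow> (\<lambda>\<omega>. F \<omega> + G \<omega>) \<in> S"
  using S_lin[of F G 1 1] by simp

lemma S_diff: "F \<in> S \<Longrightarrow> G \<in> S \<Longrightarrow> (\<lambda>\<omega>. F \<omega> - G \<omega>) \<in> S"
  using S_lin[of F G 1 "-1"] by simp

text \<open>A constant is a function of zero variables, so smooth stability applies with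
  \<open>n = 0\<close>; the chain rule in \<open>D_const\<close> then has an empty sum.\<close>

lemma S_const: "(\<lambda>\<omega>. c) \<in> S"
proof -
  have "Cp_inf 0 (\<lambda>x. c)"
    by (rule Cp_inf_if_closed[where \<G> = "{\<lambda>x. c}"]) (auto intro: exI[of _ "\<bar>c\<bar>"] exI[of _ 0])
  from S_smooth[OF _ this] show ?thesis by simp
qed

lemma S_mult: assumes "F \<in> S" "G \<in> S" shows "(\<lambda>\<omega>. F \<omega> * G \<omega>) \<in> S"
  using S_smooth[OF _ Cp_inf_mult, of "\<lambda>i. if i = 0 then F else G"] assms by auto

lemma S_sum: "finite A \<Longrightarrow> (\<And>a. a \<in> A \<Longrightarrow> U a \<in> S) \<Longrightarrow> (\<lambda>\<omega>. \<Sum>a\<in>A. U a \<omega>) \<in> S"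
  by (induction A rule: finite_induct) (auto intro: S_add S_zero)

lemma S_power: "U \<in> S \<Longrightarrow> (\<lambda>\<omega>. U \<omega> ^ k) \<in> S"
  by (induction k) (auto intro: S_mult S_const)

lemma S_compose: "smooth_class \<G> \<Longrightarrow> g \<in> \<G> \<Longrightarrow> F \<in> S \<Longrightarrow> (\<lambda>\<omega>. g (F \<omega>)) \<in> S"
  using S_smooth[OF _ Cp_inf_one, of "\<lambda>_. F"] by auto

lemma D_compose:
  assumes "smooth_class \<G>" "g \<in> \<G>" "F \<in> S" "\<And>x. (g has_real_derivative g' x) (at x)"
  shows "AE \<omega> in M. D (\<lambda>\<omega>. g (F \<omega>)) \<omega> = g' (F \<omega>) *\<^sub>R D F \<omega>"
  using D_chain[of 1 "\<lambda>_. F" "\<lambda>x. g (x 0)"] Cp_inf_one[OF assms(1,2)] S_compose[OF assms(1-3)] assms(3)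
  by (simp add: Cp_inf_def pderivs_one[OF assms(4)] del: pderivs.simps)

lemma D_mult:
  assumes "F \<in> S" "G \<in> S"
  shows "AE \<omega> in M. D (\<lambda>\<omega>. F \<omega> * G \<omega>) \<omega> = F \<omega> *\<^sub>R D G \<omega> + G \<omega> *\<^sub>R D F \<omega>"
  using D_chain[of 2 "\<lambda>i. if i = 0 then F else G" "\<lambda>x. x 0 * x 1"] Cp_inf_mult S_mult[OF assms] assms
  by (simp add: Cp_inf_def pderivs_mult numeral_2_eq_2 add.commute del: pderivs.simps)

lemma D_const: "AE \<omega> in M. D (\<lambda>\<omega>. c) \<omega> = 0"
proof -
  have "Cp_inf 0 (\<lambda>x. c)"
    by (rule Cp_inf_if_closed[where \<G> = "{\<lambda>x. c}"]) (auto intro: exI[of _ "\<bar>c\<bar>"] exI[of _ 0])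
  then show ?thesis using D_chain[of 0 "\<lambda>_. undefined" "\<lambda>x. c"] S_const by (simp add: Cp_inf_def)
qed

lemma D_sum:
  "finite A \<Longrightarrow> (\<And>a. a \<in> A \<Longrightarrow> U a \<in> S) \<Longrightarrow> (AE \<omega> in M. D (\<lambda>\<omega>. \<Sum>a\<in>A. U a \<omega>) \<omega> = (\<Sum>a\<in>A. D (U a) \<omega>))"
proof (induction A rule: finite_induct)
  case empty
  then show ?case using D_const[of 0] by simp
next
  case (insert a A)
  have "AE \<omega> in M. D (\<lambda>\<omega>. 1 * U a \<omega> + 1 * (\<Sum>a\<in>A. U a \<omega>)) \<omega> = 1 *\<^sub>R D (U a) \<omega> + 1 *\<^sub>R D (\<lambda>\<omega>. \<Sum>a\<in>A. U a \<omega>) \<omega>"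
    using insert.prems insert.hyps by (intro D_lin S_sum) auto
  moreover have "AE \<omega> in M. D (\<lambda>\<omega>. \<Sum>a\<in>A. U a \<omega>) \<omega> = (\<Sum>a\<in>A. D (U a) \<omega>)"
    using insert by auto
  ultimately have "AE \<omega> in M. D (\<lambda>\<omega>. U a \<omega> + (\<Sum>a\<in>A. U a \<omega>)) \<omega> = D (U a) \<omega> + (\<Sum>a\<in>A. D (U a) \<omega>)"
    by eventually_elim simp
  then show ?case using insert.hyps by simp
qed

lemma D_scale: "F \<in> S \<Longrightarrow> AE \<omega> in M. D (\<lambda>\<omega>. c * F \<omega>) \<omega> = c *\<^sub>R D F \<omega>"
  using D_lin[of F F c 0] by simp

lemma D_add: "F \<in> S \<Longrightarrow> G \<in> S \<Longrightarrow> AE \<omega> in M. D (\<lambda>\<omega>. F \<omega> + G \<omega>) \<omega> = D F \<omega> + D G \<omega>"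
  using D_lin[of F G 1 1] by simp

lemma D_diff: "F \<in> S \<Longrightarrow> G \<in> S \<Longrightarrow> AE \<omega> in M. D (\<lambda>\<omega>. F \<omega> - G \<omega>) \<omega> = D F \<omega> - D G \<omega>"
  using D_lin[of F G 1 "-1"] by simp

section \<open>The carre du champ operator\<close>

definition \<Gamma> :: "('w \<Rightarrow> real) \<Rightarrow> ('w \<Rightarrow> real) \<Rightarrow> 'w \<Rightarrow> real" where
  "\<Gamma> F G = (\<lambda>\<omega>. D F \<omega> \<bullet> D G \<omega>)"

text \<open>Membership is read off the second order chain rule \<open>L(FG) = F LG + G LF - 2 \<Gamma>(F, G)\<close>.\<close>

lemma \<Gamma>_S:
  assumes "F \<in> S" "G \<in> S"
  shows "\<Gamma> F G \<in> S"
proof -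
  have "AE \<omega> in M. L (\<lambda>\<omega>. F \<omega> * G \<omega>) \<omega> = G \<omega> * L F \<omega> + F \<omega> * L G \<omega> - 2 * \<Gamma> F G \<omega>"
    using L_chain[of 2 "\<lambda>i. if i = 0 then F else G" "\<lambda>x. x 0 * x 1"] Cp_inf_mult S_mult[OF assms] assms
    by (simp add: Cp_inf_def pderivs_mult numeral_2_eq_2 \<Gamma>_def inner_commute del: pderivs.simps)
  then have "AE \<omega> in M. (1/2) * (G \<omega> * L F \<omega> + F \<omega> * L G \<omega>) + (-1/2) * L (\<lambda>\<omega>. F \<omega> * G \<omega>) \<omega> = \<Gamma> F G \<omega>"
    by eventually_elim (simp add: field_simps)
  moreover have "\<Gamma> F G \<in> borel_measurable M" unfolding \<Gamma>_def using assms by measurable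
  moreover have "(\<lambda>\<omega>. (1/2) * (G \<omega> * L F \<omega> + F \<omega> * L G \<omega>) + (-1/2) * L (\<lambda>\<omega>. F \<omega> * G \<omega>) \<omega>) \<in> S"
    using assms by (intro S_lin S_add S_mult L_S)
  ultimately show ?thesis using S_AE by blast
qed

lemma \<Gamma>_cong:
  assumes "F \<in> S" "F' \<in> S" "AE \<omega> in M. F \<omega> = F' \<omega>"
  shows "AE \<omega> in M. \<Gamma> F G \<omega> = \<Gamma> F' G \<omega>"
  using D_AE[OF assms] by eventually_elim (simp add: \<Gamma>_def)

lemma \<Gamma>_mult:
  "F \<in> S \<Longrightarrow> G \<in> S \<Longrightarrow> AE \<omega> in M. \<Gamma> (\<lambda>\<omega>. F \<omega> * G \<omega>) H \<omega> = F \<omega> * \<Gamma> G H \<omega> + G \<omega> * \<Gamma> F H \<omega>"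
  by (drule (1) D_mult, erule eventually_mono) (simp add: \<Gamma>_def inner_simps)

lemma \<Gamma>_add:
  "F \<in> S \<Longrightarrow> G \<in> S \<Longrightarrow> AE \<omega> in M. \<Gamma> (\<lambda>\<omega>. F \<omega> + G \<omega>) H \<omega> = \<Gamma> F H \<omega> + \<Gamma> G H \<omega>"
  by (drule (1) D_add, erule eventually_mono) (simp add: \<Gamma>_def inner_simps)

lemma \<Gamma>_sum:
  "finite A \<Longrightarrow> (\<And>a. a \<in> A \<Longrightarrow> U a \<in> S) \<Longrightarrow>
    AE \<omega> in M. \<Gamma> (\<lambda>\<omega>. \<Sum>a\<in>A. U a \<omega>) H \<omega> = (\<Sum>a\<in>A. \<Gamma> (U a) H \<omega>)"
  using D_sum[of A U] by (auto simp: \<Gamma>_def inner_sum_left elim!: eventually_mono)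

lemma \<Gamma>_const: "AE \<omega> in M. \<Gamma> (\<lambda>\<omega>. c) H \<omega> = 0"
  using D_const[of c] by eventually_elim (simp add: \<Gamma>_def)

lemma \<Gamma>_compose:
  assumes "smooth_class \<G>" "g \<in> \<G>" "F \<in> S" "\<And>x. (g has_real_derivative g' x) (at x)"
  shows "AE \<omega> in M. \<Gamma> (\<lambda>\<omega>. g (F \<omega>)) H \<omega> = g' (F \<omega>) * \<Gamma> F H \<omega>"
  using D_compose[OF assms] by eventually_elim (simp add: \<Gamma>_def)

text \<open>Duality is applied to the product \<open>Y W\<close> with \<open>Z\<close>, and
  \<Gamma>(YW, Z) is expanded by Leibniz' rule; the derivation moves from \<open>Y\<close> to
  \<open>W\<close> at the price of a term with \<open>L Z\<close>.\<close>

lemma \<Gamma>_ibp: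
  assumes "W \<in> S" "Y \<in> S" "Z \<in> S"
  shows "expectation (\<lambda>\<omega>. W \<omega> * \<Gamma> Y Z \<omega>) = expectation (\<lambda>\<omega>. Y \<omega> * (W \<omega> * L Z \<omega> - \<Gamma> W Z \<omega>))"
proof -
  have YW: "(\<lambda>\<omega>. Y \<omega> * W \<omega>) \<in> S" using assms by (intro S_mult)
  have i: "integrable M (\<lambda>\<omega>. Y \<omega> * \<Gamma> W Z \<omega>)" "integrable M (\<lambda>\<omega>. W \<omega> * \<Gamma> Y Z \<omega>)"
     "integrable M (\<lambda>\<omega>. Y \<omega> * W \<omega> * L Z \<omega>)"
    using assms by (auto intro!: S_integrable S_mult \<Gamma>_S L_S)
  have "expectation (\<lambda>\<omega>. Y \<omega> * W \<omega> * L Z \<omega>) = expectation (\<Gamma> (\<lambda>\<omega>. Y \<omega> * W \<omega>) Z)"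
    using L_dual(1)[OF YW assms(3)] by (simp add: \<Gamma>_def)
  also have "\<dots> = expectation (\<lambda>\<omega>. Y \<omega> * \<Gamma> W Z \<omega> + W \<omega> * \<Gamma> Y Z \<omega>)"
    using assms by (intro integral_cong_AE \<Gamma>_mult) (auto intro!: S_borel S_add S_mult \<Gamma>_S)
  finally show ?thesis using i by (simp add: algebra_simps)
qed

end

section \<open>Exhaustion of a separable inner product space\<close>

definition orthonormal :: "'h::real_inner set \<Rightarrow> bool" where
  "orthonormal B \<longleftrightarrow> finite B \<and> pairwise orthogonal B \<and> (\<forall>b\<in>B. norm b = 1)"

definition proj :: "'h::real_inner set \<Rightarrow> 'h \<Rightarrow> 'h" where
  "proj B x = (\<Sum>b\<in>B. (x \<bullet> b) *\<^sub>R b)"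

lemma proj_inner_basis:
  assumes "orthonormal B" "c \<in> B"
  shows "proj B x \<bullet> c = x \<bullet> c"
proof -
  have "proj B x \<bullet> c = (\<Sum>b\<in>B. if b = c then x \<bullet> c else 0)"
    unfolding proj_def inner_sum_left using assms
    by (intro sum.cong) (auto simp: orthonormal_def pairwise_def orthogonal_def dot_square_norm)
  then show ?thesis using assms by (simp add: orthonormal_def)
qed

lemma proj_inner: "proj B x \<bullet> y = (\<Sum>b\<in>B. (x \<bullet> b) * (y \<bullet> b))"
  unfolding proj_def inner_sum_left by (intro sum.cong) (simp_all add: inner_commute)

lemma proj_inner_proj: "orthonormal B \<Longrightarrow> proj B x \<bullet> proj B y = proj B x \<bullet> y"
  unfolding proj_inner[of B x] by (intro sum.cong) (simp_all add: proj_inner_basis)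

lemma proj_norm_le: assumes "orthonormal B" shows "norm (proj B x) \<le> norm x"
proof -
  have "norm (proj B x) * norm (proj B x) = proj B x \<bullet> x"
    using proj_inner_proj[OF assms, of x x] by (metis dot_square_norm power2_eq_square)
  also have "\<dots> \<le> norm (proj B x) * norm x" by (rule norm_cauchy_schwarz)
  finally show ?thesis by (cases "proj B x = 0") auto
qed

lemma Bessel_ineq: assumes "orthonormal B" shows "(\<Sum>b\<in>B. (x \<bullet> b)\<^sup>2) \<le> (norm x)\<^sup>2"
proof -
  have "(\<Sum>b\<in>B. (x \<bullet> b)\<^sup>2) = proj B x \<bullet> x" by (simp add: proj_inner power2_eq_square)
  also have "\<dots> \<le> norm (proj B x) * norm x" by (rule norm_cauchy_schwarz)
  also have "\<dots> \<le> (norm x)\<^sup>2"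
    using proj_norm_le[OF assms] by (simp add: power2_eq_square mult_right_mono)
  finally show ?thesis .
qed

lemma proj_diff: "proj B (x - y) = proj B x - proj B y"
  by (simp add: proj_def inner_diff_left scaleR_diff_left sum_subtractf)

text \<open>A fixed point of \<open>proj B\<close> lies in the span of \<open>B\<close>, so the
  residual is orthogonal to \<open>proj B x - v\<close> and Pythagoras applies.\<close>

lemma proj_best_approx:
  assumes B: "orthonormal B" and v: "proj B v = v"
  shows "norm (x - proj B x) \<le> norm (x - v)"
proof -
  have "(x - proj B x) \<bullet> (proj B x - v) = 0"
    using proj_inner_proj[OF B, of "x - v" x] v
    by (simp add: inner_diff_left inner_diff_right proj_diff inner_commute)
  then have "(norm (x - proj B x))\<^sup>2 + (norm (proj B x - v))\<^sup>2 = (norm (x - v))\<^sup>2"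
    using norm_add_Pythagorean[of "x - proj B x" "proj B x - v"] by (simp add: orthogonal_def)
  then have "(norm (x - proj B x))\<^sup>2 \<le> (norm (x - v))\<^sup>2"
    using zero_le_power2[of "norm (proj B x - v)"] by linarith
  then show ?thesis by (rule power2_le_imp_le) simp
qed

text \<open>The vectors added to \<open>B\<close> are orthogonal to its span, so they contribute
  zero coefficients to a vector in that span.\<close>

lemma proj_fixed_mono:
  assumes "orthonormal B'" "B \<subseteq> B'" "proj B v = v"
  shows "proj B' v = v"
proof -
  have "v \<bullet> b = 0" if "b \<in> B' - B" for b
  proof -
    have "proj B v \<bullet> b = 0" unfolding proj_def inner_sum_left
      by (rule sum.neutral) (use that assms in \<open>auto simp: orthonormal_def pairwise_def orthogonal_def\<close>)
    then show ?thesis using assms by simp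
  qed
  then have "proj B' v = proj B v" unfolding proj_def
    using assms by (intro sum.mono_neutral_right) (auto simp: orthonormal_def)
  then show ?thesis using assms by simp
qed

text \<open>One step of Gram-Schmidt: the normalised residual of \<open>v\<close> is added, and if
  the residual vanishes \<open>B\<close> itself serves.\<close>

lemma orthonormal_insert:
  assumes B: "orthonormal B"
  shows "\<exists>B'. orthonormal B' \<and> B \<subseteq> B' \<and> proj B' v = v"
proof (cases "v - proj B v = 0")
  case True
  then show ?thesis using B by auto
next
  case False
  define r where "r = v - proj B v"
  define c where "c = r /\<^sub>R norm r"
  have r0: "r \<noteq> 0" using False by (simp add: r_def)
  have rb: "r \<bullet> b = 0" if "b \<in> B" for b
    using proj_inner_basis[OF B that] by (simp add: r_def inner_diff_left)
  have cB: "c \<notin> B"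
  proof
    assume "c \<in> B"
    from rb[OF this] r0 show False by (simp add: c_def)
  qed
  have on: "orthonormal (insert c B)"
    unfolding orthonormal_def
  proof (intro conjI)
    show "pairwise orthogonal (insert c B)"
      using B rb by (auto simp: pairwise_insert orthonormal_def orthogonal_def c_def inner_commute)
  qed (use B r0 in \<open>auto simp: orthonormal_def c_def\<close>)
  have "v = proj B v + norm r *\<^sub>R c" using r0 by (simp add: c_def r_def)
  moreover have "v \<bullet> c = norm r"
  proof -
    have "proj B v \<bullet> c = 0"
      unfolding proj_def inner_sum_left c_def using rb by (intro sum.neutral) (auto simp: inner_commute)
    moreover have "r \<bullet> c = norm r" using r0 by (simp add: c_def dot_square_norm power2_eq_square)
    ultimately show ?thesis by (simp add: r_def inner_diff_left)
  qed
  ultimately have "proj (insert c B) v = v"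
    using cB B by (simp add: proj_def orthonormal_def add.commute)
  then show ?thesis using on by blast
qed

text \<open>An orthonormal basis presented as an increasing sequence of finite sets, with Parseval's
  identity as completeness. Finite sets keep all sums of directional derivatives inside
  \<open>S\<close>; the sequence may become stationary, so finite-dimensional spaces are
  covered.\<close>

definition exhausting :: "(nat \<Rightarrow> 'h::real_inner set) \<Rightarrow> bool" where
  "exhausting B \<longleftrightarrow> (\<forall>N. orthonormal (B N)) \<and> mono B \<and>
     (\<forall>x y. (\<lambda>N. \<Sum>b\<in>B N. (x \<bullet> b) * (y \<bullet> b)) \<longlonglongrightarrow> x \<bullet> y)"

text \<open>Gram-Schmidt along a dense sequence \<open>h\<close>: the span at stage
  \<open>Suc n\<close> contains \<open>h n\<close>, so best approximation and density force the
  projections of any vector to converge to it.\<close>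

lemma exhausting_exists: "\<exists>B::nat \<Rightarrow> 'h::{real_inner, second_countable_topology} set. exhausting B"
proof -
  obtain E :: "'h set" where E: "countable E" "\<And>X. open X \<Longrightarrow> X \<noteq> {} \<Longrightarrow> \<exists>d\<in>E. d \<in> X"
    using countable_dense_exists by blast
  have "E \<noteq> {}" using E(2)[of UNIV] by auto
  define h where "h = from_nat_into E"
  have h: "range h = E" using E(1) \<open>E \<noteq> {}\<close> by (simp add: h_def range_from_nat_into)
  have "\<exists>B. \<forall>n. orthonormal (B n) \<and> (B n \<subseteq> B (Suc n) \<and> proj (B (Suc n)) (h n) = h n)"
    by (rule dependent_nat_choice) (auto intro: exI[of _ "{}"] orthonormal_insert simp: orthonormal_def[of "{}"])
  then obtain B where B: "\<And>n. orthonormal (B n)" "\<And>n. B n \<subseteq> B (Suc n)" "\<And>n. proj (B (Suc n)) (h n) = h n"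
    by blast
  have mono: "mono B" using B(2) by (intro incseq_SucI)
  have "(\<lambda>N. \<Sum>b\<in>B N. (x \<bullet> b) * (y \<bullet> b)) \<longlonglongrightarrow> x \<bullet> y" for x y
  proof -
    have "(\<lambda>N. proj (B N) x) \<longlonglongrightarrow> x"
    proof (rule LIMSEQ_I)
      fix e :: real assume "e > 0"
      then obtain n where n: "dist x (h n) < e" using E(2)[of "ball x e"] h by auto
      have "norm (proj (B N) x - x) < e" if "N \<ge> Suc n" for N
        using proj_best_approx[OF B(1) proj_fixed_mono[OF B(1) monoD[OF mono that] B(3)], of x] n
        by (simp add: dist_norm norm_minus_commute)
      then show "\<exists>no. \<forall>N\<ge>no. norm (proj (B N) x - x) < e" by blast
    qed
    then have "(\<lambda>N. proj (B N) x \<bullet> y) \<longlonglongrightarrow> x \<bullet> y" by (intro tendsto_intros)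
    then show ?thesis by (simp add: proj_inner)
  qed
  then show ?thesis using B(1) mono by (auto simp: exhausting_def)
qed

definition onb :: "nat \<Rightarrow> 'h::{real_inner, second_countable_topology} set" where
  "onb = (SOME B. exhausting B)"

lemma exhausting_onb: "exhausting onb"
  unfolding onb_def by (rule someI_ex[OF exhausting_exists])

lemma orthonormal_onb: "orthonormal (onb N)"
  and onb_mono: "N \<le> N' \<Longrightarrow> onb N \<subseteq> onb N'"
  and onb_tendsto: "(\<lambda>N. \<Sum>b\<in>onb N. (x \<bullet> b) * (y \<bullet> b)) \<longlonglongrightarrow> x \<bullet> y"
  using exhausting_onb unfolding exhausting_def mono_def by auto

lemma finite_onb [simp]: "finite (onb N)"
  using orthonormal_onb orthonormal_def by blast

section \<open>Truncated Sobolev norms\<close>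

context ibp_framework
begin

text \<open>The squared Sobolev norm of order \<open>m\<close> at a point, with directions
  restricted to \<open>B\<close>: the sum of the squares of all iterated derivatives along words
  over \<open>B\<close> of length at most \<open>m\<close>. The recursion splits off the first
  derivative, which suits induction by Leibniz' rule.\<close>

primrec sq :: "'h set \<Rightarrow> nat \<Rightarrow> ('w \<Rightarrow> real) \<Rightarrow> 'w \<Rightarrow> real" where
  "sq B 0 G = (\<lambda>\<omega>. (G \<omega>)\<^sup>2)"
| "sq B (Suc m) G = (\<lambda>\<omega>. (G \<omega>)\<^sup>2 + (\<Sum>b\<in>B. sq B m (\<lambda>\<omega>. D G \<omega> \<bullet> b) \<omega>))"

lemma sq_nonneg: "0 \<le> sq B m G \<omega>"
  by (induction m arbitrary: G) (auto intro!: add_nonneg_nonneg sum_nonneg)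

lemma sq_S: "finite B \<Longrightarrow> G \<in> S \<Longrightarrow> sq B m G \<in> S"
proof (induction m arbitrary: G)
  case 0 then show ?case by (auto intro: S_power)
next
  case (Suc m) then show ?case by (auto intro!: S_add S_sum S_power D_dir)
qed

lemma sq_Suc_ge: "sq B m G \<omega> \<le> sq B (Suc m) G \<omega>"
proof (induction m arbitrary: G)
  case 0 show ?case by (auto intro: sum_nonneg)
next
  case (Suc m)
  have "(\<Sum>b\<in>B. sq B m (\<lambda>\<omega>. D G \<omega> \<bullet> b) \<omega>) \<le> (\<Sum>b\<in>B. sq B (Suc m) (\<lambda>\<omega>. D G \<omega> \<bullet> b) \<omega>)"
    by (intro sum_mono Suc)
  then show ?case by simp
qed

lemma sq_mono: "m \<le> n \<Longrightarrow> sq B m G \<omega> \<le> sq B n G \<omega>"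
  by (rule lift_Suc_mono_le[where f = "\<lambda>m. sq B m G \<omega>"]) (auto simp del: sq.simps intro: sq_Suc_ge)

lemma D_dir_cong:
  assumes "F \<in> S" "G \<in> S" "AE \<omega> in M. F \<omega> = G \<omega>"
  shows "AE \<omega> in M. D F \<omega> \<bullet> h = D G \<omega> \<bullet> h"
  using D_AE[OF assms] by eventually_elim simp

lemma sq_cong:
  "finite B \<Longrightarrow> F \<in> S \<Longrightarrow> G \<in> S \<Longrightarrow> (AE \<omega> in M. F \<omega> = G \<omega>) \<Longrightarrow> AE \<omega> in M. sq B m F \<omega> = sq B m G \<omega>"
proof (induction m arbitrary: F G)
  case 0
  from 0(4) show ?case by eventually_elim simp
next
  case (Suc m)
  have "AE \<omega> in M. \<forall>b\<in>B. sq B m (\<lambda>\<omega>. D F \<omega> \<bullet> b) \<omega> = sq B m (\<lambda>\<omega>. D G \<omega> \<bullet> b) \<omega>"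
    using Suc.prems by (intro AE_finite_allI Suc.IH D_dir D_dir_cong) auto
  with Suc.prems(4) show ?case by eventually_elim simp
qed

text \<open>Differentiation is linear, so the inequality between (a + b)^2 and 2 a^2 + 2 b^2 applies
  to each derivative separately; hence the factor 2 is the same for every \<open>m\<close>.\<close>

lemma sq_add:
  "finite B \<Longrightarrow> F \<in> S \<Longrightarrow> G \<in> S \<Longrightarrow> AE \<omega> in M. sq B m (\<lambda>\<omega>. F \<omega> + G \<omega>) \<omega> \<le> 2 * sq B m F \<omega> + 2 * sq B m G \<omega>"
proof (induction m arbitrary: F G)
  case 0
  show ?case by (rule AE_I2) (use sum_squares_bound[where ?'a = real] in \<open>auto simp: power2_sum add.commute\<close>)
next
  case (Suc m)
  have "AE \<omega> in M. sq B m (\<lambda>\<omega>. D (\<lambda>\<omega>. F \<omega> + G \<omega>) \<omega> \<bullet> b) \<omega>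
     \<le> 2 * sq B m (\<lambda>\<omega>. D F \<omega> \<bullet> b) \<omega> + 2 * sq B m (\<lambda>\<omega>. D G \<omega> \<bullet> b) \<omega>" for b
  proof -
    have "AE \<omega> in M. D (\<lambda>\<omega>. F \<omega> + G \<omega>) \<omega> \<bullet> b = D F \<omega> \<bullet> b + D G \<omega> \<bullet> b"
      using D_add[OF Suc.prems(2,3)] by eventually_elim (simp add: inner_simps)
    then have "AE \<omega> in M. sq B m (\<lambda>\<omega>. D (\<lambda>\<omega>. F \<omega> + G \<omega>) \<omega> \<bullet> b) \<omega> = sq B m (\<lambda>\<omega>. D F \<omega> \<bullet> b + D G \<omega> \<bullet> b) \<omega>"
      using Suc.prems by (intro sq_cong) (auto intro: D_dir S_add)
    moreover have "AE \<omega> in M. sq B m (\<lambda>\<omega>. D F \<omega> \<bullet> b + D G \<omega> \<bullet> b) \<omega>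
      \<le> 2 * sq B m (\<lambda>\<omega>. D F \<omega> \<bullet> b) \<omega> + 2 * sq B m (\<lambda>\<omega>. D G \<omega> \<bullet> b) \<omega>"
      using Suc.prems by (intro Suc.IH) (auto intro: D_dir)
    ultimately show ?thesis by eventually_elim simp
  qed
  then have "AE \<omega> in M. \<forall>b\<in>B. sq B m (\<lambda>\<omega>. D (\<lambda>\<omega>. F \<omega> + G \<omega>) \<omega> \<bullet> b) \<omega>
     \<le> 2 * sq B m (\<lambda>\<omega>. D F \<omega> \<bullet> b) \<omega> + 2 * sq B m (\<lambda>\<omega>. D G \<omega> \<bullet> b) \<omega>"
    using Suc.prems by (intro AE_finite_allI) auto
  then show ?case
  proof eventually_elim
    case (elim \<omega>)
    have "(\<Sum>b\<in>B. sq B m (\<lambda>\<omega>. D (\<lambda>\<omega>. F \<omega> + G \<omega>) \<omega> \<bullet> b) \<omega>) \<le>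
       (\<Sum>b\<in>B. 2 * sq B m (\<lambda>\<omega>. D F \<omega> \<bullet> b) \<omega> + 2 * sq B m (\<lambda>\<omega>. D G \<omega> \<bullet> b) \<omega>)"
      using elim by (intro sum_mono) auto
    then show ?case using sum_squares_bound[of "F \<omega>" "G \<omega>"]
      by (simp add: power2_sum sum.distrib sum_distrib_left)
  qed
qed

text \<open>Cauchy-Schwarz over \<open>A\<close>, propagated to derivatives by Leibniz' rule. The
  constant is independent of the size of \<open>A\<close> and of \<open>B\<close>, which lets the
  truncation sets grow later.\<close>

lemma sq_sum_mult:
  assumes "finite B" "finite A"
  shows "(\<And>a. a \<in> A \<Longrightarrow> U a \<in> S) \<Longrightarrow> (\<And>a. a \<in> A \<Longrightarrow> V a \<in> S) \<Longrightarrow>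
    AE \<omega> in M. sq B m (\<lambda>\<omega>. \<Sum>a\<in>A. U a \<omega> * V a \<omega>) \<omega>
      \<le> 5 ^ m * ((\<Sum>a\<in>A. sq B m (U a) \<omega>) * (\<Sum>a\<in>A. sq B m (V a) \<omega>))"
proof (induction m arbitrary: U V)
  case 0
  show ?case by (auto intro: Cauchy_Schwarz_ineq_sum)
next
  case (Suc m)
  note [simp] = Suc.prems
  let ?D = "\<lambda>b U \<omega>. D U \<omega> \<bullet> b"
  have "AE \<omega> in M. sq B m (?D b (\<lambda>\<omega>. \<Sum>a\<in>A. U a \<omega> * V a \<omega>)) \<omega> \<le>
      2 * (5 ^ m * ((\<Sum>a\<in>A. sq B m (?D b (U a)) \<omega>) * (\<Sum>a\<in>A. sq B m (V a) \<omega>))) +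
      2 * (5 ^ m * ((\<Sum>a\<in>A. sq B m (U a) \<omega>) * (\<Sum>a\<in>A. sq B m (?D b (V a)) \<omega>)))" for b
  proof -
    let ?P = "\<lambda>\<omega>. \<Sum>a\<in>A. ?D b (U a) \<omega> * V a \<omega>" and ?Q = "\<lambda>\<omega>. \<Sum>a\<in>A. U a \<omega> * ?D b (V a) \<omega>"
    have PQ: "?P \<in> S" "?Q \<in> S" using assms by (auto intro!: S_sum S_mult D_dir)
    have UV: "(\<lambda>\<omega>. \<Sum>a\<in>A. U a \<omega> * V a \<omega>) \<in> S" using assms by (auto intro!: S_sum S_mult)
    have "AE \<omega> in M. D (\<lambda>\<omega>. \<Sum>a\<in>A. U a \<omega> * V a \<omega>) \<omega> = (\<Sum>a\<in>A. D (\<lambda>\<omega>. U a \<omega> * V a \<omega>) \<omega>)"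
      using assms by (intro D_sum) (auto intro: S_mult)
    moreover have "AE \<omega> in M. \<forall>a\<in>A. D (\<lambda>\<omega>. U a \<omega> * V a \<omega>) \<omega> = U a \<omega> *\<^sub>R D (V a) \<omega> + V a \<omega> *\<^sub>R D (U a) \<omega>"
      using assms by (intro AE_finite_allI D_mult) auto
    ultimately have "AE \<omega> in M. ?D b (\<lambda>\<omega>. \<Sum>a\<in>A. U a \<omega> * V a \<omega>) \<omega> = ?P \<omega> + ?Q \<omega>"
      by eventually_elim (simp add: inner_simps inner_sum_left sum.distrib mult.commute add.commute)
    then have "AE \<omega> in M. sq B m (?D b (\<lambda>\<omega>. \<Sum>a\<in>A. U a \<omega> * V a \<omega>)) \<omega> = sq B m (\<lambda>\<omega>. ?P \<omega> + ?Q \<omega>) \<omega>"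
      using assms UV PQ by (intro sq_cong D_dir S_add)
    moreover have "AE \<omega> in M. sq B m (\<lambda>\<omega>. ?P \<omega> + ?Q \<omega>) \<omega> \<le> 2 * sq B m ?P \<omega> + 2 * sq B m ?Q \<omega>"
      using assms PQ by (intro sq_add)
    moreover have "AE \<omega> in M. sq B m ?P \<omega> \<le> 5 ^ m * ((\<Sum>a\<in>A. sq B m (?D b (U a)) \<omega>) * (\<Sum>a\<in>A. sq B m (V a) \<omega>))"
      by (rule Suc.IH) (auto intro: D_dir)
    moreover have "AE \<omega> in M. sq B m ?Q \<omega> \<le> 5 ^ m * ((\<Sum>a\<in>A. sq B m (U a) \<omega>) * (\<Sum>a\<in>A. sq B m (?D b (V a)) \<omega>))"
      by (rule Suc.IH) (auto intro: D_dir)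
    ultimately show ?thesis by eventually_elim linarith
  qed
  then have "AE \<omega> in M. \<forall>b\<in>B. sq B m (?D b (\<lambda>\<omega>. \<Sum>a\<in>A. U a \<omega> * V a \<omega>)) \<omega> \<le>
      2 * (5 ^ m * ((\<Sum>a\<in>A. sq B m (?D b (U a)) \<omega>) * (\<Sum>a\<in>A. sq B m (V a) \<omega>))) +
      2 * (5 ^ m * ((\<Sum>a\<in>A. sq B m (U a) \<omega>) * (\<Sum>a\<in>A. sq B m (?D b (V a)) \<omega>)))"
    using assms by (intro AE_finite_allI) auto
  then show ?case
  proof eventually_elim
    case (elim \<omega>)
    define u v where "u = (\<Sum>a\<in>A. (U a \<omega>)\<^sup>2)" and "v = (\<Sum>a\<in>A. (V a \<omega>)\<^sup>2)"
    define r s where "r = (\<Sum>a\<in>A. sq B m (U a) \<omega>)" and "s = (\<Sum>a\<in>A. sq B m (V a) \<omega>)"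
    define X Y where "X = (\<Sum>b\<in>B. \<Sum>a\<in>A. sq B m (?D b (U a)) \<omega>)" and "Y = (\<Sum>b\<in>B. \<Sum>a\<in>A. sq B m (?D b (V a)) \<omega>)"
    define SU SV where "SU = (\<Sum>a\<in>A. sq B (Suc m) (U a) \<omega>)" and "SV = (\<Sum>a\<in>A. sq B (Suc m) (V a) \<omega>)"
    have SU: "SU = u + X" and SV: "SV = v + Y"
      unfolding SU_def SV_def u_def v_def X_def Y_def
      by (simp_all add: sum.distrib) (rule sum.swap)+
    have nn: "0 \<le> u" "0 \<le> v" "0 \<le> r" "0 \<le> s" "0 \<le> X" "0 \<le> Y"
      unfolding u_def v_def r_def s_def X_def Y_def by (auto intro!: sum_nonneg sq_nonneg)
    have rs: "r \<le> SU" "s \<le> SV" unfolding r_def s_def SU_def SV_def by (auto simp del: sq.simps intro!: sum_mono sq_Suc_ge)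
    have "(\<Sum>b\<in>B. sq B m (?D b (\<lambda>\<omega>. \<Sum>a\<in>A. U a \<omega> * V a \<omega>)) \<omega>) \<le>
      (\<Sum>b\<in>B. 2 * (5 ^ m * ((\<Sum>a\<in>A. sq B m (?D b (U a)) \<omega>) * s)) +
      2 * (5 ^ m * (r * (\<Sum>a\<in>A. sq B m (?D b (V a)) \<omega>))))"
      unfolding r_def s_def using elim by (intro sum_mono) auto
    also have "\<dots> = 2 * 5 ^ m * (X * s + r * Y)"
      unfolding X_def Y_def by (simp add: sum.distrib sum_distrib_left sum_distrib_right algebra_simps)
    finally have 1: "(\<Sum>b\<in>B. sq B m (?D b (\<lambda>\<omega>. \<Sum>a\<in>A. U a \<omega> * V a \<omega>)) \<omega>) \<le> 2 * 5 ^ m * (X * s + r * Y)" .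
    have le: "X \<le> SU" "Y \<le> SV" "u \<le> SU" "v \<le> SV" "0 \<le> SU" "0 \<le> SV" using nn SU SV by linarith+
    have "X * s + r * Y \<le> SU * SV + SU * SV"
      by (intro add_mono mult_mono rs le nn)
    then have 2: "2 * 5 ^ m * (X * s + r * Y) \<le> 2 * 5 ^ m * (SU * SV + SU * SV)"
      by (rule mult_left_mono) simp
    have "(\<Sum>a\<in>A. U a \<omega> * V a \<omega>)\<^sup>2 \<le> u * v" unfolding u_def v_def by (rule Cauchy_Schwarz_ineq_sum)
    also have "\<dots> \<le> SU * SV" by (intro mult_mono le nn)
    also have "\<dots> \<le> 5 ^ m * (SU * SV)"
      using mult_right_mono[of 1 "5 ^ m" "SU * SV"] mult_nonneg_nonneg[OF le(5,6)] by simp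
    finally have 3: "(\<Sum>a\<in>A. U a \<omega> * V a \<omega>)\<^sup>2 \<le> 5 ^ m * (SU * SV)" .
    \<comment> \<open>The two Leibniz terms, doubled by \<open>sq_add\<close>, contribute 4 and the
      undifferentiated square contributes 1; this is the origin of the base 5.\<close>
    have "2 * 5 ^ m * (SU * SV + SU * SV) = 4 * (5 ^ m * (SU * SV))" by simp
    with 1 2 3 show ?case unfolding SU_def[symmetric] SV_def[symmetric]
      unfolding sq.simps power_Suc mult.assoc by linarith
  qed
qed

section \<open>Iterated derivatives in the directions \<open>DF\<^sub>j\<close>\<close>

definition \<Gamma>_trunc :: "'h set \<Rightarrow> ('w \<Rightarrow> real) \<Rightarrow> ('w \<Rightarrow> real) \<Rightarrow> 'w \<Rightarrow> real" where
  "\<Gamma>_trunc B G F = (\<lambda>\<omega>. \<Sum>b\<in>B. (D G \<omega> \<bullet> b) * (D F \<omega> \<bullet> b))"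

lemma \<Gamma>_trunc_S: "finite B \<Longrightarrow> G \<in> S \<Longrightarrow> F \<in> S \<Longrightarrow> \<Gamma>_trunc B G F \<in> S"
  unfolding \<Gamma>_trunc_def by (intro S_sum S_mult D_dir)

text \<open>The inner product uses one derivative of each factor, so both are measured one order
  higher. The truncation \<open>B'\<close> may be smaller than the set \<open>B\<close> of the
  measuring norm: one truncation is fixed while the norms are taken with larger sets.\<close>

lemma sq_\<Gamma>_trunc:
  assumes "finite B" "B' \<subseteq> B" "G \<in> S" "F \<in> S"
  shows "AE \<omega> in M. sq B m (\<Gamma>_trunc B' G F) \<omega> \<le> 5 ^ m * (sq B (Suc m) G \<omega> * sq B (Suc m) F \<omega>)"
proof -
  have "AE \<omega> in M. sq B m (\<Gamma>_trunc B' G F) \<omega> \<le> 5 ^ m *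
     ((\<Sum>b\<in>B'. sq B m (\<lambda>\<omega>. D G \<omega> \<bullet> b) \<omega>) * (\<Sum>b\<in>B'. sq B m (\<lambda>\<omega>. D F \<omega> \<bullet> b) \<omega>))"
    unfolding \<Gamma>_trunc_def using assms by (intro sq_sum_mult) (auto intro: D_dir finite_subset)
  then show ?thesis
  proof eventually_elim
    case (elim \<omega>)
    have le: "(\<Sum>b\<in>B'. sq B m (\<lambda>\<omega>. D G \<omega> \<bullet> b) \<omega>) \<le> sq B (Suc m) G \<omega>" for G
    proof -
      have "(\<Sum>b\<in>B'. sq B m (\<lambda>\<omega>. D G \<omega> \<bullet> b) \<omega>) \<le> (\<Sum>b\<in>B. sq B m (\<lambda>\<omega>. D G \<omega> \<bullet> b) \<omega>)"
        using assms by (intro sum_mono2) (auto intro: sq_nonneg)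
      then have "(\<Sum>b\<in>B'. sq B m (\<lambda>\<omega>. D G \<omega> \<bullet> b) \<omega>) \<le> (G \<omega>)\<^sup>2 + (\<Sum>b\<in>B. sq B m (\<lambda>\<omega>. D G \<omega> \<bullet> b) \<omega>)"
        by (rule add_increasing[OF zero_le_power2])
      then show ?thesis by simp
    qed
    have "(\<Sum>b\<in>B'. sq B m (\<lambda>\<omega>. D G \<omega> \<bullet> b) \<omega>) * (\<Sum>b\<in>B'. sq B m (\<lambda>\<omega>. D F \<omega> \<bullet> b) \<omega>)
       \<le> sq B (Suc m) G \<omega> * sq B (Suc m) F \<omega>"
      by (rule mult_mono[OF le le sq_nonneg sum_nonneg]) (rule sq_nonneg)
    from order_trans[OF elim mult_left_mono[OF this]] show ?case by simp
  qed
qed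

text \<open>Pointwise convergence is Parseval's identity. Projections do not increase norms, so the
  sum of the two squared norms dominates every truncation, and its product with \<open>W\<close> is
  integrable because \<open>S\<close> is an algebra.\<close>

lemma \<Gamma>_trunc_tendsto:
  assumes "W \<in> S" "G \<in> S" "F \<in> S"
  shows "(\<lambda>N. expectation (\<lambda>\<omega>. W \<omega> * \<Gamma>_trunc (onb N) G F \<omega>)) \<longlonglongrightarrow> expectation (\<lambda>\<omega>. W \<omega> * \<Gamma> G F \<omega>)"
proof (rule integral_dominated_convergence[where w = "\<lambda>\<omega>. \<bar>W \<omega> * \<Gamma> G G \<omega>\<bar> + \<bar>W \<omega> * \<Gamma> F F \<omega>\<bar>"])
  show "integrable M (\<lambda>\<omega>. \<bar>W \<omega> * \<Gamma> G G \<omega>\<bar> + \<bar>W \<omega> * \<Gamma> F F \<omega>\<bar>)"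
    using assms by (intro Bochner_Integration.integrable_add integrable_abs S_integrable S_mult \<Gamma>_S)
  show "AE \<omega> in M. (\<lambda>N. W \<omega> * \<Gamma>_trunc (onb N) G F \<omega>) \<longlonglongrightarrow> W \<omega> * \<Gamma> G F \<omega>"
    unfolding \<Gamma>_trunc_def \<Gamma>_def by (intro AE_I2 tendsto_mult tendsto_const onb_tendsto)
  fix N
  have "\<bar>\<Gamma>_trunc (onb N) G F \<omega>\<bar> \<le> \<bar>\<Gamma> G G \<omega>\<bar> + \<bar>\<Gamma> F F \<omega>\<bar>" for \<omega>
  proof -
    have "\<bar>\<Gamma>_trunc (onb N) G F \<omega>\<bar> = \<bar>proj (onb N) (D G \<omega>) \<bullet> D F \<omega>\<bar>"
      by (simp add: \<Gamma>_trunc_def proj_inner)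
    also have "\<dots> \<le> norm (proj (onb N) (D G \<omega>)) * norm (D F \<omega>)" by (rule Cauchy_Schwarz_ineq2)
    also have "\<dots> \<le> norm (D G \<omega>) * norm (D F \<omega>)"
      by (intro mult_right_mono proj_norm_le orthonormal_onb) auto
    also have "\<dots> \<le> (norm (D G \<omega>))\<^sup>2 + (norm (D F \<omega>))\<^sup>2"
      using sum_squares_bound[of "norm (D G \<omega>)" "norm (D F \<omega>)"]
        mult_nonneg_nonneg[OF norm_ge_zero[of "D G \<omega>"] norm_ge_zero[of "D F \<omega>"]]
      unfolding mult.assoc by linarith
    finally show ?thesis by (simp add: \<Gamma>_def dot_square_norm)
  qed
  then have "\<bar>W \<omega>\<bar> * \<bar>\<Gamma>_trunc (onb N) G F \<omega>\<bar> \<le> \<bar>W \<omega>\<bar> * (\<bar>\<Gamma> G G \<omega>\<bar> + \<bar>\<Gamma> F F \<omega>\<bar>)" for \<omega>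
    by (rule mult_left_mono) simp
  then show "AE \<omega> in M. norm (W \<omega> * \<Gamma>_trunc (onb N) G F \<omega>) \<le> \<bar>W \<omega> * \<Gamma> G G \<omega>\<bar> + \<bar>W \<omega> * \<Gamma> F F \<omega>\<bar>"
    by (intro AE_I2) (simp add: abs_mult distrib_left)
  show "(\<lambda>\<omega>. W \<omega> * \<Gamma>_trunc (onb N) G F \<omega>) \<in> borel_measurable M"
    by (intro S_borel S_mult \<Gamma>_trunc_S assms finite_onb)
qed (intro S_borel S_mult \<Gamma>_S assms)

end

text \<open>The sum is at most the number of terms times the largest one. The extra 1 covers the
  empty set with exponent 0, where the left side is \<open>0 ^ 0 = 1\<close>.\<close>

lemma sum_power_le_card:
  fixes x :: "'a \<Rightarrow> real"
  assumes "finite A" "\<And>a. a \<in> A \<Longrightarrow> 0 \<le> x a"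
  shows "(\<Sum>a\<in>A. x a) ^ k \<le> real (card A) ^ k * (\<Sum>a\<in>A. x a ^ k) + (if A = {} then 1 else 0)"
proof (cases "A = {}")
  case True then show ?thesis by (cases k) auto
next
  case False
  define m where "m = Max (x ` A)"
  have "m \<in> x ` A" unfolding m_def using assms(1) False by (intro Max_in) auto
  then obtain a0 where a0: "a0 \<in> A" "m = x a0" by auto
  have le: "x a \<le> m" if "a \<in> A" for a unfolding m_def using that assms(1) by (intro Max_ge) auto
  have "(\<Sum>a\<in>A. x a) \<le> real (card A) * m"
    using sum_bounded_above[of A x m] le by auto
  then have "(\<Sum>a\<in>A. x a) ^ k \<le> (real (card A) * m) ^ k"
    by (intro power_mono sum_nonneg assms(2))
  also have "\<dots> = real (card A) ^ k * x a0 ^ k" by (simp add: a0 power_mult_distrib)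
  also have "\<dots> \<le> real (card A) ^ k * (\<Sum>a\<in>A. x a ^ k)"
    using assms a0 by (intro mult_left_mono member_le_sum) auto
  finally show ?thesis using False by simp
qed

lemma power_le_one_plus:
  fixes x :: real assumes "0 \<le> x" "k \<le> n" shows "x ^ k \<le> 1 + x ^ n"
proof (cases "x \<le> 1")
  case True
  then have "x ^ k \<le> 1" using assms by (simp add: power_le_one)
  then show ?thesis using assms by (simp add: add_increasing2)
next
  case False
  then have "x ^ k \<le> x ^ n" using assms by (intro power_increasing) auto
  then show ?thesis by simp
qed

lemma mult_le_sum_squares: "x * y \<le> x\<^sup>2 + y\<^sup>2" for x y :: real
proof -
  have "0 \<le> (x - y / 2)\<^sup>2 + 3 / 4 * y\<^sup>2" by simp
  also have "\<dots> = x\<^sup>2 + y\<^sup>2 - x * y" by (simp add: power2_eq_square algebra_simps)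
  finally show ?thesis by simp
qed

text \<open>If \<open>b\<close> is at most \<open>\<theta> * a\<close>, the first term dominates;
  otherwise \<open>a\<close> is below \<open>b / \<theta>\<close> and the second does. The free
  weight allows the power of \<open>a\<close> to be absorbed on the other side of an
  estimate.\<close>

lemma Young_weighted:
  fixes a b \<theta> :: real
  assumes "0 \<le> a" "0 \<le> b" "0 < \<theta>"
  shows "a ^ n * b \<le> \<theta> * a ^ Suc n + (1 / \<theta>) ^ n * b ^ Suc n"
proof (cases "b \<le> \<theta> * a")
  case True
  then have "a ^ n * b \<le> a ^ n * (\<theta> * a)" using assms by (intro mult_left_mono) auto
  moreover have "0 \<le> (1 / \<theta>) ^ n * b ^ Suc n" using assms by simp
  ultimately show ?thesis by (simp add: algebra_simps)
next
  case False
  then have "a \<le> b / \<theta>" using assms by (simp add: field_simps)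
  then have "a ^ n \<le> (b / \<theta>) ^ n" using assms by (intro power_mono) auto
  then have "a ^ n * b \<le> (b / \<theta>) ^ n * b" using assms by (intro mult_right_mono) auto
  also have "\<dots> = (1 / \<theta>) ^ n * b ^ Suc n" by (simp add: power_divide)
  finally show ?thesis using assms by (simp add: add_increasing)
qed

context ibp_framework
begin

primrec \<Gamma>_iter :: "('i \<Rightarrow> 'w \<Rightarrow> real) \<Rightarrow> 'i list \<Rightarrow> ('w \<Rightarrow> real) \<Rightarrow> 'w \<Rightarrow> real" where
  "\<Gamma>_iter F [] G = G"
| "\<Gamma>_iter F (j # js) G = \<Gamma> (\<Gamma>_iter F js G) (F j)"

text \<open>The last entry of the list acts first; this form exposes the innermost derivation, the
  one that is truncated.\<close>

lemma \<Gamma>_iter_snoc: "\<Gamma>_iter F (js @ [j]) G = \<Gamma>_iter F js (\<Gamma> G (F j))"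
  by (induction js) auto

lemma \<Gamma>_iter_S: "(\<forall>j. F j \<in> S) \<Longrightarrow> G \<in> S \<Longrightarrow> \<Gamma>_iter F js G \<in> S"
  by (induction js) (auto intro: \<Gamma>_S)

text \<open>One application of \<open>\<Gamma>_ibp\<close> per derivation, starting with the
  outermost. The new test functional is built from \<open>W\<close>, \<open>F j\<close> and
  \<open>L (F j)\<close> alone and stays in \<open>S\<close>, so one \<open>W'\<close> serves all
  \<open>G\<close>.\<close>

lemma \<Gamma>_iter_adjoint:
  assumes F: "\<forall>j. F j \<in> S"
  shows "W \<in> S \<Longrightarrow> \<exists>W'\<in>S. \<forall>G\<in>S. expectation (\<lambda>\<omega>. W \<omega> * \<Gamma>_iter F js G \<omega>) = expectation (\<lambda>\<omega>. W' \<omega> * G \<omega>)"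
proof (induction js arbitrary: W)
  case Nil
  then show ?case by auto
next
  case (Cons j js)
  let ?W = "\<lambda>\<omega>. W \<omega> * L (F j) \<omega> - \<Gamma> W (F j) \<omega>"
  have "?W \<in> S" by (intro S_diff S_mult L_S \<Gamma>_S Cons.prems F[rule_format])
  from Cons.IH[OF this] obtain W' where W': "W' \<in> S"
    "\<And>G. G \<in> S \<Longrightarrow> expectation (\<lambda>\<omega>. ?W \<omega> * \<Gamma>_iter F js G \<omega>) = expectation (\<lambda>\<omega>. W' \<omega> * G \<omega>)"
    by blast
  have "expectation (\<lambda>\<omega>. W \<omega> * \<Gamma>_iter F (j # js) G \<omega>) = expectation (\<lambda>\<omega>. W' \<omega> * G \<omega>)" if "G \<in> S" for G
    using \<Gamma>_ibp[OF Cons.prems \<Gamma>_iter_S[OF F that, of js] F[rule_format, of j]] W'(2)[OF that]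
    by (simp add: mult.commute)
  then show ?case using W'(1) by blast
qed

definition sq_total :: "('i::finite \<Rightarrow> 'w \<Rightarrow> real) \<Rightarrow> nat \<Rightarrow> nat \<Rightarrow> 'w \<Rightarrow> real" where
  "sq_total F K N = (\<lambda>\<omega>. \<Sum>j\<in>UNIV. sq (onb N) K (F j) \<omega>)"

lemma sq_total_nonneg: "0 \<le> sq_total F K N \<omega>"
  by (simp add: sq_total_def sum_nonneg sq_nonneg)

lemma sq_total_S: "(\<forall>j. F j \<in> S) \<Longrightarrow> sq_total F K N \<in> S"
  unfolding sq_total_def by (intro S_sum sq_S) auto

lemma sq_le_total: "m \<le> K \<Longrightarrow> sq (onb N) m (F j) \<omega> \<le> sq_total F K N \<omega>"
  unfolding sq_total_def
  by (rule order_trans[OF sq_mono member_le_sum[where f = "\<lambda>j. sq (onb N) K (F j) \<omega>"]]) (auto intro: sq_nonneg)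

lemma integrable_mult_sqrt:
  assumes "W \<in> S" "Y \<in> S" "\<And>\<omega>. 0 \<le> Y \<omega>"
  shows "integrable M (\<lambda>\<omega>. \<bar>W \<omega>\<bar> * sqrt (Y \<omega>))"
proof (rule Bochner_Integration.integrable_bound[where f = "\<lambda>\<omega>. W \<omega> ^ 2 + Y \<omega>"])
  show "integrable M (\<lambda>\<omega>. W \<omega> ^ 2 + Y \<omega>)"
    using assms by (intro S_integrable S_add S_power)
  show "(\<lambda>\<omega>. \<bar>W \<omega>\<bar> * sqrt (Y \<omega>)) \<in> borel_measurable M"
    using S_borel[OF assms(1)] S_borel[OF assms(2)] by measurable
  have "\<bar>W \<omega>\<bar> * sqrt (Y \<omega>) \<le> W \<omega> ^ 2 + Y \<omega>" for \<omega>
    using mult_le_sum_squares[of "\<bar>W \<omega>\<bar>" "sqrt (Y \<omega>)"] assms(3)[of \<omega>] by simp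
  then show "AE \<omega> in M. norm (\<bar>W \<omega>\<bar> * sqrt (Y \<omega>)) \<le> norm (W \<omega> ^ 2 + Y \<omega>)"
    using assms(3) by (intro AE_I2) (simp add: abs_mult)
qed

text \<open>
  The innermost \<open>\<Gamma>(\<cdot>, F\<^sub>j)\<close> is replaced by its truncation to \<open>onb N\<close>, for which Leibniz' rule is a
  finite sum. Truncations converge only weakly under the outer operators, but testing against
  \<open>W \<in> S\<close> suffices since the outer operators have adjoints on \<open>S\<close>.
\<close>

lemma \<Gamma>_iter_weak_bound:
  assumes F: "\<forall>j. F j \<in> S"
  shows "length js \<le> K \<Longrightarrow> G \<in> S \<Longrightarrow> W \<in> S \<Longrightarrow>
    (\<And>N. N0 \<le> N \<Longrightarrow> expectation (\<lambda>\<omega>. \<bar>W \<omega>\<bar> *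
        sqrt (sq_total F K N \<omega> ^ length js * sq (onb N) (length js) G \<omega>)) \<le> c) \<Longrightarrow>
    \<bar>expectation (\<lambda>\<omega>. W \<omega> * \<Gamma>_iter F js G \<omega>)\<bar> \<le> (5 ^ K) ^ length js * c"
proof (induction js arbitrary: G N0 c rule: rev_induct)
  case Nil
  have "\<bar>expectation (\<lambda>\<omega>. W \<omega> * G \<omega>)\<bar> \<le> expectation (\<lambda>\<omega>. \<bar>W \<omega> * G \<omega>\<bar>)"
    by (rule integral_abs_bound)
  also have "\<dots> \<le> c" using Nil(4)[of N0] by (simp add: abs_mult)
  finally show ?case by simp
next
  case (snoc j js)
  define k where "k = length js"
  have k: "Suc k \<le> K" using snoc.prems(1) by (simp add: k_def)
  obtain W' where W': "W' \<in> S" "\<And>G. G \<in> S \<Longrightarrow>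
      expectation (\<lambda>\<omega>. W \<omega> * \<Gamma>_iter F js G \<omega>) = expectation (\<lambda>\<omega>. W' \<omega> * G \<omega>)"
    using \<Gamma>_iter_adjoint[of F W js] F snoc.prems by blast
  have GN: "\<Gamma>_trunc (onb N) G (F j) \<in> S" for N by (intro \<Gamma>_trunc_S finite_onb snoc.prems F[rule_format])
  have lim: "(\<lambda>N. expectation (\<lambda>\<omega>. W \<omega> * \<Gamma>_iter F js (\<Gamma>_trunc (onb N) G (F j)) \<omega>))
      \<longlonglongrightarrow> expectation (\<lambda>\<omega>. W \<omega> * \<Gamma>_iter F (js @ [j]) G \<omega>)"
    unfolding \<Gamma>_iter_snoc W'(2)[OF GN] W'(2)[OF \<Gamma>_S[OF snoc.prems(2) F[rule_format]]]
    by (rule \<Gamma>_trunc_tendsto[OF W'(1) snoc.prems(2) F[rule_format]])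
  have bound: "\<bar>expectation (\<lambda>\<omega>. W \<omega> * \<Gamma>_iter F js (\<Gamma>_trunc (onb N) G (F j)) \<omega>)\<bar> \<le> (5 ^ K) ^ k * (5 ^ K * c)" for N
    unfolding k_def
  proof (rule snoc.IH)
    \<comment> \<open>The bound is requested only from a threshold on so that it can be raised here:
      beyond \<open>max N0 N\<close> the measuring set \<open>onb N'\<close> contains the truncation
      set \<open>onb N\<close>.\<close>
    fix N' assume N': "max N0 N \<le> N'"
    have B: "AE \<omega> in M. sq (onb N') k (\<Gamma>_trunc (onb N) G (F j)) \<omega>
        \<le> 5 ^ k * (sq (onb N') (Suc k) G \<omega> * sq (onb N') (Suc k) (F j) \<omega>)"
      using N' by (intro sq_\<Gamma>_trunc finite_onb onb_mono snoc.prems F[rule_format]) auto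
    let ?Y = "\<lambda>\<omega>. sq_total F K N' \<omega> ^ k * sq (onb N') k (\<Gamma>_trunc (onb N) G (F j)) \<omega>"
    let ?Z = "\<lambda>\<omega>. sq_total F K N' \<omega> ^ Suc k * sq (onb N') (Suc k) G \<omega>"
    have Y: "?Y \<in> S" "?Z \<in> S"
      using GN F snoc.prems by (auto simp del: sq.simps power_Suc intro!: S_mult S_power sq_S sq_total_S)
    have nn: "0 \<le> ?Y \<omega>" "0 \<le> ?Z \<omega>" for \<omega>
      by (auto simp del: sq.simps power_Suc intro!: mult_nonneg_nonneg zero_le_power sq_total_nonneg sq_nonneg)
    have "expectation (\<lambda>\<omega>. \<bar>W \<omega>\<bar> * sqrt (?Y \<omega>)) \<le> expectation (\<lambda>\<omega>. 5 ^ K * (\<bar>W \<omega>\<bar> * sqrt (?Z \<omega>)))"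
    proof (rule integral_mono_AE)
      show "integrable M (\<lambda>\<omega>. \<bar>W \<omega>\<bar> * sqrt (?Y \<omega>))" "integrable M (\<lambda>\<omega>. 5 ^ K * (\<bar>W \<omega>\<bar> * sqrt (?Z \<omega>)))"
        by (intro integrable_mult_right integrable_mult_sqrt snoc.prems Y nn)+
      from B show "AE \<omega> in M. \<bar>W \<omega>\<bar> * sqrt (?Y \<omega>) \<le> 5 ^ K * (\<bar>W \<omega>\<bar> * sqrt (?Z \<omega>))"
      proof eventually_elim
        case (elim \<omega>)
        define s where "s = sq_total F K N' \<omega>"
        define g where "g = sq (onb N') (Suc k) G \<omega>"
        have s: "0 \<le> s" "0 \<le> g" "sq (onb N') (Suc k) (F j) \<omega> \<le> s"
          unfolding s_def g_def using k by (auto simp del: sq.simps intro!: sq_total_nonneg sq_nonneg sq_le_total)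
        have "sq (onb N') k (\<Gamma>_trunc (onb N) G (F j)) \<omega> \<le> 5 ^ k * (g * s)"
          using elim s mult_left_mono[OF s(3) s(2)] unfolding g_def[symmetric]
          by (auto simp del: sq.simps intro: order_trans mult_left_mono)
        \<comment> \<open>The constant is enlarged to a perfect square, so that every derivation
          costs the same factor \<open>5 ^ K\<close> after the square root. The factor
          \<open>s\<close>, coming from \<open>F j\<close>, raises the power of
          \<open>sq_total\<close> by one.\<close>
        also have "\<dots> \<le> (5 ^ K)\<^sup>2 * (g * s)"
        proof (rule mult_right_mono)
          have "(5::real) ^ k \<le> 5 ^ (K * 2)" using k by (intro power_increasing) auto
          then show "(5::real) ^ k \<le> (5 ^ K)\<^sup>2" by (simp add: power_mult)
        qed (use s in simp)
        finally have "s ^ k * sq (onb N') k (\<Gamma>_trunc (onb N) G (F j)) \<omega> \<le> s ^ k * ((5 ^ K)\<^sup>2 * (g * s))"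
          using s by (intro mult_left_mono) auto
        also have "\<dots> = (5 ^ K)\<^sup>2 * (s ^ Suc k * g)" by (simp add: algebra_simps)
        finally have "sqrt (?Y \<omega>) \<le> sqrt ((5 ^ K)\<^sup>2 * ?Z \<omega>)"
          unfolding s_def g_def by (rule real_sqrt_le_mono)
        also have "\<dots> = 5 ^ K * sqrt (?Z \<omega>)" by (simp add: real_sqrt_mult del: sq.simps power_Suc)
        finally have "\<bar>W \<omega>\<bar> * sqrt (?Y \<omega>) \<le> \<bar>W \<omega>\<bar> * (5 ^ K * sqrt (?Z \<omega>))"
          by (rule mult_left_mono) simp
        then show ?case by (simp add: mult.left_commute del: sq.simps power_Suc)
      qed
    qed
    also have "\<dots> = 5 ^ K * expectation (\<lambda>\<omega>. \<bar>W \<omega>\<bar> * sqrt (?Z \<omega>))" by (rule integral_mult_right_zero)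
    also have "\<dots> \<le> 5 ^ K * c"
      using snoc.prems(4)[of N'] N' by (intro mult_left_mono) (auto simp add: k_def simp del: sq.simps power_Suc)
    finally show "expectation (\<lambda>\<omega>. \<bar>W \<omega>\<bar> * sqrt (sq_total F K N' \<omega> ^ length js * sq (onb N') (length js) (\<Gamma>_trunc (onb N) G (F j)) \<omega>)) \<le> 5 ^ K * c"
      by (simp add: k_def)
  qed (use snoc.prems GN in auto)
  have "\<bar>expectation (\<lambda>\<omega>. W \<omega> * \<Gamma>_iter F (js @ [j]) G \<omega>)\<bar> \<le> (5 ^ K) ^ k * (5 ^ K * c)"
    by (rule LIMSEQ_le_const2[OF tendsto_rabs[OF lim]]) (use bound in auto)
  then show ?case by (simp add: k_def mult.assoc mult.left_commute)
qed

text \<open>The bound is self-improving: test against the odd power of \<open>\<Gamma>_iter F js G\<close> itself.\<close>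

lemma \<Gamma>_iter_moment:
  assumes F: "\<forall>j. F j \<in> S" and G: "G \<in> S" and len: "length js \<le> K" and p: "p \<ge> 1"
    and R1: "\<And>N. expectation (\<lambda>\<omega>. sq_total F K N \<omega> ^ (2 * length js * p)) \<le> R"
    and R2: "\<And>N. expectation (\<lambda>\<omega>. sq (onb N) (length js) G \<omega> ^ (2 * p)) \<le> R"
  shows "expectation (\<lambda>\<omega>. \<Gamma>_iter F js G \<omega> ^ (2 * p)) \<le> (2 * (5 ^ K) ^ length js) ^ (2 * p) * (2 * R)"
proof -
  define T where "T = \<Gamma>_iter F js G"
  define k where "k = length js"
  define \<kappa> :: real where "\<kappa> = (5 ^ K) ^ k"
  \<comment> \<open>With this weight \<kappa> times \<theta> is 1/2, so half of the moment
    \<open>a\<close> can be subtracted in the end.\<close>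
  define \<theta> where "\<theta> = 1 / (2 * \<kappa>)"
  define a where "a = expectation (\<lambda>\<omega>. T \<omega> ^ (2 * p))"
  \<comment> \<open>The test functional is the power of \<open>T\<close> with exponent
    \<open>n = 2 * p - 1\<close>; paired with \<open>T\<close> it gives the even moment
    \<open>a\<close>.\<close>
  obtain n where n: "2 * p = Suc n" using p by (cases "2 * p") auto
  have \<kappa>: "\<kappa> > 0" by (simp add: \<kappa>_def)
  then have \<theta>: "\<theta> > 0" by (simp add: \<theta>_def)
  have T: "T \<in> S" unfolding T_def by (rule \<Gamma>_iter_S[OF F G])
  have W: "(\<lambda>\<omega>. T \<omega> ^ n) \<in> S" by (rule S_power[OF T])
  have "\<bar>expectation (\<lambda>\<omega>. T \<omega> ^ n * \<Gamma>_iter F js G \<omega>)\<bar> \<le> (5 ^ K) ^ length js * (\<theta> * a + (1 / \<theta>) ^ n * (2 * R))"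
  proof (rule \<Gamma>_iter_weak_bound[where ?N0.0 = 0, OF F len G W])
    fix N :: nat
    let ?s = "\<lambda>\<omega>. sq_total F K N \<omega>" and ?g = "\<lambda>\<omega>. sq (onb N) k G \<omega>"
    have sS: "?s \<in> S" "?g \<in> S" using F G by (auto intro!: sq_total_S sq_S)
    have Y: "(\<lambda>\<omega>. ?s \<omega> ^ k * ?g \<omega>) \<in> S" using sS by (intro S_mult S_power)
    have nn: "0 \<le> ?s \<omega> ^ k * ?g \<omega>" for \<omega> by (intro mult_nonneg_nonneg zero_le_power sq_total_nonneg sq_nonneg)
    have "expectation (\<lambda>\<omega>. \<bar>T \<omega> ^ n\<bar> * sqrt (?s \<omega> ^ k * ?g \<omega>)) \<le>
      expectation (\<lambda>\<omega>. \<theta> * T \<omega> ^ (2 * p) + (1 / \<theta>) ^ n * (?s \<omega> ^ (2 * k * p) + ?g \<omega> ^ (2 * p)))"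
    proof (rule integral_mono)
      show "integrable M (\<lambda>\<omega>. \<bar>T \<omega> ^ n\<bar> * sqrt (?s \<omega> ^ k * ?g \<omega>))" by (rule integrable_mult_sqrt[OF W Y nn])
      show "integrable M (\<lambda>\<omega>. \<theta> * T \<omega> ^ (2 * p) + (1 / \<theta>) ^ n * (?s \<omega> ^ (2 * k * p) + ?g \<omega> ^ (2 * p)))"
        using sS T by (intro S_integrable S_add S_scale S_power)
      fix \<omega>
      let ?b = "sqrt (?s \<omega> ^ k * ?g \<omega>)"
      have 1: "\<bar>T \<omega>\<bar> ^ n * ?b \<le> \<theta> * \<bar>T \<omega>\<bar> ^ Suc n + (1 / \<theta>) ^ n * ?b ^ Suc n"
        using \<theta> nn by (intro Young_weighted) auto
      have 2: "\<bar>T \<omega>\<bar> ^ Suc n = T \<omega> ^ (2 * p)" unfolding n[symmetric] by (simp add: power_even_abs)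
      \<comment> \<open>The even exponent removes the square root, and the product of powers of
        \<open>?s\<close> and \<open>?g\<close> is split into squares; this fixes the exponents in
        the two moment hypotheses.\<close>
      have 3: "?b ^ Suc n \<le> ?s \<omega> ^ (2 * k * p) + ?g \<omega> ^ (2 * p)"
      proof -
        let ?x = "?s \<omega> ^ (k * p)" and ?y = "?g \<omega> ^ p"
        have "?b ^ Suc n = (?b\<^sup>2) ^ p" unfolding n[symmetric] by (simp add: power_mult)
        also have "\<dots> = ?x * ?y" using nn[of \<omega>] by (simp add: power_mult_distrib power_mult)
        also have "\<dots> \<le> ?x\<^sup>2 + ?y\<^sup>2"
          by (rule mult_le_sum_squares)
        also have "\<dots> = ?s \<omega> ^ (2 * k * p) + ?g \<omega> ^ (2 * p)"
          by (simp add: power_mult[symmetric] ac_simps)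
        finally show ?thesis .
      qed
      have "(1 / \<theta>) ^ n * ?b ^ Suc n \<le> (1 / \<theta>) ^ n * (?s \<omega> ^ (2 * k * p) + ?g \<omega> ^ (2 * p))"
        by (rule mult_left_mono[OF 3]) (use \<theta> in simp)
      then show "\<bar>T \<omega> ^ n\<bar> * ?b \<le> \<theta> * T \<omega> ^ (2 * p) + (1 / \<theta>) ^ n * (?s \<omega> ^ (2 * k * p) + ?g \<omega> ^ (2 * p))"
        using order_trans[OF 1[unfolded 2] add_left_mono] by (simp add: power_abs)
    qed
    also have "\<dots> = \<theta> * a + (1 / \<theta>) ^ n * (expectation (\<lambda>\<omega>. ?s \<omega> ^ (2 * k * p)) + expectation (\<lambda>\<omega>. ?g \<omega> ^ (2 * p)))"
      unfolding a_def using S_integrable[OF S_power[OF T]] S_integrable[OF S_power[OF sS(1)]] S_integrable[OF S_power[OF sS(2)]]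
      by simp
    also have "\<dots> \<le> \<theta> * a + (1 / \<theta>) ^ n * (2 * R)"
      using R1[of N] R2[of N] \<theta> by (intro add_left_mono mult_left_mono) (auto simp: k_def)
    finally show "expectation (\<lambda>\<omega>. \<bar>T \<omega> ^ n\<bar> * sqrt (?s \<omega> ^ length js * sq (onb N) (length js) G \<omega>))
       \<le> \<theta> * a + (1 / \<theta>) ^ n * (2 * R)" by (simp add: k_def)
  qed
  moreover have "expectation (\<lambda>\<omega>. T \<omega> ^ n * \<Gamma>_iter F js G \<omega>) = a"
    unfolding a_def n T_def by (simp add: mult.commute)
  ultimately have "a \<le> \<kappa> * (\<theta> * a + (1 / \<theta>) ^ n * (2 * R))" by (simp add: \<kappa>_def k_def)
  also have "\<dots> = a / 2 + \<kappa> * (2 * \<kappa>) ^ n * (2 * R)" using \<kappa> by (simp add: \<theta>_def field_simps)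
  finally have "a \<le> (2 * \<kappa>) ^ Suc n * (2 * R)" by (simp add: field_simps)
  then show ?thesis by (simp add: a_def T_def \<kappa>_def k_def n)
qed

section \<open>Functionals with controlled moments\<close>

text \<open>One index \<open>K\<close> is both the order of differentiation and the exponent, so
  several requirements combine by taking a maximum. Uniformity in \<open>N\<close> stands in for
  norms over the whole of H.\<close>

definition norm_bd :: "nat \<Rightarrow> real \<Rightarrow> ('i::finite \<Rightarrow> 'w \<Rightarrow> real) \<Rightarrow> bool" where
  "norm_bd K R F \<longleftrightarrow> (\<forall>j. F j \<in> S) \<and> (\<forall>j N. expectation (\<lambda>\<omega>. sq (onb N) K (F j) \<omega> ^ K) \<le> R \<and>
     expectation (\<lambda>\<omega>. sq (onb N) K (L (F j)) \<omega> ^ K) \<le> R)"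

lemma sq_moment_mono:
  assumes "G \<in> S" "m \<le> K" "a \<le> K"
  shows "expectation (\<lambda>\<omega>. sq (onb N) m G \<omega> ^ a) \<le> 1 + expectation (\<lambda>\<omega>. sq (onb N) K G \<omega> ^ K)"
proof -
  have "expectation (\<lambda>\<omega>. sq (onb N) m G \<omega> ^ a) \<le> expectation (\<lambda>\<omega>. 1 + sq (onb N) K G \<omega> ^ K)"
  proof (rule integral_mono)
    fix \<omega>
    have "sq (onb N) m G \<omega> ^ a \<le> sq (onb N) K G \<omega> ^ a"
      using assms by (intro power_mono sq_mono sq_nonneg)
    also have "\<dots> \<le> 1 + sq (onb N) K G \<omega> ^ K" by (intro power_le_one_plus sq_nonneg assms)
    finally show "sq (onb N) m G \<omega> ^ a \<le> 1 + sq (onb N) K G \<omega> ^ K" .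
  qed (auto intro!: S_integrable S_add S_const S_power sq_S assms)
  also have "\<dots> = 1 + expectation (\<lambda>\<omega>. sq (onb N) K G \<omega> ^ K)"
    by (subst Bochner_Integration.integral_add) (auto intro!: S_integrable S_power sq_S assms simp: prob_space)
  finally show ?thesis .
qed

lemma norm_bd_mono:
  assumes "norm_bd K R F" "m \<le> K"
  shows "norm_bd m (1 + R) F"
  using assms sq_moment_mono[of "F _" m K m] sq_moment_mono[of "L (F _)" m K m] L_S
  unfolding norm_bd_def by (meson add_left_mono order_refl order_trans)

text \<open>\<open>X\<close> is a construction applied to all vectors \<open>F\<close> at once.
  Since \<open>K\<close> depends only on the moment and \<open>C\<close> only on the bound
  \<open>R\<close>, the estimate is uniform along any sequence bounded in the norms.\<close>

definition moments_controlled :: "(('i::finite \<Rightarrow> 'w \<Rightarrow> real) \<Rightarrow> 'w \<Rightarrow> real) \<Rightarrow> bool" where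
  "moments_controlled X \<longleftrightarrow> (\<forall>F. (\<forall>j. F j \<in> S) \<longrightarrow> X F \<in> S) \<and>
     (\<forall>p\<ge>1. \<exists>K. \<forall>R. \<exists>C. \<forall>F. norm_bd K R F \<longrightarrow> expectation (\<lambda>\<omega>. X F \<omega> ^ (2 * p)) \<le> C)"

text \<open>The admissible weights are those whose moment bounds survive derivations in the
  directions DF_j. Counting the derivations gives closure under products by induction, since
  Leibniz' rule lowers the count by one.\<close>

primrec tame_upto :: "nat \<Rightarrow> (('i::finite \<Rightarrow> 'w \<Rightarrow> real) \<Rightarrow> 'w \<Rightarrow> real) \<Rightarrow> bool" where
  "tame_upto 0 X \<longleftrightarrow> moments_controlled X"
| "tame_upto (Suc n) X \<longleftrightarrow> moments_controlled X \<and> (\<forall>j. tame_upto n (\<lambda>F. \<Gamma> (X F) (F j)))"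

definition tame :: "(('i::finite \<Rightarrow> 'w \<Rightarrow> real) \<Rightarrow> 'w \<Rightarrow> real) \<Rightarrow> bool" where
  "tame X \<longleftrightarrow> (\<forall>n. tame_upto n X)"

lemma moments_controlled_S: "moments_controlled X \<Longrightarrow> (\<forall>j. F j \<in> S) \<Longrightarrow> X F \<in> S"
  by (auto simp: moments_controlled_def)

lemma tame_upto_controlled: "tame_upto n X \<Longrightarrow> moments_controlled X"
  by (cases n) auto

lemma tame_upto_S: "tame_upto n X \<Longrightarrow> (\<forall>j. F j \<in> S) \<Longrightarrow> X F \<in> S"
  by (auto intro: moments_controlled_S tame_upto_controlled)

lemma tame_S: "tame X \<Longrightarrow> (\<forall>j. F j \<in> S) \<Longrightarrow> X F \<in> S"
  unfolding tame_def by (auto intro: tame_upto_S)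

lemma tame_\<Gamma>: "tame X \<Longrightarrow> tame (\<lambda>F. \<Gamma> (X F) (F j))"
  unfolding tame_def by (metis tame_upto.simps(2))

lemma tame_upto_mono: "tame_upto (Suc n) X \<Longrightarrow> tame_upto n X"
  by (induction n arbitrary: X) auto

lemma moments_controlled_cong:
  fixes X Y :: "('i::finite \<Rightarrow> 'w \<Rightarrow> real) \<Rightarrow> 'w \<Rightarrow> real"
  assumes X: "moments_controlled X"
    and Y: "\<And>F. (\<forall>j. F j \<in> S) \<Longrightarrow> Y F \<in> S" "\<And>F. (\<forall>j. F j \<in> S) \<Longrightarrow> AE \<omega> in M. X F \<omega> = Y F \<omega>"
  shows "moments_controlled Y"
proof -
  have eq: "expectation (\<lambda>\<omega>. Y F \<omega> ^ n) = expectation (\<lambda>\<omega>. X F \<omega> ^ n)" if bd: "norm_bd K R F" for F n K R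
  proof -
    have F: "\<forall>j. F j \<in> S" using bd by (simp add: norm_bd_def)
    show ?thesis
    proof (rule integral_cong_AE)
      show "AE \<omega> in M. Y F \<omega> ^ n = X F \<omega> ^ n" using Y(2)[OF F] by eventually_elim simp
    qed (intro S_borel S_power Y(1)[OF F] moments_controlled_S[OF X F])+
  qed
  show ?thesis unfolding moments_controlled_def
  proof (intro conjI allI impI)
    fix p :: nat assume "p \<ge> 1"
    with X obtain K where K: "\<And>R. \<exists>C. \<forall>F. norm_bd K R F \<longrightarrow> expectation (\<lambda>\<omega>. X F \<omega> ^ (2 * p)) \<le> C"
      unfolding moments_controlled_def by meson
    show "\<exists>K. \<forall>R. \<exists>C. \<forall>F. norm_bd K R F \<longrightarrow> expectation (\<lambda>\<omega>. Y F \<omega> ^ (2 * p)) \<le> C"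
    proof (intro exI[of _ K] allI)
      fix R
      from K[of R] show "\<exists>C. \<forall>F. norm_bd K R F \<longrightarrow> expectation (\<lambda>\<omega>. Y F \<omega> ^ (2 * p)) \<le> C"
        using eq by simp
    qed
  qed (use Y(1) in auto)
qed

text \<open>Leibniz' rule holds only almost surely, so tameness has to be transported along almost
  sure equality; derivations respect it by \<open>\<Gamma>_cong\<close>.\<close>

lemma tame_upto_cong:
  fixes X Y :: "('i::finite \<Rightarrow> 'w \<Rightarrow> real) \<Rightarrow> 'w \<Rightarrow> real"
  assumes "tame_upto n X"
    and "\<And>F. (\<forall>j. F j \<in> S) \<Longrightarrow> Y F \<in> S" "\<And>F. (\<forall>j. F j \<in> S) \<Longrightarrow> AE \<omega> in M. X F \<omega> = Y F \<omega>"
  shows "tame_upto n Y"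
  using assms
proof (induction n arbitrary: X Y)
  case 0
  then show ?case by (auto intro: moments_controlled_cong)
next
  case (Suc n)
  have "tame_upto n (\<lambda>F. \<Gamma> (Y F) (F j))" for j
  proof (rule Suc.IH)
    show "tame_upto n (\<lambda>F. \<Gamma> (X F) (F j))" using Suc.prems by simp
    fix F :: "'i \<Rightarrow> 'w \<Rightarrow> real" assume F: "\<forall>j. F j \<in> S"
    show "\<Gamma> (Y F) (F j) \<in> S" using F Suc.prems by (auto intro: \<Gamma>_S)
    show "AE \<omega> in M. \<Gamma> (X F) (F j) \<omega> = \<Gamma> (Y F) (F j) \<omega>"
      using F Suc.prems by (intro \<Gamma>_cong tame_upto_S[OF Suc.prems(1)]) auto
  qed
  moreover have "moments_controlled Y"
    by (rule moments_controlled_cong[OF tame_upto_controlled[OF Suc.prems(1)] Suc.prems(2,3)])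
  ultimately show ?case by simp
qed

lemma moments_controlled_add:
  fixes X Y :: "('i::finite \<Rightarrow> 'w \<Rightarrow> real) \<Rightarrow> 'w \<Rightarrow> real"
  assumes X: "moments_controlled X" and Y: "moments_controlled Y"
  shows "moments_controlled (\<lambda>F \<omega>. X F \<omega> + Y F \<omega>)"
  unfolding moments_controlled_def
proof (intro conjI allI impI)
  fix p :: nat assume "p \<ge> 1"
  then obtain K1 K2 where K: "\<And>R. \<exists>C. \<forall>F. norm_bd K1 R F \<longrightarrow> expectation (\<lambda>\<omega>. X F \<omega> ^ (2 * p)) \<le> C"
    "\<And>R. \<exists>C. \<forall>F. norm_bd K2 R F \<longrightarrow> expectation (\<lambda>\<omega>. Y F \<omega> ^ (2 * p)) \<le> C"
    using X Y unfolding moments_controlled_def by meson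
  show "\<exists>K. \<forall>R. \<exists>C. \<forall>F. norm_bd K R F \<longrightarrow> expectation (\<lambda>\<omega>. (X F \<omega> + Y F \<omega>) ^ (2 * p)) \<le> C"
  proof (intro exI[of _ "max K1 K2"] allI)
    fix R
    \<comment> \<open>Lowering the index from the maximum to \<open>K1\<close> or \<open>K2\<close>
      costs a change from \<open>R\<close> to \<open>1 + R\<close>, see
      \<open>norm_bd_mono\<close>.\<close>
    obtain C1 C2 where C: "\<And>F. norm_bd K1 (1 + R) F \<Longrightarrow> expectation (\<lambda>\<omega>. X F \<omega> ^ (2 * p)) \<le> C1"
      "\<And>F. norm_bd K2 (1 + R) F \<Longrightarrow> expectation (\<lambda>\<omega>. Y F \<omega> ^ (2 * p)) \<le> C2" using K by meson
    show "\<exists>C. \<forall>F. norm_bd (max K1 K2) R F \<longrightarrow> expectation (\<lambda>\<omega>. (X F \<omega> + Y F \<omega>) ^ (2 * p)) \<le> C"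
    proof (intro exI[of _ "2 ^ (2 * p) * (C1 + C2)"] allI impI)
      fix F :: "'i \<Rightarrow> 'w \<Rightarrow> real" assume F: "norm_bd (max K1 K2) R F"
      then have FS: "\<forall>j. F j \<in> S" by (simp add: norm_bd_def)
      note XY = moments_controlled_S[OF X FS] moments_controlled_S[OF Y FS]
      have "expectation (\<lambda>\<omega>. (X F \<omega> + Y F \<omega>) ^ (2 * p)) \<le>
        expectation (\<lambda>\<omega>. 2 ^ (2 * p) * (X F \<omega> ^ (2 * p) + Y F \<omega> ^ (2 * p)))"
      proof (rule integral_mono)
        fix \<omega>
        have "(X F \<omega> + Y F \<omega>) ^ (2 * p) = \<bar>X F \<omega> + Y F \<omega>\<bar> ^ (2 * p)" by (simp add: power_even_abs)
        also have "\<dots> \<le> (\<bar>X F \<omega>\<bar> + \<bar>Y F \<omega>\<bar>) ^ (2 * p)" by (intro power_mono) auto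
        also have "\<dots> \<le> 2 ^ (2 * p) * (\<bar>X F \<omega>\<bar> ^ (2 * p) + \<bar>Y F \<omega>\<bar> ^ (2 * p))"
          using sum_power_le_card[of "UNIV :: bool set" "\<lambda>b. if b then \<bar>X F \<omega>\<bar> else \<bar>Y F \<omega>\<bar>" "2 * p"]
          by (simp add: UNIV_bool add.commute)
        finally show "(X F \<omega> + Y F \<omega>) ^ (2 * p) \<le> 2 ^ (2 * p) * (X F \<omega> ^ (2 * p) + Y F \<omega> ^ (2 * p))"
          by (simp add: power_even_abs)
      qed (intro S_integrable S_scale S_add S_power XY)+
      also have "\<dots> = 2 ^ (2 * p) * (expectation (\<lambda>\<omega>. X F \<omega> ^ (2 * p)) + expectation (\<lambda>\<omega>. Y F \<omega> ^ (2 * p)))"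
        using S_integrable[OF S_power[OF XY(1)]] S_integrable[OF S_power[OF XY(2)]] by simp
      also have "\<dots> \<le> 2 ^ (2 * p) * (C1 + C2)"
        using C norm_bd_mono[OF F] by (intro mult_left_mono add_mono) auto
      finally show "expectation (\<lambda>\<omega>. (X F \<omega> + Y F \<omega>) ^ (2 * p)) \<le> 2 ^ (2 * p) * (C1 + C2)" .
    qed
  qed
qed (use assms in \<open>auto intro: S_add moments_controlled_S\<close>)

text \<open>The moment of a product is bounded by moments of twice the order of its factors; the
  class is therefore defined with all moments at once.\<close>

lemma moments_controlled_mult:
  fixes X Y :: "('i::finite \<Rightarrow> 'w \<Rightarrow> real) \<Rightarrow> 'w \<Rightarrow> real"
  assumes X: "moments_controlled X" and Y: "moments_controlled Y"
  shows "moments_controlled (\<lambda>F \<omega>. X F \<omega> * Y F \<omega>)"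
  unfolding moments_controlled_def
proof (intro conjI allI impI)
  fix p :: nat assume "p \<ge> 1"
  then have "2 * p \<ge> 1" by simp
  then obtain K1 K2 where K: "\<And>R. \<exists>C. \<forall>F. norm_bd K1 R F \<longrightarrow> expectation (\<lambda>\<omega>. X F \<omega> ^ (2 * (2 * p))) \<le> C"
    "\<And>R. \<exists>C. \<forall>F. norm_bd K2 R F \<longrightarrow> expectation (\<lambda>\<omega>. Y F \<omega> ^ (2 * (2 * p))) \<le> C"
    using X Y unfolding moments_controlled_def by meson
  show "\<exists>K. \<forall>R. \<exists>C. \<forall>F. norm_bd K R F \<longrightarrow> expectation (\<lambda>\<omega>. (X F \<omega> * Y F \<omega>) ^ (2 * p)) \<le> C"
  proof (intro exI[of _ "max K1 K2"] allI)
    fix R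
    obtain C1 C2 where C: "\<And>F. norm_bd K1 (1 + R) F \<Longrightarrow> expectation (\<lambda>\<omega>. X F \<omega> ^ (2 * (2 * p))) \<le> C1"
      "\<And>F. norm_bd K2 (1 + R) F \<Longrightarrow> expectation (\<lambda>\<omega>. Y F \<omega> ^ (2 * (2 * p))) \<le> C2" using K by meson
    show "\<exists>C. \<forall>F. norm_bd (max K1 K2) R F \<longrightarrow> expectation (\<lambda>\<omega>. (X F \<omega> * Y F \<omega>) ^ (2 * p)) \<le> C"
    proof (intro exI[of _ "C1 + C2"] allI impI)
      fix F :: "'i \<Rightarrow> 'w \<Rightarrow> real" assume F: "norm_bd (max K1 K2) R F"
      then have FS: "\<forall>j. F j \<in> S" by (simp add: norm_bd_def)
      note XY = moments_controlled_S[OF X FS] moments_controlled_S[OF Y FS]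
      have "expectation (\<lambda>\<omega>. (X F \<omega> * Y F \<omega>) ^ (2 * p)) \<le>
        expectation (\<lambda>\<omega>. X F \<omega> ^ (2 * (2 * p)) + Y F \<omega> ^ (2 * (2 * p)))"
      proof (rule integral_mono)
        fix \<omega>
        let ?x = "X F \<omega> ^ (2 * p)" and ?y = "Y F \<omega> ^ (2 * p)"
        have "?x * ?y \<le> ?x\<^sup>2 + ?y\<^sup>2" by (rule mult_le_sum_squares)
        then show "(X F \<omega> * Y F \<omega>) ^ (2 * p) \<le> X F \<omega> ^ (2 * (2 * p)) + Y F \<omega> ^ (2 * (2 * p))"
          by (simp add: power_mult_distrib power_mult[symmetric] mult.commute mult.left_commute)
      qed (intro S_integrable S_mult S_add S_power XY)+
      also have "\<dots> = expectation (\<lambda>\<omega>. X F \<omega> ^ (2 * (2 * p))) + expectation (\<lambda>\<omega>. Y F \<omega> ^ (2 * (2 * p)))"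
        by (intro Bochner_Integration.integral_add S_integrable S_power XY)
      also have "\<dots> \<le> C1 + C2"
        using C norm_bd_mono[OF F] by (intro add_mono) auto
      finally show "expectation (\<lambda>\<omega>. (X F \<omega> * Y F \<omega>) ^ (2 * p)) \<le> C1 + C2" .
    qed
  qed
qed (use assms in \<open>auto intro: S_mult moments_controlled_S\<close>)

lemma tame_upto_add:
  fixes X Y :: "('i::finite \<Rightarrow> 'w \<Rightarrow> real) \<Rightarrow> 'w \<Rightarrow> real"
  shows "tame_upto n X \<Longrightarrow> tame_upto n Y \<Longrightarrow> tame_upto n (\<lambda>F \<omega>. X F \<omega> + Y F \<omega>)"
proof (induction n arbitrary: X Y)
  case 0
  then show ?case by (simp add: moments_controlled_add)
next
  case (Suc n)
  have "tame_upto n (\<lambda>F. \<Gamma> (\<lambda>\<omega>. X F \<omega> + Y F \<omega>) (F j))" for j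
  proof (rule tame_upto_cong)
    show "tame_upto n (\<lambda>F \<omega>. \<Gamma> (X F) (F j) \<omega> + \<Gamma> (Y F) (F j) \<omega>)"
      using Suc.prems by (intro Suc.IH) auto
    fix F :: "'i \<Rightarrow> 'w \<Rightarrow> real" assume F: "\<forall>j. F j \<in> S"
    note XY = tame_upto_S[OF Suc.prems(1) F] tame_upto_S[OF Suc.prems(2) F]
    show "\<Gamma> (\<lambda>\<omega>. X F \<omega> + Y F \<omega>) (F j) \<in> S" by (intro \<Gamma>_S S_add XY F[rule_format])
    show "AE \<omega> in M. \<Gamma> (X F) (F j) \<omega> + \<Gamma> (Y F) (F j) \<omega> = \<Gamma> (\<lambda>\<omega>. X F \<omega> + Y F \<omega>) (F j) \<omega>"
      using \<Gamma>_add[OF XY, of "F j"] by eventually_elim simp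
  qed
  then show ?case using Suc.prems by (simp add: moments_controlled_add)
qed

lemma tame_upto_mult:
  fixes X Y :: "('i::finite \<Rightarrow> 'w \<Rightarrow> real) \<Rightarrow> 'w \<Rightarrow> real"
  shows "tame_upto n X \<Longrightarrow> tame_upto n Y \<Longrightarrow> tame_upto n (\<lambda>F \<omega>. X F \<omega> * Y F \<omega>)"
proof (induction n arbitrary: X Y)
  case 0
  then show ?case by (simp add: moments_controlled_mult)
next
  case (Suc n)
  have "tame_upto n (\<lambda>F. \<Gamma> (\<lambda>\<omega>. X F \<omega> * Y F \<omega>) (F j))" for j
  proof (rule tame_upto_cong)
    show "tame_upto n (\<lambda>F \<omega>. X F \<omega> * \<Gamma> (Y F) (F j) \<omega> + Y F \<omega> * \<Gamma> (X F) (F j) \<omega>)"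
      using Suc.prems tame_upto_mono by (intro tame_upto_add Suc.IH) (auto simp del: tame_upto.simps(1))
    fix F :: "'i \<Rightarrow> 'w \<Rightarrow> real" assume F: "\<forall>j. F j \<in> S"
    note XY = tame_upto_S[OF Suc.prems(1) F] tame_upto_S[OF Suc.prems(2) F]
    show "\<Gamma> (\<lambda>\<omega>. X F \<omega> * Y F \<omega>) (F j) \<in> S" by (intro \<Gamma>_S S_mult XY F[rule_format])
    show "AE \<omega> in M. X F \<omega> * \<Gamma> (Y F) (F j) \<omega> + Y F \<omega> * \<Gamma> (X F) (F j) \<omega> = \<Gamma> (\<lambda>\<omega>. X F \<omega> * Y F \<omega>) (F j) \<omega>"
      using \<Gamma>_mult[OF XY, of "F j"] by eventually_elim simp
  qed
  then show ?case using Suc.prems by (simp add: moments_controlled_mult)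
qed

lemma tame_add: "tame X \<Longrightarrow> tame Y \<Longrightarrow> tame (\<lambda>F \<omega>. X F \<omega> + Y F \<omega>)"
  and tame_mult: "tame X \<Longrightarrow> tame Y \<Longrightarrow> tame (\<lambda>F \<omega>. X F \<omega> * Y F \<omega>)"
  unfolding tame_def by (simp_all add: tame_upto_add tame_upto_mult)

lemma moments_controlled_const: "moments_controlled (\<lambda>(F::'i::finite \<Rightarrow> 'w \<Rightarrow> real) \<omega>. c)"
  unfolding moments_controlled_def
  by (auto intro!: S_const exI[of _ 0] exI[of _ "c ^ (2 * _)"] simp: prob_space)

lemma tame_const: "tame (\<lambda>(F::'i::finite \<Rightarrow> 'w \<Rightarrow> real) \<omega>. c)"
proof -
  have "tame_upto n (\<lambda>(F::'i \<Rightarrow> 'w \<Rightarrow> real) \<omega>. c)" for n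
  proof (induction n arbitrary: c)
    case 0 show ?case by (simp add: moments_controlled_const)
  next
    case (Suc n)
    have "tame_upto n (\<lambda>F::'i \<Rightarrow> 'w \<Rightarrow> real. \<Gamma> (\<lambda>\<omega>. c) (F j))" for j
      by (rule tame_upto_cong[OF Suc.IH[of 0]]) (auto intro: \<Gamma>_S S_const eventually_mono[OF \<Gamma>_const])
    then show ?case by (simp add: moments_controlled_const)
  qed
  then show ?thesis by (simp add: tame_def)
qed

lemma tame_sum: "finite A \<Longrightarrow> (\<And>a. a \<in> A \<Longrightarrow> tame (X a)) \<Longrightarrow> tame (\<lambda>F \<omega>. \<Sum>a\<in>A. X a F \<omega>)"
  by (induction A rule: finite_induct) (auto intro: tame_const tame_add)

lemma tame_prod: "finite A \<Longrightarrow> (\<And>a. a \<in> A \<Longrightarrow> tame (X a)) \<Longrightarrow> tame (\<lambda>F \<omega>. \<Prod>a\<in>A. X a F \<omega>)"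
  by (induction A rule: finite_induct) (auto intro: tame_const tame_mult)

text \<open>Each layer of \<open>tame_upto\<close> applies a derivation directly to
  \<open>X F\<close>, inside those already present, so the word grows at its inner end.\<close>

lemma tame_if_iter:
  assumes "\<And>js. moments_controlled (\<lambda>F. \<Gamma>_iter F js (X F))"
  shows "tame X"
proof -
  have "(\<And>js. moments_controlled (\<lambda>F. \<Gamma>_iter F js (X F))) \<Longrightarrow> tame_upto n X" for n
  proof (induction n arbitrary: X)
    case 0
    from 0[of "[]"] show ?case by simp
  next
    case (Suc n)
    have "tame_upto n (\<lambda>F. \<Gamma> (X F) (F j))" for j
      using Suc.prems[of "_ @ [j]"] by (intro Suc.IH) (simp add: \<Gamma>_iter_snoc)
    with Suc.prems[of "[]"] show ?case by simp
  qed
  with assms show ?thesis by (simp add: tame_def)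
qed

text \<open>The entry point of the calculus: a functional whose truncated norms are bounded by the
  same \<open>R\<close> has all iterated derivations under control. It is applied to the components
  of \<open>F\<close> and of \<open>L F\<close>, the two families in \<open>norm_bd\<close>.\<close>

lemma moments_controlled_iter:
  fixes X :: "('i::finite \<Rightarrow> 'w \<Rightarrow> real) \<Rightarrow> 'w \<Rightarrow> real"
  assumes XS: "\<And>F. (\<forall>j. F j \<in> S) \<Longrightarrow> X F \<in> S"
    and X: "\<And>K R F N. norm_bd K R F \<Longrightarrow> expectation (\<lambda>\<omega>. sq (onb N) K (X F) \<omega> ^ K) \<le> R"
  shows "moments_controlled (\<lambda>F. \<Gamma>_iter F js (X F))"
  unfolding moments_controlled_def
proof (intro conjI allI impI)
  fix F :: "'i \<Rightarrow> 'w \<Rightarrow> real" assume "\<forall>j. F j \<in> S"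
  then show "\<Gamma>_iter F js (X F) \<in> S" by (intro \<Gamma>_iter_S XS) auto
next
  fix p :: nat assume p: "p \<ge> 1"
  \<comment> \<open>This dominates the number of derivations as well as the exponents
    \<open>2 * length js * p\<close> and \<open>2 * p\<close> occurring in
    \<open>\<Gamma>_iter_moment\<close>.\<close>
  define K where "K = length js + 2 * length js * p + 2 * p"
  define d where "d = real CARD('i)"
  show "\<exists>K. \<forall>R. \<exists>C. \<forall>F. norm_bd K R F \<longrightarrow> expectation (\<lambda>\<omega>. \<Gamma>_iter F js (X F) \<omega> ^ (2 * p)) \<le> C"
  proof (intro exI[of _ K] allI)
    fix R
    show "\<exists>C. \<forall>F. norm_bd K R F \<longrightarrow> expectation (\<lambda>\<omega>. \<Gamma>_iter F js (X F) \<omega> ^ (2 * p)) \<le> C"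
    proof (intro exI allI impI)
      fix F :: "'i \<Rightarrow> 'w \<Rightarrow> real" assume bd: "norm_bd K R F"
      then have F: "\<forall>j. F j \<in> S" by (simp add: norm_bd_def)
      have "0 \<le> expectation (\<lambda>\<omega>. sq (onb 0) K (X F) \<omega> ^ K)"
        by (intro Bochner_Integration.integral_nonneg zero_le_power sq_nonneg)
      then have R: "0 \<le> R" using X[OF bd, of 0] by (rule order_trans)
      show "expectation (\<lambda>\<omega>. \<Gamma>_iter F js (X F) \<omega> ^ (2 * p))
         \<le> (2 * (5 ^ K) ^ length js) ^ (2 * p) * (2 * (1 + R + d ^ K * (d * R)))"
      proof (rule \<Gamma>_iter_moment[OF F XS[OF F] _ p])
        show "length js \<le> K" by (simp add: K_def)
        fix N
        have "expectation (\<lambda>\<omega>. sq (onb N) (length js) (X F) \<omega> ^ (2 * p)) \<le> 1 + expectation (\<lambda>\<omega>. sq (onb N) K (X F) \<omega> ^ K)"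
          by (intro sq_moment_mono XS F F[rule_format]) (auto simp: K_def)
        also have "\<dots> \<le> 1 + R" using X[OF bd] by simp
        also have "\<dots> \<le> 1 + R + d ^ K * (d * R)" using R by (simp add: d_def)
        finally show "expectation (\<lambda>\<omega>. sq (onb N) (length js) (X F) \<omega> ^ (2 * p)) \<le> 1 + R + d ^ K * (d * R)" .
        let ?e = "2 * length js * p"
        have i: "integrable M (\<lambda>\<omega>. sq (onb N) K (F j) \<omega> ^ K)" for j
          by (intro S_integrable S_power sq_S finite_onb F[rule_format])
        have "expectation (\<lambda>\<omega>. sq_total F K N \<omega> ^ ?e) \<le> expectation (\<lambda>\<omega>. 1 + d ^ K * (\<Sum>j\<in>UNIV. sq (onb N) K (F j) \<omega> ^ K))"
        proof (rule integral_mono)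
          show "integrable M (\<lambda>\<omega>. sq_total F K N \<omega> ^ ?e)" by (intro S_integrable S_power sq_total_S F F[rule_format])
          show "integrable M (\<lambda>\<omega>. 1 + d ^ K * (\<Sum>j\<in>UNIV. sq (onb N) K (F j) \<omega> ^ K))"
            using i by auto
          fix \<omega>
          have "sq_total F K N \<omega> ^ ?e \<le> 1 + sq_total F K N \<omega> ^ K"
            by (intro power_le_one_plus sq_total_nonneg) (simp add: K_def)
          also have "sq_total F K N \<omega> ^ K \<le> d ^ K * (\<Sum>j\<in>UNIV. sq (onb N) K (F j) \<omega> ^ K)"
            using sum_power_le_card[of UNIV "\<lambda>j. sq (onb N) K (F j) \<omega>" K]
            by (simp add: sq_total_def d_def sq_nonneg)
          finally show "sq_total F K N \<omega> ^ ?e \<le> 1 + d ^ K * (\<Sum>j\<in>UNIV. sq (onb N) K (F j) \<omega> ^ K)" by simp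
        qed
        also have "\<dots> = 1 + d ^ K * (\<Sum>j\<in>UNIV. expectation (\<lambda>\<omega>. sq (onb N) K (F j) \<omega> ^ K))"
          using i by (simp add: prob_space)
        also have "\<dots> \<le> 1 + d ^ K * (\<Sum>j\<in>(UNIV::'i set). R)"
          using bd by (intro add_left_mono mult_left_mono sum_mono) (auto simp: norm_bd_def d_def)
        also have "\<dots> \<le> 1 + R + d ^ K * (d * R)" using R by (simp add: d_def)
        finally show "expectation (\<lambda>\<omega>. sq_total F K N \<omega> ^ ?e) \<le> 1 + R + d ^ K * (d * R)" .
      qed
    qed
  qed
qed

lemma tame_component: "tame (\<lambda>F. F i)"
  by (intro tame_if_iter moments_controlled_iter) (auto simp: norm_bd_def)

lemma tame_L: "tame (\<lambda>F. L (F i))"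
  by (intro tame_if_iter moments_controlled_iter) (auto simp: norm_bd_def L_S)

lemma tame_det:
  fixes A :: "('i::finite \<Rightarrow> 'w \<Rightarrow> real) \<Rightarrow> 'w \<Rightarrow> real ^ 'n::finite ^ 'n"
  assumes "\<And>i j. tame (\<lambda>F \<omega>. A F \<omega> $ i $ j)"
  shows "tame (\<lambda>F \<omega>. det (A F \<omega>))"
  unfolding det_def by (intro tame_sum tame_mult tame_const tame_prod assms) (auto simp: finite_permutations)

end

section \<open>Cofactors\<close>

text \<open>Replacing row \<open>i\<close> by a unit vector gives the signed minor without deleting
  indices from the type \<open>'n\<close>, and makes the determinant's multilinearity directly
  applicable.\<close>

definition cofactor :: "real ^ 'n ^ 'n \<Rightarrow> 'n::finite \<Rightarrow> 'n \<Rightarrow> real" where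
  "cofactor A i j = det (\<chi> r. if r = i then axis j 1 else A $ r)"

text \<open>By multilinearity the sum is the determinant of the matrix in which row \<open>i\<close>
  is overwritten by row \<open>k\<close>; for \<open>i \<noteq> k\<close> two rows coincide.\<close>

lemma sum_cofactor: "(\<Sum>j\<in>UNIV. cofactor A i j * A $ k $ j) = (if i = k then det A else 0)"
proof -
  have "det (\<chi> r. if r = i then A $ k else A $ r) = det (\<chi> r. if r = i then (\<Sum>j\<in>UNIV. A $ k $ j *s axis j 1) else A $ r)"
    by (simp only: basis_expansion)
  also have "\<dots> = (\<Sum>j\<in>UNIV. det (\<chi> r. if r = i then A $ k $ j *s axis j 1 else A $ r))"
    by (rule det_linear_row_sum) simp
  also have "\<dots> = (\<Sum>j\<in>UNIV. cofactor A i j * A $ k $ j)"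
    by (simp add: det_row_mul cofactor_def mult.commute)
  finally have eq: "(\<Sum>j\<in>UNIV. cofactor A i j * A $ k $ j) = det (\<chi> r. if r = i then A $ k else A $ r)" ..
  show ?thesis
  proof (cases "i = k")
    case True
    have "(\<chi> r. if r = i then A $ k else A $ r) = A" using True by (simp add: vec_eq_iff)
    then show ?thesis using True eq by simp
  next
    case False
    have "det (\<chi> r. if r = i then A $ k else A $ r) = 0"
      by (rule det_identical_rows[OF False]) (use False in \<open>simp add: row_def vec_eq_iff\<close>)
    then show ?thesis using False eq by simp
  qed
qed

section \<open>Rational cutoff functions\<close>

text \<open>The overview's \<Psi> is the case \<open>a = m\<close>, \<open>b = 1\<close>. The
  exponents record how often the determinant vanishes at 0 and how often the denominator occurs
  after differentiations.\<close>

definition cutoff :: "nat \<Rightarrow> real \<Rightarrow> nat \<Rightarrow> nat \<Rightarrow> real \<Rightarrow> real" where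
  "cutoff m \<eta> a b x = x ^ a / (x ^ m + \<eta> ^ m) ^ b"

lemma cutoff_pos: "even m \<Longrightarrow> 0 < \<eta> \<Longrightarrow> 0 < x ^ m + \<eta> ^ m" for x \<eta> :: real
  by (simp add: add_nonneg_pos zero_le_even_power)

text \<open>The difference of \<open>a\<close> and \<open>m * b\<close> is the degree of homogeneity
  in \<open>x\<close> and \<eta> jointly. In both terms it is exactly one lower than before, which
  is the loss of one power of \<eta>.\<close>

lemma cutoff_deriv:
  assumes "even m" "0 < \<eta>" "m \<ge> 2"
  shows "(cutoff m \<eta> (Suc a) b has_real_derivative
     (real (Suc a) * cutoff m \<eta> a b x - real (b * m) * cutoff m \<eta> (a + m) (Suc b) x)) (at x)"
proof (cases b)
  case 0
  have "((\<lambda>x. x ^ Suc a) has_real_derivative real (Suc a) * x ^ a) (at x)"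
    by (auto intro!: derivative_eq_intros simp del: power_Suc)
  then show ?thesis using 0 by (simp add: cutoff_def[abs_def])
next
  case (Suc b')
  define u where "u = x ^ m + \<eta> ^ m"
  have u: "u > 0" unfolding u_def by (rule cutoff_pos[OF assms(1,2)])
  have du: "((\<lambda>x. (x ^ m + \<eta> ^ m) ^ b) has_real_derivative real b * (real m * x ^ (m - 1)) * u ^ b') (at x)"
  proof -
    have "((\<lambda>x. x ^ m + \<eta> ^ m) has_real_derivative real m * x ^ (m - 1)) (at x)"
      by (auto intro!: derivative_eq_intros)
    from DERIV_power[OF this, of b] show ?thesis using Suc by (simp add: u_def mult.assoc)
  qed
  have "((\<lambda>x. x ^ Suc a / (x ^ m + \<eta> ^ m) ^ b) has_real_derivative
     ((real (Suc a) * x ^ a) * u ^ b - x ^ Suc a * (real b * (real m * x ^ (m - 1)) * u ^ b')) / (u ^ b * u ^ b)) (at x)"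
    using u by (intro DERIV_divide[OF _ du, folded u_def]) (auto intro!: derivative_eq_intros simp del: power_Suc simp: u_def)
  moreover have "((real (Suc a) * x ^ a) * u ^ b - x ^ Suc a * (real b * (real m * x ^ (m - 1)) * u ^ b')) / (u ^ b * u ^ b)
     = real (Suc a) * (x ^ a / u ^ b) - real (b * m) * (x ^ (a + m) / u ^ Suc b)"
  proof -
    obtain n where "m = Suc n" using assms(3) by (cases m) auto
    then show ?thesis using u Suc by (simp add: field_simps power_add)
  qed
  ultimately show ?thesis by (simp add: cutoff_def[abs_def] u_def)
qed

text \<open>With \<open>s\<close> the larger of |x| and \<eta>, the numerator is at most s^a and the
  denominator at least s^(mb). As the resulting exponent is nonpositive, \<open>s\<close> may be
  lowered to \<eta>.\<close>

lemma cutoff_le: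
  assumes m: "even m" and \<eta>: "0 < \<eta>" and ab: "a \<le> m * b"
  shows "\<bar>cutoff m \<eta> a b x\<bar> \<le> \<eta> powr (real a - real (m * b))"
proof -
  define s where "s = max \<bar>x\<bar> \<eta>"
  have s: "s > 0" "\<bar>x\<bar> \<le> s" "\<eta> \<le> s" using \<eta> by (auto simp: s_def)
  have u: "0 < x ^ m + \<eta> ^ m" by (rule cutoff_pos[OF m \<eta>])
  have "s ^ m \<le> x ^ m + \<eta> ^ m"
    using m \<eta> by (auto simp: s_def max_def power_even_abs zero_le_even_power)
  then have "(s ^ m) ^ b \<le> (x ^ m + \<eta> ^ m) ^ b" using s by (intro power_mono) auto
  moreover have "\<bar>x\<bar> ^ a \<le> s ^ a" using s by (intro power_mono) auto
  ultimately have "\<bar>x\<bar> ^ a / (x ^ m + \<eta> ^ m) ^ b \<le> s ^ a / (s ^ m) ^ b"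
    using s by (intro frac_le) auto
  also have "\<dots> = s powr (real a - real (m * b))"
    using s by (simp add: powr_diff powr_realpow[symmetric] powr_powr power_mult[symmetric])
  also have "\<dots> \<le> \<eta> powr (real a - real (m * b))"
    using ab \<eta> s by (intro powr_mono2') (auto simp flip: of_nat_mult)
  finally show ?thesis using u by (simp add: cutoff_def abs_divide power_abs)
qed

lemma poly_growth: "\<exists>C\<ge>0. \<exists>n. \<forall>x. \<bar>poly P x\<bar> \<le> C * (1 + \<bar>x\<bar>) ^ n" for P :: "real poly"
proof (induction P)
  case 0
  show ?case by (auto intro: exI[of _ 0])
next
  case (pCons a P)
  then obtain C n where C: "C \<ge> 0" "\<And>x. \<bar>poly P x\<bar> \<le> C * (1 + \<bar>x\<bar>) ^ n" by blast
  have "\<bar>poly (pCons a P) x\<bar> \<le> (\<bar>a\<bar> + C) * (1 + \<bar>x\<bar>) ^ Suc n" for x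
  proof -
    have "\<bar>poly (pCons a P) x\<bar> \<le> \<bar>a\<bar> + \<bar>x\<bar> * \<bar>poly P x\<bar>" by (simp add: abs_mult[symmetric])
    also have "\<dots> \<le> \<bar>a\<bar> * (1 + \<bar>x\<bar>) ^ Suc n + (1 + \<bar>x\<bar>) * (C * (1 + \<bar>x\<bar>) ^ n)"
    proof (intro add_mono mult_mono C)
      have "1 \<le> (1 + \<bar>x\<bar>) ^ Suc n" by (intro one_le_power) simp
      then show "\<bar>a\<bar> \<le> \<bar>a\<bar> * (1 + \<bar>x\<bar>) ^ Suc n" by (simp add: mult_le_cancel_left1 del: power_Suc)
    qed auto
    finally show ?thesis by (simp add: algebra_simps)
  qed
  then show ?case using C(1) by (intro exI[of _ "\<bar>a\<bar> + C"] conjI exI[of _ "Suc n"]) auto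
qed

text \<open>Arbitrary polynomial numerators make closure under differentiation the quotient rule.
  The class serves to certify smoothness; the dependence on \<eta> is tracked by
  \<open>cutoff\<close> itself.\<close>

definition cutoff_class :: "nat \<Rightarrow> real \<Rightarrow> (real \<Rightarrow> real) set" where
  "cutoff_class m \<eta> = {\<lambda>x. poly P x / (x ^ m + \<eta> ^ m) ^ b | P b. True}"

lemma smooth_class_cutoff:
  assumes m: "even m" and \<eta>: "0 < \<eta>"
  shows "smooth_class (cutoff_class m \<eta>)"
  unfolding smooth_class_def
proof (intro ballI conjI)
  fix g assume "g \<in> cutoff_class m \<eta>"
  then obtain P b where g: "g = (\<lambda>x. poly P x / (x ^ m + \<eta> ^ m) ^ b)" by (auto simp: cutoff_class_def)
  define U :: "real poly" where "U = monom 1 m + [:\<eta> ^ m:]"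
  have U: "poly U x = x ^ m + \<eta> ^ m" for x by (simp add: U_def poly_monom)
  have U0: "poly U x > 0" for x unfolding U by (rule cutoff_pos[OF m \<eta>])
  define Q where "Q = pderiv P * U - smult (of_nat b) (P * pderiv U)"
  have "((\<lambda>x. poly P x / poly U x ^ b) has_real_derivative poly Q x / poly U x ^ Suc b) (at x)" for x
  proof (cases b)
    case 0
    then show ?thesis using U0[of x] by (simp add: Q_def)
  next
    case (Suc b')
    have "((\<lambda>x. poly U x ^ b) has_real_derivative of_nat b * poly (pderiv U) x * poly U x ^ b') (at x)"
      using DERIV_power[OF poly_DERIV[of U x], of b] Suc by (simp add: mult.assoc)
    from DERIV_divide[OF poly_DERIV this]
    have "((\<lambda>x. poly P x / poly U x ^ b) has_real_derivative
      (poly (pderiv P) x * poly U x ^ b - poly P x * (of_nat b * poly (pderiv U) x * poly U x ^ b')) / (poly U x ^ b * poly U x ^ b)) (at x)"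
      using U0[of x] by simp
    moreover have "(poly (pderiv P) x * poly U x ^ b - poly P x * (of_nat b * poly (pderiv U) x * poly U x ^ b')) / (poly U x ^ b * poly U x ^ b)
       = poly Q x / poly U x ^ Suc b"
      using U0[of x] Suc by (simp add: Q_def field_simps)
    ultimately show ?thesis by simp
  qed
  then show "\<exists>g'\<in>cutoff_class m \<eta>. \<forall>x. (g has_real_derivative g' x) (at x)"
    unfolding g U cutoff_class_def
    by (intro bexI[of _ "\<lambda>x. poly Q x / (x ^ m + \<eta> ^ m) ^ Suc b"] allI CollectI exI[of _ Q] exI[of _ "Suc b"]) auto
  obtain C n where C: "C \<ge> 0" "\<And>x. \<bar>poly P x\<bar> \<le> C * (1 + \<bar>x\<bar>) ^ n" using poly_growth by blast
  have "\<bar>g x\<bar> \<le> (C / (\<eta> ^ m) ^ b) * (1 + \<bar>x\<bar>) ^ n" for x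
  proof -
    have "(\<eta> ^ m) ^ b \<le> (x ^ m + \<eta> ^ m) ^ b"
      using m \<eta> by (intro power_mono) (auto simp: zero_le_even_power)
    then have "\<bar>poly P x\<bar> / (x ^ m + \<eta> ^ m) ^ b \<le> (C * (1 + \<bar>x\<bar>) ^ n) / (\<eta> ^ m) ^ b"
      using C \<eta> by (intro frac_le) auto
    then show ?thesis using cutoff_pos[OF m \<eta>, of x] by (simp add: g abs_divide)
  qed
  then show "\<exists>C n. \<forall>x. \<bar>g x\<bar> \<le> C * (1 + \<bar>x\<bar>) ^ n" by blast
qed

lemma cutoff_in_class: "cutoff m \<eta> a b \<in> cutoff_class m \<eta>"
  unfolding cutoff_class_def cutoff_def[abs_def]
  by (rule CollectI, rule exI[of _ "monom 1 a"]) (auto simp: poly_monom)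

section \<open>Trigonometric polynomials\<close>

type_synonym 'd trig = "(real \<times> (real ^ 'd) \<times> real) list"

definition trig_fun :: "'d::finite trig \<Rightarrow> real ^ 'd \<Rightarrow> real" where
  "trig_fun l x = (\<Sum>(c, \<xi>, \<theta>)\<leftarrow>l. c * cos (\<xi> \<bullet> x + \<theta>))"

text \<open>Differentiating a cosine advances its phase by pi / 2, so the directional derivative
  acts entry by entry and never leaves lists of cosines.\<close>

definition trig_deriv :: "real ^ 'd \<Rightarrow> 'd::finite trig \<Rightarrow> 'd trig" where
  "trig_deriv v l = map (\<lambda>(c, \<xi>, \<theta>). (c * (\<xi> \<bullet> v), \<xi>, \<theta> + pi / 2)) l"

lemma trig_fun_Nil [simp]: "trig_fun [] x = 0"
  and trig_fun_Cons [simp]: "trig_fun ((c, \<xi>, \<theta>) # l) x = c * cos (\<xi> \<bullet> x + \<theta>) + trig_fun l x"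
  and trig_fun_append [simp]: "trig_fun (l @ l') x = trig_fun l x + trig_fun l' x"
  by (simp_all add: trig_fun_def)

lemma trig_deriv_Nil [simp]: "trig_deriv v [] = []"
  and trig_deriv_Cons [simp]:
    "trig_deriv v ((c, \<xi>, \<theta>) # l) = (c * (\<xi> \<bullet> v), \<xi>, \<theta> + pi / 2) # trig_deriv v l"
  by (simp_all add: trig_deriv_def)

lemma trig_deriv_expand: "trig_fun (trig_deriv v l) x = (\<Sum>i\<in>UNIV. v $ i * trig_fun (trig_deriv (axis i 1) l) x)"
proof (induction l)
  case (Cons t l)
  obtain c \<xi> \<theta> where t: "t = (c, \<xi>, \<theta>)" by (cases t)
  have "\<xi> \<bullet> v = (\<Sum>i\<in>UNIV. v $ i * (\<xi> \<bullet> axis i 1))"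
    by (simp add: inner_vec_def[of \<xi> v] inner_axis mult.commute)
  with Cons show ?case by (simp add: t sum.distrib distrib_left sum_distrib_left sum_distrib_right ac_simps)
qed simp

lemma trig_fun_continuous: "continuous_on A (trig_fun l)"
proof (induction l)
  case (Cons t l)
  obtain c \<xi> \<theta> where t: "t = (c, \<xi>, \<theta>)" by (cases t)
  from Cons show ?case unfolding t trig_fun_Cons by (intro continuous_intros)
qed (simp add: trig_fun_Nil[abs_def])

definition cos_class :: "(real \<Rightarrow> real) set" where
  "cos_class = {\<lambda>x. c * cos (x + \<theta>) | c \<theta>. True}"

lemma cos_deriv: "((\<lambda>x. c * cos (x + \<theta>)) has_real_derivative c * cos (x + (\<theta> + pi / 2))) (at x)"
  by (auto intro!: derivative_eq_intros simp: cos_add sin_add add.assoc[symmetric])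

lemma smooth_class_cos: "smooth_class cos_class"
  unfolding smooth_class_def
proof (intro ballI conjI)
  fix g assume "g \<in> cos_class"
  then obtain c \<theta> where g: "g = (\<lambda>x. c * cos (x + \<theta>))" by (auto simp: cos_class_def)
  show "\<exists>g'\<in>cos_class. \<forall>x. (g has_real_derivative g' x) (at x)"
    unfolding g cos_class_def
    by (rule bexI[of _ "\<lambda>x. c * cos (x + (\<theta> + pi / 2))"]) (use cos_deriv in blast)+
  have "\<bar>g x\<bar> \<le> \<bar>c\<bar> * (1 + \<bar>x\<bar>) ^ 0" for x
    using mult_left_mono[OF abs_cos_le_one[of "x + \<theta>"], of "\<bar>c\<bar>"] by (simp add: g abs_mult)
  then show "\<exists>C m. \<forall>x. \<bar>g x\<bar> \<le> C * (1 + \<bar>x\<bar>) ^ m" by blast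
qed

section \<open>Integration by parts against the covariance determinant\<close>

definition rv_vec :: "('d \<Rightarrow> 'w \<Rightarrow> real) \<Rightarrow> 'w \<Rightarrow> real ^ 'd::finite" where
  "rv_vec F \<omega> = (\<chi> i. F i \<omega>)"

context ibp_framework
begin

text \<open>The covariance matrix on \<open>S\<close>, built from \<open>D\<close> itself; the
  version with \<open>D_bar\<close> appears in the limit only.\<close>

definition cov :: "('d::finite \<Rightarrow> 'w \<Rightarrow> real) \<Rightarrow> 'w \<Rightarrow> real ^ 'd ^ 'd" where
  "cov F \<omega> = (\<chi> i j. \<Gamma> (F i) (F j) \<omega>)"

lemma tame_cov: "tame (\<lambda>F \<omega>. cov F \<omega> $ i $ j)"
  unfolding cov_def using tame_\<Gamma>[OF tame_component] by simp

lemma tame_det_cov: "tame (\<lambda>F \<omega>. det (cov F \<omega>))"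
  by (intro tame_det tame_cov)

lemma tame_cofactor: "tame (\<lambda>F \<omega>. cofactor (cov F \<omega>) i j)"
  unfolding cofactor_def
proof (rule tame_det)
  fix r c
  show "tame (\<lambda>F \<omega>. (\<chi> r. if r = i then axis j 1 else cov F \<omega> $ r) $ r $ c)"
    using tame_const[of "axis j 1 $ c"] tame_cov[of r c] by (cases "r = i") auto
qed

lemma inner_rv_vec_S: "(\<forall>j. F j \<in> S) \<Longrightarrow> (\<lambda>\<omega>. \<xi> \<bullet> rv_vec F \<omega>) \<in> S"
  unfolding rv_vec_def inner_vec_def by (auto intro!: S_sum S_scale)

lemma trig_term_S: "(\<forall>j. F j \<in> S) \<Longrightarrow> (\<lambda>\<omega>. c * cos (\<xi> \<bullet> rv_vec F \<omega> + \<theta>)) \<in> S"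
  by (rule S_compose[OF smooth_class_cos, of "\<lambda>x. c * cos (x + \<theta>)"]) (auto simp: cos_class_def intro: inner_rv_vec_S)

lemma trig_fun_S: assumes "\<forall>j. F j \<in> S" shows "(\<lambda>\<omega>. trig_fun l (rv_vec F \<omega>)) \<in> S"
proof (induction l)
  case Nil show ?case by (simp add: S_zero)
next
  case (Cons t l)
  then show ?case by (cases t) (auto intro!: S_add trig_term_S assms)
qed

lemma \<Gamma>_trig_fun:
  assumes F: "\<forall>j. F j \<in> S"
  shows "AE \<omega> in M. \<Gamma> (\<lambda>\<omega>. trig_fun l (rv_vec F \<omega>)) (F j) \<omega> =
    (\<Sum>k\<in>UNIV. trig_fun (trig_deriv (axis k 1) l) (rv_vec F \<omega>) * cov F \<omega> $ k $ j)"
proof (induction l)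
  case Nil
  show ?case using \<Gamma>_const[of 0 "F j"] by simp
next
  case (Cons t l)
  obtain c \<xi> \<theta> where t: "t = (c, \<xi>, \<theta>)" by (cases t)
  let ?Z = "\<lambda>\<omega>. \<xi> \<bullet> rv_vec F \<omega>"
  let ?h = "\<lambda>\<omega>. c * cos (?Z \<omega> + \<theta>)"
  have "AE \<omega> in M. \<Gamma> ?h (F j) \<omega> = c * cos (?Z \<omega> + (\<theta> + pi / 2)) * \<Gamma> ?Z (F j) \<omega>"
    by (rule \<Gamma>_compose[OF smooth_class_cos _ inner_rv_vec_S[OF F] cos_deriv]) (auto simp: cos_class_def)
  moreover have "AE \<omega> in M. \<Gamma> ?Z (F j) \<omega> = (\<Sum>k\<in>UNIV. \<Gamma> (\<lambda>\<omega>. \<xi> $ k * F k \<omega>) (F j) \<omega>)"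
    unfolding rv_vec_def inner_vec_def using F by (simp, intro \<Gamma>_sum) (auto intro: S_scale)
  moreover have "AE \<omega> in M. \<forall>k\<in>UNIV. \<Gamma> (\<lambda>\<omega>. \<xi> $ k * F k \<omega>) (F j) \<omega> = \<xi> $ k * \<Gamma> (F k) (F j) \<omega>"
  proof (rule AE_finite_allI)
    fix k
    show "AE \<omega> in M. \<Gamma> (\<lambda>\<omega>. \<xi> $ k * F k \<omega>) (F j) \<omega> = \<xi> $ k * \<Gamma> (F k) (F j) \<omega>"
      using D_scale[OF F[rule_format], of "\<xi> $ k" k] by eventually_elim (simp add: \<Gamma>_def)
  qed simp
  moreover have "AE \<omega> in M. \<Gamma> (\<lambda>\<omega>. ?h \<omega> + trig_fun l (rv_vec F \<omega>)) (F j) \<omega>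
      = \<Gamma> ?h (F j) \<omega> + \<Gamma> (\<lambda>\<omega>. trig_fun l (rv_vec F \<omega>)) (F j) \<omega>"
    by (intro \<Gamma>_add trig_term_S trig_fun_S F)
  ultimately show ?case using Cons
    by eventually_elim
      (simp add: t cov_def inner_axis sum.distrib sum_distrib_left distrib_left distrib_right ac_simps)
qed

text \<open>Cramer's rule: the chain rule expresses \<Gamma>(g, F_j) through the partial derivatives
  of \<open>g\<close> and the entries of the covariance matrix, and summation against cofactors
  isolates the i-th one, multiplied by the determinant. All coefficients are polynomial in the
  entries.\<close>

lemma det_cov_trig_deriv:
  assumes F: "\<forall>j. F j \<in> S"
  shows "AE \<omega> in M. trig_fun (trig_deriv (axis i 1) l) (rv_vec F \<omega>) * det (cov F \<omega>) =
    (\<Sum>j\<in>UNIV. cofactor (cov F \<omega>) i j * \<Gamma> (\<lambda>\<omega>. trig_fun l (rv_vec F \<omega>)) (F j) \<omega>)"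
proof -
  have "AE \<omega> in M. \<forall>j\<in>UNIV. \<Gamma> (\<lambda>\<omega>. trig_fun l (rv_vec F \<omega>)) (F j) \<omega> =
    (\<Sum>k\<in>UNIV. trig_fun (trig_deriv (axis k 1) l) (rv_vec F \<omega>) * cov F \<omega> $ k $ j)"
    by (intro AE_finite_allI \<Gamma>_trig_fun F) simp
  then show ?thesis
  proof eventually_elim
    case (elim \<omega>)
    let ?g = "\<lambda>k. trig_fun (trig_deriv (axis k 1) l) (rv_vec F \<omega>)"
    have "(\<Sum>j\<in>UNIV. cofactor (cov F \<omega>) i j * \<Gamma> (\<lambda>\<omega>. trig_fun l (rv_vec F \<omega>)) (F j) \<omega>)
      = (\<Sum>j\<in>UNIV. \<Sum>k\<in>UNIV. ?g k * (cofactor (cov F \<omega>) i j * cov F \<omega> $ k $ j))"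
      using elim by (simp add: sum_distrib_left ac_simps)
    also have "\<dots> = (\<Sum>k\<in>UNIV. ?g k * (\<Sum>j\<in>UNIV. cofactor (cov F \<omega>) i j * cov F \<omega> $ k $ j))"
      by (subst sum.swap) (simp add: sum_distrib_left)
    also have "\<dots> = ?g i * det (cov F \<omega>)"
      by (simp add: sum_cofactor if_distrib[of "\<lambda>x. _ * x"] cong: if_cong)
    finally show ?case by simp
  qed
qed


text \<open>The divergence, in the sense of the adjoint in \<open>\<Gamma>_ibp\<close>, of the field
  given by the sum over \<open>j\<close> of \<open>X F\<close> times the cofactor times DF_j. The
  form \<open>+ (- 1)\<close> matches the closure rules for tame functionals.\<close>

definition div_weight ::
  "'d \<Rightarrow> (('d::finite \<Rightarrow> 'w \<Rightarrow> real) \<Rightarrow> 'w \<Rightarrow> real) \<Rightarrow> ('d \<Rightarrow> 'w \<Rightarrow> real) \<Rightarrow> 'w \<Rightarrow> real" where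
  "div_weight i X F = (\<lambda>\<omega>. \<Sum>j\<in>UNIV. X F \<omega> * cofactor (cov F \<omega>) i j * L (F j) \<omega>
     + (- 1) * \<Gamma> (\<lambda>\<omega>. X F \<omega> * cofactor (cov F \<omega>) i j) (F j) \<omega>)"

text \<open>The derivative of the determinant along the same field; it appears whenever the cutoff
  is differentiated.\<close>

definition det_weight ::
  "'d \<Rightarrow> (('d::finite \<Rightarrow> 'w \<Rightarrow> real) \<Rightarrow> 'w \<Rightarrow> real) \<Rightarrow> ('d \<Rightarrow> 'w \<Rightarrow> real) \<Rightarrow> 'w \<Rightarrow> real" where
  "det_weight i X F = (\<lambda>\<omega>. \<Sum>j\<in>UNIV. X F \<omega> * cofactor (cov F \<omega>) i j * \<Gamma> (\<lambda>\<omega>. det (cov F \<omega>)) (F j) \<omega>)"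

lemma tame_div_weight: "tame X \<Longrightarrow> tame (div_weight i X)"
  unfolding div_weight_def
  by (intro tame_sum tame_add tame_mult tame_const tame_cofactor tame_L tame_\<Gamma> finite)

lemma tame_det_weight: "tame X \<Longrightarrow> tame (det_weight i X)"
  unfolding det_weight_def
  by (intro tame_sum tame_mult tame_cofactor tame_det_cov tame_\<Gamma> finite)

lemma cutoff_det_S:
  assumes F: "\<forall>j. F j \<in> S" and m: "even m" "0 < \<eta>"
  shows "(\<lambda>\<omega>. cutoff m \<eta> a b (det (cov F \<omega>))) \<in> S"
  by (rule S_compose[OF smooth_class_cutoff[OF m] cutoff_in_class tame_S[OF tame_det_cov F]])

text \<open>Of the two spare powers of the determinant, one pays for Cramer's rule and the other is
  lost when the derivation falls on the cutoff. Hence the new cutoffs are \<open>Suc a, b\<close>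
  from the divergence term, and \<open>a, b\<close> and \<open>a + m, Suc b\<close> from
  \<open>cutoff_deriv\<close>.\<close>

lemma ibp_step:
  fixes F :: "'d::finite \<Rightarrow> 'w \<Rightarrow> real" and l :: "'d trig"
  assumes F: "\<forall>j. F j \<in> S" and X: "tame X" and m: "even m" "m \<ge> 2" and \<eta>: "0 < \<eta>"
  defines "g \<equiv> \<lambda>\<omega>. trig_fun l (rv_vec F \<omega>)" and "\<psi> \<equiv> \<lambda>a b \<omega>. cutoff m \<eta> a b (det (cov F \<omega>))"
  shows "expectation (\<lambda>\<omega>. trig_fun (trig_deriv (axis i 1) l) (rv_vec F \<omega>) * (X F \<omega> * \<psi> (Suc (Suc a)) b \<omega>)) =
    expectation (\<lambda>\<omega>. g \<omega> * (div_weight i X F \<omega> * \<psi> (Suc a) b \<omega>))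
    - real (Suc a) * expectation (\<lambda>\<omega>. g \<omega> * (det_weight i X F \<omega> * \<psi> a b \<omega>))
    + real (b * m) * expectation (\<lambda>\<omega>. g \<omega> * (det_weight i X F \<omega> * \<psi> (a + m) (Suc b) \<omega>))"
proof -
  define \<Delta> where "\<Delta> = (\<lambda>\<omega>. det (cov F \<omega>))"
  define U where "U = (\<lambda>j \<omega>. X F \<omega> * cofactor (cov F \<omega>) i j)"
  define W where "W = (\<lambda>j \<omega>. U j \<omega> * \<psi> (Suc a) b \<omega>)"
  have \<Delta>S: "\<Delta> \<in> S" unfolding \<Delta>_def by (rule tame_S[OF tame_det_cov F])
  have gS: "g \<in> S" unfolding g_def by (rule trig_fun_S[OF F])
  have \<psi>S: "\<psi> a b \<in> S" for a b unfolding \<psi>_def by (rule cutoff_det_S[OF F m(1) \<eta>])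
  have US: "U j \<in> S" for j unfolding U_def by (intro S_mult tame_S[OF X F] tame_S[OF tame_cofactor F])
  have WS: "W j \<in> S" for j unfolding W_def by (intro S_mult US \<psi>S)
  have dgS: "(\<lambda>\<omega>. trig_fun (trig_deriv (axis i 1) l) (rv_vec F \<omega>)) \<in> S" by (rule trig_fun_S[OF F])
  note wS = tame_S[OF tame_div_weight[OF X] F] tame_S[OF tame_det_weight[OF X] F]
  have d\<psi>: "AE \<omega> in M. \<forall>j\<in>UNIV. \<Gamma> (\<psi> (Suc a) b) (F j) \<omega> =
      (real (Suc a) * \<psi> a b \<omega> - real (b * m) * \<psi> (a + m) (Suc b) \<omega>) * \<Gamma> \<Delta> (F j) \<omega>"
    unfolding \<psi>_def \<Delta>_def
    by (intro AE_finite_allI \<Gamma>_compose[OF smooth_class_cutoff[OF m(1) \<eta>] cutoff_in_class _ cutoff_deriv[OF m(1) \<eta> m(2)]]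
        tame_S[OF tame_det_cov F]) simp
  have dW: "AE \<omega> in M. \<forall>j\<in>UNIV. \<Gamma> (W j) (F j) \<omega> = U j \<omega> * \<Gamma> (\<psi> (Suc a) b) (F j) \<omega> + \<psi> (Suc a) b \<omega> * \<Gamma> (U j) (F j) \<omega>"
    unfolding W_def by (intro AE_finite_allI \<Gamma>_mult US \<psi>S) simp
  have "expectation (\<lambda>\<omega>. trig_fun (trig_deriv (axis i 1) l) (rv_vec F \<omega>) * (X F \<omega> * \<psi> (Suc (Suc a)) b \<omega>))
     = expectation (\<lambda>\<omega>. \<Sum>j\<in>UNIV. W j \<omega> * \<Gamma> g (F j) \<omega>)"
  proof (rule integral_cong_AE)
    show "AE \<omega> in M. trig_fun (trig_deriv (axis i 1) l) (rv_vec F \<omega>) * (X F \<omega> * \<psi> (Suc (Suc a)) b \<omega>)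
       = (\<Sum>j\<in>UNIV. W j \<omega> * \<Gamma> g (F j) \<omega>)"
      using det_cov_trig_deriv[OF F, of i l]
    proof eventually_elim
      case (elim \<omega>)
      have "\<psi> (Suc (Suc a)) b \<omega> = \<Delta> \<omega> * \<psi> (Suc a) b \<omega>" by (simp add: \<psi>_def \<Delta>_def cutoff_def)
      then have "trig_fun (trig_deriv (axis i 1) l) (rv_vec F \<omega>) * (X F \<omega> * \<psi> (Suc (Suc a)) b \<omega>)
        = (trig_fun (trig_deriv (axis i 1) l) (rv_vec F \<omega>) * det (cov F \<omega>)) * (X F \<omega> * \<psi> (Suc a) b \<omega>)"
        by (simp add: \<Delta>_def)
      also have "\<dots> = (\<Sum>j\<in>UNIV. W j \<omega> * \<Gamma> g (F j) \<omega>)"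
        unfolding elim by (simp add: W_def U_def g_def sum_distrib_left sum_distrib_right ac_simps)
      finally show ?case .
    qed
    show "(\<lambda>\<omega>. trig_fun (trig_deriv (axis i 1) l) (rv_vec F \<omega>) * (X F \<omega> * \<psi> (Suc (Suc a)) b \<omega>)) \<in> borel_measurable M"
      by (intro S_borel S_mult dgS tame_S[OF X F] \<psi>S)
    show "(\<lambda>\<omega>. \<Sum>j\<in>UNIV. W j \<omega> * \<Gamma> g (F j) \<omega>) \<in> borel_measurable M"
      by (intro S_borel S_sum S_mult WS \<Gamma>_S gS F[rule_format] finite)
  qed
  also have "\<dots> = (\<Sum>j\<in>UNIV. expectation (\<lambda>\<omega>. W j \<omega> * \<Gamma> g (F j) \<omega>))"
    by (intro Bochner_Integration.integral_sum S_integrable S_mult WS \<Gamma>_S gS F[rule_format])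
  also have "\<dots> = (\<Sum>j\<in>UNIV. expectation (\<lambda>\<omega>. g \<omega> * (W j \<omega> * L (F j) \<omega> - \<Gamma> (W j) (F j) \<omega>)))"
    by (intro sum.cong refl \<Gamma>_ibp WS gS F[rule_format])
  also have "\<dots> = expectation (\<lambda>\<omega>. \<Sum>j\<in>UNIV. g \<omega> * (W j \<omega> * L (F j) \<omega> - \<Gamma> (W j) (F j) \<omega>))"
    by (intro Bochner_Integration.integral_sum[symmetric] S_integrable S_mult S_diff L_S WS \<Gamma>_S gS F[rule_format])
  also have "\<dots> = expectation (\<lambda>\<omega>. g \<omega> * (div_weight i X F \<omega> * \<psi> (Suc a) b \<omega>)
      - real (Suc a) * (g \<omega> * (det_weight i X F \<omega> * \<psi> a b \<omega>))
      + real (b * m) * (g \<omega> * (det_weight i X F \<omega> * \<psi> (a + m) (Suc b) \<omega>)))"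
  proof (rule integral_cong_AE)
    show "AE \<omega> in M. (\<Sum>j\<in>UNIV. g \<omega> * (W j \<omega> * L (F j) \<omega> - \<Gamma> (W j) (F j) \<omega>)) =
      g \<omega> * (div_weight i X F \<omega> * \<psi> (Suc a) b \<omega>)
      - real (Suc a) * (g \<omega> * (det_weight i X F \<omega> * \<psi> a b \<omega>))
      + real (b * m) * (g \<omega> * (det_weight i X F \<omega> * \<psi> (a + m) (Suc b) \<omega>))"
      using d\<psi> dW
    proof eventually_elim
      case (elim \<omega>)
      define c where "c = real (Suc a) * \<psi> a b \<omega> - real (b * m) * \<psi> (a + m) (Suc b) \<omega>"
      have 1: "W j \<omega> * L (F j) \<omega> - \<Gamma> (W j) (F j) \<omega> =
          (U j \<omega> * L (F j) \<omega> + (- 1) * \<Gamma> (U j) (F j) \<omega>) * \<psi> (Suc a) b \<omega> - c * (U j \<omega> * \<Gamma> \<Delta> (F j) \<omega>)" for j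
      proof -
        have "\<Gamma> (W j) (F j) \<omega> = U j \<omega> * \<Gamma> (\<psi> (Suc a) b) (F j) \<omega> + \<psi> (Suc a) b \<omega> * \<Gamma> (U j) (F j) \<omega>"
          using elim(2) by blast
        moreover have "\<Gamma> (\<psi> (Suc a) b) (F j) \<omega> = c * \<Gamma> \<Delta> (F j) \<omega>" using elim(1) unfolding c_def by blast
        moreover have "W j \<omega> = U j \<omega> * \<psi> (Suc a) b \<omega>" by (simp add: W_def)
        ultimately show ?thesis by (simp add: algebra_simps)
      qed
      have eq: "(\<Sum>j\<in>UNIV. W j \<omega> * L (F j) \<omega> - \<Gamma> (W j) (F j) \<omega>) =
          div_weight i X F \<omega> * \<psi> (Suc a) b \<omega> - c * det_weight i X F \<omega>"
        unfolding 1 sum_subtractf div_weight_def det_weight_def U_def \<Delta>_def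
        by (simp add: sum_distrib_left sum_distrib_right)
      show ?case
        unfolding sum_distrib_left[symmetric] eq by (simp add: c_def algebra_simps)
    qed
    show "(\<lambda>\<omega>. \<Sum>j\<in>UNIV. g \<omega> * (W j \<omega> * L (F j) \<omega> - \<Gamma> (W j) (F j) \<omega>)) \<in> borel_measurable M"
      by (intro S_borel S_sum S_mult S_diff WS \<Gamma>_S L_S gS F[rule_format] finite)
    show "(\<lambda>\<omega>. g \<omega> * (div_weight i X F \<omega> * \<psi> (Suc a) b \<omega>)
      - real (Suc a) * (g \<omega> * (det_weight i X F \<omega> * \<psi> a b \<omega>))
      + real (b * m) * (g \<omega> * (det_weight i X F \<omega> * \<psi> (a + m) (Suc b) \<omega>))) \<in> borel_measurable M"
      by (intro S_borel S_add S_diff S_scale S_mult gS wS \<psi>S)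
  qed
  also have "\<dots> = expectation (\<lambda>\<omega>. g \<omega> * (div_weight i X F \<omega> * \<psi> (Suc a) b \<omega>))
    - real (Suc a) * expectation (\<lambda>\<omega>. g \<omega> * (det_weight i X F \<omega> * \<psi> a b \<omega>))
    + real (b * m) * expectation (\<lambda>\<omega>. g \<omega> * (det_weight i X F \<omega> * \<psi> (a + m) (Suc b) \<omega>))"
  proof -
    have "integrable M (\<lambda>\<omega>. g \<omega> * (div_weight i X F \<omega> * \<psi> a b \<omega>))" "integrable M (\<lambda>\<omega>. g \<omega> * (det_weight i X F \<omega> * \<psi> a b \<omega>))" for a b
      by (intro S_integrable S_mult gS wS \<psi>S)+
    then show ?thesis by simp
  qed
  finally show ?thesis .
qed

text \<open>The quantifier pattern of \<open>moments_controlled\<close> for an arbitrary relation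
  between \<open>F\<close> and a constant; finitely many such relations, monotone in the constant,
  can be satisfied with a common constant.\<close>

definition unif_bound :: "(('i::finite \<Rightarrow> 'w \<Rightarrow> real) \<Rightarrow> real \<Rightarrow> bool) \<Rightarrow> bool" where
  "unif_bound P \<longleftrightarrow> (\<exists>K. \<forall>R. \<exists>C\<ge>0. \<forall>F. norm_bd K R F \<longrightarrow> P F C)"

lemma unif_bound_imp:
  assumes "unif_bound P" "\<And>F C. \<forall>j. F j \<in> S \<Longrightarrow> 0 \<le> C \<Longrightarrow> P F C \<Longrightarrow> Q F (h C)" "\<And>C. 0 \<le> C \<Longrightarrow> 0 \<le> h C"
  shows "unif_bound Q"
  using assms unfolding unif_bound_def norm_bd_def by meson

lemma unif_bound_conj:
  fixes P Q :: "('i::finite \<Rightarrow> 'w \<Rightarrow> real) \<Rightarrow> real \<Rightarrow> bool"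
  assumes P: "unif_bound P" and Q: "unif_bound Q"
    and "\<And>F C C'. C \<le> C' \<Longrightarrow> P F C \<Longrightarrow> P F C'" "\<And>F C C'. C \<le> C' \<Longrightarrow> Q F C \<Longrightarrow> Q F C'"
  shows "unif_bound (\<lambda>F C. P F C \<and> Q F C)"
proof -
  obtain K1 K2 where K: "\<And>R. \<exists>C\<ge>0. \<forall>F. norm_bd K1 R F \<longrightarrow> P F C" "\<And>R. \<exists>C\<ge>0. \<forall>F. norm_bd K2 R F \<longrightarrow> Q F C"
    using P Q unfolding unif_bound_def by meson
  show ?thesis unfolding unif_bound_def
  proof (intro exI[of _ "max K1 K2"] allI)
    fix R
    obtain C1 C2 where C: "C1 \<ge> 0" "\<And>F. norm_bd K1 (1 + R) F \<Longrightarrow> P F C1" "C2 \<ge> 0" "\<And>F. norm_bd K2 (1 + R) F \<Longrightarrow> Q F C2"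
      using K by meson
    show "\<exists>C\<ge>0. \<forall>F. norm_bd (max K1 K2) R F \<longrightarrow> P F C \<and> Q F C"
    proof (intro exI[of _ "max C1 C2"] conjI allI impI)
      fix F :: "'i \<Rightarrow> 'w \<Rightarrow> real" assume F: "norm_bd (max K1 K2) R F"
      show "P F (max C1 C2)" by (rule assms(3)[OF _ C(2)[OF norm_bd_mono[OF F]]]) auto
      show "Q F (max C1 C2)" by (rule assms(4)[OF _ C(4)[OF norm_bd_mono[OF F]]]) auto
    qed (use C in auto)
  qed
qed

lemma unif_bound_finite:
  assumes "finite A" "\<And>a. a \<in> A \<Longrightarrow> unif_bound (P a)"
    and "\<And>a F C C'. C \<le> C' \<Longrightarrow> P a F C \<Longrightarrow> P a F C'"
  shows "unif_bound (\<lambda>F C. \<forall>a\<in>A. P a F C)"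
  using assms(1,2)
proof (induction A rule: finite_induct)
  case empty
  then show ?case by (auto simp: unif_bound_def)
next
  case (insert a A)
  have "unif_bound (\<lambda>F C. P a F C \<and> (\<forall>a\<in>A. P a F C))"
  proof (rule unif_bound_conj)
    show "unif_bound (P a)" "unif_bound (\<lambda>F C. \<forall>a\<in>A. P a F C)" using insert by auto
  qed (use assms(3) in blast)+
  then show ?case by simp
qed

text \<open>The right side sees the trigonometric polynomial only through its supremum bound
  \<open>B\<close>. The exponent of \<eta> is the degree of the cutoff, lowered by 2 for each
  derivative removed.\<close>

definition ibp_estimate ::
  "real \<Rightarrow> nat \<Rightarrow> nat \<Rightarrow> (('d::finite \<Rightarrow> 'w \<Rightarrow> real) \<Rightarrow> 'w \<Rightarrow> real) \<Rightarrow> nat \<Rightarrow> nat \<Rightarrow> ('d \<Rightarrow> 'w \<Rightarrow> real) \<Rightarrow> real \<Rightarrow> bool" where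
  "ibp_estimate \<eta>0 m k X a b F C \<longleftrightarrow> (\<forall>\<eta> l y B. 0 < \<eta> \<and> \<eta> \<le> \<eta>0 \<and> (\<forall>x. \<bar>trig_fun l x\<bar> \<le> B) \<longrightarrow>
     \<bar>expectation (\<lambda>\<omega>. trig_fun ((trig_deriv y ^^ k) l) (rv_vec F \<omega>) * (X F \<omega> * cutoff m \<eta> a b (det (cov F \<omega>))))\<bar>
       \<le> C * norm y ^ k * B * \<eta> powr (real a - real (m * b) - 2 * real k))"

lemma ibp_estimate_mono:
  fixes X :: "('d::finite \<Rightarrow> 'w \<Rightarrow> real) \<Rightarrow> 'w \<Rightarrow> real"
  assumes le: "C \<le> C'" and est: "ibp_estimate \<eta>0 m k X a b F C"
  shows "ibp_estimate \<eta>0 m k X a b F C'"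
  unfolding ibp_estimate_def
proof (intro allI impI)
  fix \<eta> and l :: "'d trig" and y :: "real ^ 'd" and B assume *: "0 < \<eta> \<and> \<eta> \<le> \<eta>0 \<and> (\<forall>x. \<bar>trig_fun l x\<bar> \<le> B)"
  then have "0 \<le> B" using abs_ge_zero order_trans by blast
  then have "C * norm y ^ k * B * \<eta> powr (real a - real (m * b) - 2 * real k)
     \<le> C' * norm y ^ k * B * \<eta> powr (real a - real (m * b) - 2 * real k)"
    using le by (intro mult_right_mono) auto
  with est * show "\<bar>expectation (\<lambda>\<omega>. trig_fun ((trig_deriv y ^^ k) l) (rv_vec F \<omega>) * (X F \<omega> * cutoff m \<eta> a b (det (cov F \<omega>))))\<bar>
       \<le> C' * norm y ^ k * B * \<eta> powr (real a - real (m * b) - 2 * real k)"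
    unfolding ibp_estimate_def by (meson order_trans)
qed

text \<open>Each integration by parts divides by the determinant and differentiates a power of it, hence costs \<open>\<eta>\<^sup>-\<^sup>2\<close>.\<close>

lemma ibp_estimate_tame:
  fixes X :: "('d::finite \<Rightarrow> 'w \<Rightarrow> real) \<Rightarrow> 'w \<Rightarrow> real"
  assumes m: "even m" "m \<ge> 2" and \<eta>0: "\<eta>0 > 0"
  shows "tame X \<Longrightarrow> 2 * k \<le> a \<Longrightarrow> a \<le> m * b \<Longrightarrow> unif_bound (ibp_estimate \<eta>0 m k X a b)"
proof (induction k arbitrary: X a b)
  case 0
  have "moments_controlled X" using 0(1) tame_upto.simps(1) unfolding tame_def by blast
  then obtain K where K: "\<And>R. \<exists>C. \<forall>F. norm_bd K R F \<longrightarrow> expectation (\<lambda>\<omega>. X F \<omega> ^ (2 * 1)) \<le> C"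
    unfolding moments_controlled_def by (metis order_refl)
  have "unif_bound (\<lambda>F C. expectation (\<lambda>\<omega>. X F \<omega> ^ 2) \<le> C)"
    unfolding unif_bound_def
  proof (intro exI[of _ K] allI)
    fix R
    obtain C where "\<And>F. norm_bd K R F \<Longrightarrow> expectation (\<lambda>\<omega>. X F \<omega> ^ 2) \<le> C" using K by auto
    then show "\<exists>C\<ge>0. \<forall>F. norm_bd K R F \<longrightarrow> expectation (\<lambda>\<omega>. X F \<omega> ^ 2) \<le> C"
      by (intro exI[of _ "max 0 C"]) (auto simp: le_max_iff_disj)
  qed
  then show ?case
  proof (rule unif_bound_imp)
    fix F :: "'d \<Rightarrow> 'w \<Rightarrow> real" and C :: real
    assume F: "\<forall>j. F j \<in> S" and C: "0 \<le> C" "expectation (\<lambda>\<omega>. X F \<omega> ^ 2) \<le> C"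
    have XS: "X F \<in> S" by (rule tame_S[OF 0(1) F])
    \<comment> \<open>Without derivatives only the mean of |X| is needed; it is at most 1 plus the
      second moment.\<close>
    show "ibp_estimate \<eta>0 m 0 X a b F (1 + C)"
      unfolding ibp_estimate_def
    proof (intro allI impI)
      fix \<eta> and l :: "'d trig" and y :: "real ^ 'd" and B assume *: "0 < \<eta> \<and> \<eta> \<le> \<eta>0 \<and> (\<forall>x. \<bar>trig_fun l x\<bar> \<le> B)"
      then have B: "0 \<le> B" using abs_ge_zero order_trans by blast
      define e where "e = \<eta> powr (real a - real (m * b))"
      let ?h = "\<lambda>\<omega>. trig_fun l (rv_vec F \<omega>) * (X F \<omega> * cutoff m \<eta> a b (det (cov F \<omega>)))"
      have hS: "?h \<in> S" using * by (intro S_mult trig_fun_S F XS cutoff_det_S m) auto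
      have "\<bar>expectation ?h\<bar> \<le> expectation (\<lambda>\<omega>. \<bar>?h \<omega>\<bar>)" by (rule integral_abs_bound)
      also have "\<dots> \<le> expectation (\<lambda>\<omega>. B * e * (1 + X F \<omega> ^ 2))"
      proof (rule integral_mono)
        show "integrable M (\<lambda>\<omega>. \<bar>?h \<omega>\<bar>)" by (intro integrable_abs S_integrable hS)
        show "integrable M (\<lambda>\<omega>. B * e * (1 + X F \<omega> ^ 2))" by (intro S_integrable S_scale S_add S_const S_power XS)
        fix \<omega>
        have 1: "\<bar>X F \<omega>\<bar> \<le> 1 + X F \<omega> ^ 2"
          using power_le_one_plus[of "\<bar>X F \<omega>\<bar>" 1 2] by simp
        have 2: "\<bar>cutoff m \<eta> a b (det (cov F \<omega>))\<bar> \<le> e"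
          unfolding e_def using * 0 m by (intro cutoff_le) auto
        have "\<bar>trig_fun l (rv_vec F \<omega>)\<bar> * (\<bar>X F \<omega>\<bar> * \<bar>cutoff m \<eta> a b (det (cov F \<omega>))\<bar>) \<le> B * ((1 + X F \<omega> ^ 2) * e)"
          using * B by (intro mult_mono 1 2) (auto simp: e_def)
        then show "\<bar>?h \<omega>\<bar> \<le> B * e * (1 + X F \<omega> ^ 2)" by (simp add: abs_mult ac_simps)
      qed
      also have "\<dots> = B * e * (1 + expectation (\<lambda>\<omega>. X F \<omega> ^ 2))"
        using S_integrable[OF S_power[OF XS, of 2]] by (simp add: prob_space)
      also have "\<dots> \<le> B * e * (1 + C)" using C B by (intro mult_left_mono) (auto simp: e_def)
      finally show "\<bar>expectation (\<lambda>\<omega>. trig_fun ((trig_deriv y ^^ 0) l) (rv_vec F \<omega>) * (X F \<omega> * cutoff m \<eta> a b (det (cov F \<omega>))))\<bar>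
        \<le> (1 + C) * norm y ^ 0 * B * \<eta> powr (real a - real (m * b) - 2 * real 0)"
        by (simp add: e_def ac_simps)
    qed
  qed simp
next
  case (Suc k)
  \<comment> \<open>The requirement \<open>2 * Suc k \<le> a\<close> provides the two powers of the
    determinant consumed by one step and leaves \<open>2 * k\<close> for the rest.\<close>
  obtain a' where a: "a = Suc (Suc a')" using Suc.prems(2) by (cases a; cases "a - 1") auto
  have mb: "m * Suc b = m * b + m" by simp
  define P where "P = (\<lambda>i F C. ibp_estimate \<eta>0 m k (div_weight i X) (Suc a') b F C \<and>
     ibp_estimate \<eta>0 m k (det_weight i X) a' b F C \<and> ibp_estimate \<eta>0 m k (det_weight i X) (a' + m) (Suc b) F C)"
  have Pmono: "C \<le> C' \<Longrightarrow> P i F C \<Longrightarrow> P i F C'" for i F C C'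
    unfolding P_def using ibp_estimate_mono by blast
  have "unif_bound (P i)" for i
    unfolding P_def using Suc.prems a mb
    by (intro unif_bound_conj Suc.IH tame_div_weight tame_det_weight) (auto intro: ibp_estimate_mono)
  then have "unif_bound (\<lambda>F C. \<forall>i\<in>UNIV. P i F C)"
    using Pmono by (intro unif_bound_finite) auto
  then show ?case
  proof (rule unif_bound_imp)
    \<comment> \<open>The three summands are the bound for the extra power of \<eta> in the
      divergence term and the two coefficients in \<open>ibp_step\<close>; the factor
      \<open>CARD('d)\<close> comes from expanding the direction \<open>y\<close> in
      coordinates.\<close>
    define h where "h = (\<lambda>C. real CARD('d) * (\<eta>0 + real (Suc a') + real (b * m)) * C)"
    show "0 \<le> h C" if "0 \<le> C" for C using that \<eta>0 by (simp add: h_def)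
    fix F :: "'d \<Rightarrow> 'w \<Rightarrow> real" and C :: real
    assume F: "\<forall>j. F j \<in> S" and C: "0 \<le> C" and P: "\<forall>i\<in>UNIV. P i F C"
    show "ibp_estimate \<eta>0 m (Suc k) X a b F (h C)"
      unfolding ibp_estimate_def
    proof (intro allI impI)
      fix \<eta> and l :: "'d trig" and y :: "real ^ 'd" and B assume *: "0 < \<eta> \<and> \<eta> \<le> \<eta>0 \<and> (\<forall>x. \<bar>trig_fun l x\<bar> \<le> B)"
      then have B: "0 \<le> B" using abs_ge_zero order_trans by blast
      have \<eta>: "0 < \<eta>" using * by simp
      define e where "e = \<eta> powr (real a - real (m * b) - 2 * real (Suc k))"
      define N where "N = C * norm y ^ k * B"
      have N0: "0 \<le> N" using C B by (simp add: N_def)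
      have e0: "0 \<le> e" by (simp add: e_def)
      define l' where "l' = (trig_deriv y ^^ k) l"
      let ?\<psi> = "\<lambda>a b \<omega>. cutoff m \<eta> a b (det (cov F \<omega>))"
      let ?T = "\<lambda>i \<omega>. trig_fun (trig_deriv (axis i 1) l') (rv_vec F \<omega>) * (X F \<omega> * ?\<psi> a b \<omega>)"
      have TS: "?T i \<in> S" for i
        by (intro S_mult trig_fun_S F tame_S[OF Suc.prems(1) F] cutoff_det_S m \<eta>)
      have each: "\<bar>expectation (?T i)\<bar> \<le> (\<eta>0 + real (Suc a') + real (b * m)) * (N * e)" for i
      proof -
        have bound: "\<bar>expectation (\<lambda>\<omega>. trig_fun l' (rv_vec F \<omega>) * (Y F \<omega> * ?\<psi> a1 b1 \<omega>))\<bar>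
           \<le> N * \<eta> powr (real a1 - real (m * b1) - 2 * real k)"
          if "ibp_estimate \<eta>0 m k Y a1 b1 F C" for Y a1 b1
          using that * unfolding ibp_estimate_def l'_def N_def by blast
        have P': "ibp_estimate \<eta>0 m k (div_weight i X) (Suc a') b F C"
          "ibp_estimate \<eta>0 m k (det_weight i X) a' b F C" "ibp_estimate \<eta>0 m k (det_weight i X) (a' + m) (Suc b) F C"
          using P by (auto simp: P_def)
        have "\<eta> powr (real (Suc a') - real (m * b) - 2 * real k) = \<eta> powr (1 + (real a - real (m * b) - 2 * real (Suc k)))"
          by (rule arg_cong[where f = "\<lambda>x. \<eta> powr x"]) (simp add: a)
        also have "\<dots> = \<eta> * e" unfolding powr_add e_def using \<eta> by simp
        also have "\<dots> \<le> \<eta>0 * e" using * e0 by (intro mult_right_mono) auto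
        finally have "N * \<eta> powr (real (Suc a') - real (m * b) - 2 * real k) \<le> N * (\<eta>0 * e)"
          using N0 by (intro mult_left_mono)
        then have 1: "\<bar>expectation (\<lambda>\<omega>. trig_fun l' (rv_vec F \<omega>) * (div_weight i X F \<omega> * ?\<psi> (Suc a') b \<omega>))\<bar> \<le> N * (\<eta>0 * e)"
          using bound[OF P'(1)] by linarith
        have "real a' - real (m * b) - 2 * real k = real a - real (m * b) - 2 * real (Suc k)" by (simp add: a)
        then have 2: "\<bar>expectation (\<lambda>\<omega>. trig_fun l' (rv_vec F \<omega>) * (det_weight i X F \<omega> * ?\<psi> a' b \<omega>))\<bar> \<le> N * e"
          using bound[OF P'(2)] by (simp only: e_def)
        have "real (a' + m) - real (m * Suc b) - 2 * real k = real a - real (m * b) - 2 * real (Suc k)"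
          by (simp add: a algebra_simps)
        then have 3: "\<bar>expectation (\<lambda>\<omega>. trig_fun l' (rv_vec F \<omega>) * (det_weight i X F \<omega> * ?\<psi> (a' + m) (Suc b) \<omega>))\<bar> \<le> N * e"
          using bound[OF P'(3)] by (simp only: e_def)
        have tri: "\<bar>u - s * v + t * w\<bar> \<le> \<bar>u\<bar> + s * \<bar>v\<bar> + t * \<bar>w\<bar>" if "0 \<le> s" "0 \<le> t" for u v w s t :: real
          using that abs_triangle_ineq[of "u - s * v" "t * w"] abs_triangle_ineq4[of u "s * v"] by (simp add: abs_mult)
        have "\<bar>expectation (?T i)\<bar> \<le> N * (\<eta>0 * e) + real (Suc a') * (N * e) + real (b * m) * (N * e)"
          unfolding a ibp_step[OF F Suc.prems(1) m \<eta>]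
          by (rule order_trans[OF tri]) (use 1 2 3 in \<open>auto intro!: add_mono mult_left_mono simp del: of_nat_Suc of_nat_mult\<close>)
        then show ?thesis by (simp add: algebra_simps)
      qed
      have "expectation (\<lambda>\<omega>. trig_fun ((trig_deriv y ^^ Suc k) l) (rv_vec F \<omega>) * (X F \<omega> * ?\<psi> a b \<omega>))
        = expectation (\<lambda>\<omega>. \<Sum>i\<in>UNIV. y $ i * ?T i \<omega>)"
      proof -
        have "trig_fun ((trig_deriv y ^^ Suc k) l) x = (\<Sum>i\<in>UNIV. y $ i * trig_fun (trig_deriv (axis i 1) l') x)" for x
          unfolding funpow.simps o_apply l'_def[symmetric] by (rule trig_deriv_expand)
        then show ?thesis by (simp add: sum_distrib_right mult.assoc)
      qed
      also have "\<dots> = (\<Sum>i\<in>UNIV. y $ i * expectation (?T i))"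
        by (subst Bochner_Integration.integral_sum) (auto intro!: integrable_mult_right S_integrable TS)
      finally have eq: "expectation (\<lambda>\<omega>. trig_fun ((trig_deriv y ^^ Suc k) l) (rv_vec F \<omega>) * (X F \<omega> * ?\<psi> a b \<omega>))
        = (\<Sum>i\<in>UNIV. y $ i * expectation (?T i))" .
      have "\<bar>\<Sum>i\<in>UNIV. y $ i * expectation (?T i)\<bar> \<le> (\<Sum>i\<in>UNIV. \<bar>y $ i * expectation (?T i)\<bar>)" by (rule sum_abs)
      also have "\<dots> \<le> (\<Sum>i\<in>(UNIV::'d set). norm y * ((\<eta>0 + real (Suc a') + real (b * m)) * (N * e)))"
        unfolding abs_mult by (intro sum_mono mult_mono each component_le_norm_cart) auto
      also have "\<dots> = h C * norm y ^ Suc k * B * e"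
        by (simp add: h_def N_def)
      finally show "\<bar>expectation (\<lambda>\<omega>. trig_fun ((trig_deriv y ^^ Suc k) l) (rv_vec F \<omega>) * (X F \<omega> * cutoff m \<eta> a b (det (cov F \<omega>))))\<bar>
        \<le> h C * norm y ^ Suc k * B * \<eta> powr (real a - real (m * b) - 2 * real (Suc k))"
        unfolding eq e_def .
    qed
  qed
qed

end

section \<open>Moments\<close>

lemma ennreal_tendsto_0_iff:
  fixes f :: "'a \<Rightarrow> ennreal"
  shows "(f \<longlongrightarrow> 0) F \<longleftrightarrow> (\<forall>e>0. eventually (\<lambda>n. f n < ennreal e) F)"
proof (intro iffI allI impI)
  fix e :: real assume "(f \<longlongrightarrow> 0) F" "e > 0"
  then show "eventually (\<lambda>n. f n < ennreal e) F" by (intro order_tendstoD(2)) auto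
next
  assume *: "\<forall>e>0. eventually (\<lambda>n. f n < ennreal e) F"
  show "(f \<longlongrightarrow> 0) F"
  proof (rule order_tendstoI)
    fix a :: ennreal assume "0 < a"
    then obtain z where z: "0 < z" "z < a" using dense by blast
    then obtain r where r: "z = ennreal r" "0 \<le> r" by (cases z) auto
    with z have "r > 0" by (simp add: order.order_iff_strict)
    with * have "eventually (\<lambda>n. f n < ennreal r) F" by blast
    then show "eventually (\<lambda>n. f n < a) F" by eventually_elim (use z r in auto)
  qed auto
qed

lemma Lp_norm_less_iff:
  assumes p: "p > 0" and e: "e > 0"
  shows "Lp_norm M p g < ennreal e \<longleftrightarrow> (\<integral>\<^sup>+ \<omega>. ennreal (\<bar>g \<omega>\<bar> powr p) \<partial>M) < ennreal (e powr p)"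
proof (cases "\<integral>\<^sup>+ \<omega>. ennreal (\<bar>g \<omega>\<bar> powr p) \<partial>M")
  case (real r)
  have "r powr (1 / p) < e \<longleftrightarrow> r < e powr p"
  proof
    assume "r powr (1 / p) < e"
    then have "(r powr (1 / p)) powr p < e powr p" using p by (intro powr_less_mono2) auto
    then show "r < e powr p" using p real by (simp add: powr_powr)
  next
    assume "r < e powr p"
    then have "r powr (1 / p) < (e powr p) powr (1 / p)" using p real by (intro powr_less_mono2) auto
    then show "r powr (1 / p) < e" using p e by (simp add: powr_powr)
  qed
  then show ?thesis using real e by (simp add: Lp_norm_def ennreal_less_iff)
qed (simp add: Lp_norm_def)

lemma Lp_norm_mono_AE:
  assumes p: "p > 0" and "AE \<omega> in M. \<bar>f \<omega>\<bar> \<le> \<bar>g \<omega>\<bar>" "e > 0" "Lp_norm M p g < ennreal e"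
  shows "Lp_norm M p f < ennreal e"
proof -
  have "(\<integral>\<^sup>+ \<omega>. ennreal (\<bar>f \<omega>\<bar> powr p) \<partial>M) \<le> (\<integral>\<^sup>+ \<omega>. ennreal (\<bar>g \<omega>\<bar> powr p) \<partial>M)"
    using assms(2) by (intro nn_integral_mono_AE) (auto elim!: eventually_mono intro!: ennreal_leI powr_mono2 simp: p less_imp_le)
  with assms show ?thesis by (auto simp: Lp_norm_less_iff)
qed

lemma powr_two_times: "k \<ge> 1 \<Longrightarrow> \<bar>x\<bar> powr real (2 * k) = (x\<^sup>2) ^ k" for x :: real
  by (cases "x = 0") (auto simp: powr_realpow power_mult simp del: of_nat_mult)

lemma Lp_norm_two_less_iff:
  "e > 0 \<Longrightarrow> Lp_norm M 2 g < ennreal e \<longleftrightarrow> (\<integral>\<^sup>+ \<omega>. ennreal ((g \<omega>)\<^sup>2) \<partial>M) < ennreal (e\<^sup>2)"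
  using Lp_norm_less_iff[of 2 e M g] powr_two_times[of 1] by (simp add: abs_of_pos)

lemma Lp_norm_two_tendsto_iff:
  "((\<lambda>n. Lp_norm M 2 (g n)) \<longlongrightarrow> 0) F \<longleftrightarrow> ((\<lambda>n. \<integral>\<^sup>+ \<omega>. ennreal ((g n \<omega>)\<^sup>2) \<partial>M) \<longlongrightarrow> 0) F"
  unfolding ennreal_tendsto_0_iff
proof (intro iffI allI impI)
  fix e :: real assume "e > 0" "\<forall>e>0. \<forall>\<^sub>F n in F. Lp_norm M 2 (g n) < ennreal e"
  then have "\<forall>\<^sub>F n in F. Lp_norm M 2 (g n) < ennreal (sqrt e)" by simp
  then show "\<forall>\<^sub>F n in F. (\<integral>\<^sup>+ \<omega>. ennreal ((g n \<omega>)\<^sup>2) \<partial>M) < ennreal e"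
    using \<open>e > 0\<close> by (simp add: Lp_norm_two_less_iff)
next
  fix e :: real assume e: "e > 0" and *: "\<forall>e>0. \<forall>\<^sub>F n in F. (\<integral>\<^sup>+ \<omega>. ennreal ((g n \<omega>)\<^sup>2) \<partial>M) < ennreal e"
  from *[rule_format, of "e\<^sup>2"] e show "\<forall>\<^sub>F n in F. Lp_norm M 2 (g n) < ennreal e"
    by (simp add: Lp_norm_two_less_iff)
qed

text \<open>Turns smallness of a Sobolev norm into a moment bound for \<open>sq\<close>, which is of
  quadratic size; hence the exponent \<open>2 * k\<close> for a moment of order
  \<open>k\<close>.\<close>

lemma Lp_norm_dominated:
  assumes "Y \<in> borel_measurable M" "\<And>\<omega>. 0 \<le> Y \<omega>" "AE \<omega> in M. Y \<omega> \<le> (A \<omega>)\<^sup>2"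
    and A: "Lp_norm M (real (2 * k)) A < ennreal e" and k: "k \<ge> 1" and e: "e > 0"
  shows "integrable M (\<lambda>\<omega>. Y \<omega> ^ k)" "(\<integral>\<omega>. Y \<omega> ^ k \<partial>M) \<le> (e\<^sup>2) ^ k"
proof -
  have [measurable]: "Y \<in> borel_measurable M" by fact
  have "(\<integral>\<^sup>+ \<omega>. ennreal (Y \<omega> ^ k) \<partial>M) \<le> (\<integral>\<^sup>+ \<omega>. ennreal (\<bar>A \<omega>\<bar> powr real (2 * k)) \<partial>M)"
    unfolding powr_two_times[OF k]
    using assms(3) by (intro nn_integral_mono_AE) (auto elim!: eventually_mono intro!: ennreal_leI power_mono assms(2))
  also have "\<dots> < ennreal (e powr real (2 * k))"
    using A k e by (subst (asm) Lp_norm_less_iff) auto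
  also have "e powr real (2 * k) = (e\<^sup>2) ^ k" using powr_two_times[OF k, of e] e by simp
  finally have *: "(\<integral>\<^sup>+ \<omega>. ennreal (Y \<omega> ^ k) \<partial>M) < ennreal ((e\<^sup>2) ^ k)" .
  then show "integrable M (\<lambda>\<omega>. Y \<omega> ^ k)"
    using assms(2) by (intro integrableI_nonneg) (auto intro: less_trans[OF _ ennreal_less_top])
  show "(\<integral>\<omega>. Y \<omega> ^ k \<partial>M) \<le> (e\<^sup>2) ^ k"
  proof -
    have "(\<integral>\<omega>. Y \<omega> ^ k \<partial>M) = enn2real (\<integral>\<^sup>+ \<omega>. ennreal (Y \<omega> ^ k) \<partial>M)"
      by (rule integral_eq_nn_integral) (auto simp: assms(2))
    also have "\<dots> \<le> (e\<^sup>2) ^ k" by (rule enn2real_leI) (use * in \<open>auto intro: less_imp_le\<close>)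
    finally show ?thesis .
  qed
qed

lemma Lp_norm_finite_bound: assumes "Lp_norm M p g < \<infinity>" shows "\<exists>e>0. Lp_norm M p g < ennreal e"
proof (cases "Lp_norm M p g")
  case (real r)
  then show ?thesis by (intro exI[of _ "r + 1"]) (auto simp: ennreal_less_iff)
qed (use assms in auto)

text \<open>Above \<open>e\<close> the quotient y / e exceeds 1 and its powers grow. Integrated over
  a probability space, this makes the first moment small as soon as the k-th one is.\<close>

lemma le_eps_power:
  fixes y e :: real assumes "0 \<le> y" "e > 0" "k \<ge> 1"
  shows "y \<le> e + y ^ k / e ^ (k - 1)"
proof (cases "y \<le> e")
  case True
  then show ?thesis using assms by (simp add: add_increasing2)
next
  case False
  obtain n where k: "k = Suc n" using assms(3) by (cases k) auto
  have "e ^ n \<le> y ^ n" using False assms by (intro power_mono) auto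
  then have "y * e ^ n \<le> y * y ^ n" using assms by (intro mult_left_mono) auto
  then have "y \<le> y ^ k / e ^ (k - 1)" using assms by (simp add: k field_simps)
  then show ?thesis using assms by simp
qed

lemma sum_squares_le_square_sum:
  fixes h :: "'a \<Rightarrow> real"
  assumes "finite A" "\<And>a. a \<in> A \<Longrightarrow> 0 \<le> h a"
  shows "(\<Sum>a\<in>A. (h a)\<^sup>2) \<le> (\<Sum>a\<in>A. h a)\<^sup>2"
  using assms
proof (induction A rule: finite_induct)
  case (insert a A)
  have "0 \<le> h a * (\<Sum>a\<in>A. h a)" using insert by (intro mult_nonneg_nonneg sum_nonneg) auto
  then show ?case using insert by (simp add: power2_sum)
qed simp

section \<open>Hilbert-Schmidt norms\<close>

lemma hs_sums_nonneg: "s \<in> hs_sums q T \<Longrightarrow> 0 \<le> s"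
  by (auto simp: hs_sums_def intro: sum_nonneg)

lemma hs_sums_zero: "q \<ge> 1 \<Longrightarrow> 0 \<in> hs_sums q T"
  unfolding hs_sums_def by (auto intro!: exI[of _ "{}"] intro: sum.neutral)

lemma hs_norm_ge:
  assumes "bdd_above (hs_sums q T)" "orthonormal B"
  shows "(\<Sum>hs\<in>{hs. set hs \<subseteq> B \<and> length hs = q}. (T hs)\<^sup>2) \<le> (hs_norm q T)\<^sup>2" "0 \<le> hs_norm q T"
proof -
  have B: "(\<Sum>hs\<in>{hs. set hs \<subseteq> B \<and> length hs = q}. (T hs)\<^sup>2) \<in> hs_sums q T"
    using assms(2) unfolding hs_sums_def orthonormal_def by blast
  have "(\<Sum>hs\<in>{hs. set hs \<subseteq> B \<and> length hs = q}. (T hs)\<^sup>2) \<le> Sup (hs_sums q T)"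
    by (rule cSup_upper[OF B assms(1)])
  moreover have "0 \<le> Sup (hs_sums q T)"
    using hs_sums_nonneg[OF B] cSup_upper[OF B assms(1)] by linarith
  ultimately show "(\<Sum>hs\<in>{hs. set hs \<subseteq> B \<and> length hs = q}. (T hs)\<^sup>2) \<le> (hs_norm q T)\<^sup>2" "0 \<le> hs_norm q T"
    by (auto simp: hs_norm_def)
qed

lemma lists_length_one: "{hs. set hs \<subseteq> B \<and> length hs = Suc 0} = (\<lambda>b. [b]) ` B"
  by (auto simp: length_Suc_conv)

lemma hs_sums_inner: "(\<Sum>hs\<in>{hs. set hs \<subseteq> B \<and> length hs = Suc 0}. (v \<bullet> hd hs)\<^sup>2) = (\<Sum>b\<in>B. (v \<bullet> b)\<^sup>2)"
  unfolding lists_length_one by (subst sum.reindex) (auto intro: inj_onI)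

lemma hs_sums_inner_le: "s \<in> hs_sums (Suc 0) (\<lambda>hs. v \<bullet> hd hs) \<Longrightarrow> s \<le> (norm v)\<^sup>2"
  using Bessel_ineq by (auto simp: hs_sums_def hs_sums_inner orthonormal_def)

text \<open>Bessel's inequality bounds all sums by the squared norm of \<open>v\<close>, and the
  single vector v / |v| attains it. Vectors thereby embed isometrically as forms of order one, which
  links \<open>D\<close> with the tensor of order 1.\<close>

lemma hs_norm_inner: "hs_norm (Suc 0) (\<lambda>hs. v \<bullet> hd hs) = norm v"
proof -
  have "Sup (hs_sums (Suc 0) (\<lambda>hs. v \<bullet> hd hs)) = (norm v)\<^sup>2"
  proof (rule cSup_eq_maximum)
    show "(norm v)\<^sup>2 \<in> hs_sums (Suc 0) (\<lambda>hs. v \<bullet> hd hs)"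
    proof (cases "v = 0")
      case True
      then show ?thesis using hs_sums_zero[of "Suc 0"] by simp
    next
      case False
      let ?b = "v /\<^sub>R norm v"
      have "v \<bullet> ?b = norm v" using False by (simp add: dot_square_norm power2_eq_square)
      then have "(v \<bullet> ?b)\<^sup>2 = (norm v)\<^sup>2" by simp
      then have "(norm v)\<^sup>2 = (\<Sum>hs\<in>{hs. set hs \<subseteq> {?b} \<and> length hs = Suc 0}. (v \<bullet> hd hs)\<^sup>2)"
        unfolding hs_sums_inner by simp
      then show ?thesis unfolding hs_sums_def using False by (auto intro!: exI[of _ "{?b}"])
    qed
  qed (rule hs_sums_inner_le)
  then show ?thesis by (simp add: hs_norm_def)
qed

lemma hs_norm_cong: "(\<And>hs. length hs = q \<Longrightarrow> T hs = T' hs) \<Longrightarrow> hs_norm q T = hs_norm q T'"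
proof -
  assume "\<And>hs. length hs = q \<Longrightarrow> T hs = T' hs"
  then have "hs_sums q T = hs_sums q T'"
    unfolding hs_sums_def by (intro Collect_cong ex_cong1 conj_cong arg_cong2[where f = "(=)"] sum.cong) auto
  then show ?thesis by (simp add: hs_norm_def)
qed

lemma hs_tensor_inner: "hs_tensor (Suc 0) (\<lambda>hs. v \<bullet> hd hs)"
  unfolding hs_tensor_def
proof (intro conjI allI impI)
  fix hs :: "'a list" and i assume *: "length hs = Suc 0 \<and> i < Suc 0"
  then have "(\<lambda>h. v \<bullet> hd (hs[i := h])) = (\<lambda>h. v \<bullet> h)" by (auto simp: length_Suc_conv)
  then show "linear (\<lambda>h. v \<bullet> hd (hs[i := h]))" by (simp add: bounded_linear_inner_right bounded_linear.linear)
next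
  show "bdd_above (hs_sums (Suc 0) (\<lambda>hs. v \<bullet> hd hs))" by (rule bdd_aboveI[OF hs_sums_inner_le])
qed

text \<open>A Hilbert-Schmidt form of order one is continuous, so it is determined on a dense set.\<close>

lemma hs_tensor_one_eq:
  fixes T :: "'h::real_inner list \<Rightarrow> real"
  assumes T: "hs_tensor (Suc 0) T" and E: "\<And>X::'h set. open X \<Longrightarrow> X \<noteq> {} \<Longrightarrow> \<exists>d\<in>E. d \<in> X"
    and eq: "\<And>d. d \<in> E \<Longrightarrow> T [d] = v \<bullet> d"
  shows "T [h] = v \<bullet> h"
proof -
  have lin: "linear (\<lambda>h. T [h])"
    using T[unfolded hs_tensor_def, THEN conjunct1, rule_format, of "[undefined]" 0] by simp
  have bdd: "bdd_above (hs_sums (Suc 0) T)" using T by (simp add: hs_tensor_def)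
  define c where "c = hs_norm (Suc 0) T"
  have unit: "\<bar>T [b]\<bar> \<le> c" if "norm b = 1" for b
  proof -
    have "orthonormal {b}" using that by (simp add: orthonormal_def)
    from hs_norm_ge[OF bdd this] have "(T [b])\<^sup>2 \<le> c\<^sup>2" "0 \<le> c" by (simp_all add: lists_length_one c_def)
    then show ?thesis by (metis abs_le_square_iff abs_of_nonneg)
  qed
  have bound: "\<bar>T [h]\<bar> \<le> c * norm h" for h
  proof (cases "h = 0")
    case True then show ?thesis using linear_0[OF lin] by simp
  next
    case False
    have "T [h] = norm h * T [h /\<^sub>R norm h]" using linear_scale[OF lin, of "norm h" "h /\<^sub>R norm h"] False by simp
    then show ?thesis using unit[of "h /\<^sub>R norm h"] False by (simp add: abs_mult mult.commute)
  qed
  have small: "\<bar>T [h] - v \<bullet> h\<bar> \<le> e" if "e > 0" for e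
  proof -
    have c: "0 \<le> c" unfolding c_def by (rule hs_norm_ge(2)[OF bdd, of "{}"]) (simp add: orthonormal_def)
    \<comment> \<open>The summand 1 keeps the denominator positive when both forms vanish.\<close>
    have "0 < e / (c + norm v + 1)" using c that norm_ge_zero[of v] by (intro divide_pos_pos) linarith+
    then obtain d where d: "d \<in> E" "dist h d < e / (c + norm v + 1)"
      using E[of "ball h (e / (c + norm v + 1))"] by auto
    have "T [h] - v \<bullet> h = T [h - d] - v \<bullet> (h - d)"
      using eq[OF d(1)] linear_diff[OF lin, of h d] by (simp add: inner_diff_right)
    then have "\<bar>T [h] - v \<bullet> h\<bar> \<le> \<bar>T [h - d]\<bar> + \<bar>v \<bullet> (h - d)\<bar>" by linarith
    also have "\<dots> \<le> c * norm (h - d) + norm v * norm (h - d)"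
      by (intro add_mono bound Cauchy_Schwarz_ineq2)
    also have "\<dots> \<le> (c + norm v + 1) * norm (h - d)" by (simp add: algebra_simps)
    also have "\<dots> \<le> (c + norm v + 1) * (e / (c + norm v + 1))"
      using d c by (intro mult_left_mono) (auto simp: dist_norm)
    also have "\<dots> = e"
    proof -
      have "c + norm v + 1 \<noteq> 0" using c norm_ge_zero[of v] by linarith
      then show ?thesis unfolding times_divide_eq_right by (rule nonzero_mult_div_cancel_left)
    qed
    finally show ?thesis .
  qed
  have "\<bar>T [h] - v \<bullet> h\<bar> \<le> 0"
  proof (rule field_le_epsilon)
    fix e :: real assume "0 < e"
    from small[OF this] show "\<bar>T [h] - v \<bullet> h\<bar> \<le> 0 + e" by simp
  qed
  then show ?thesis by simp
qed

section \<open>Approximation of smooth functionals\<close>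

context ibp_framework
begin

text \<open>The part of \<open>sq\<close> of order exactly \<open>k\<close>, arranged as the sums in
  \<open>hs_sums\<close> so that it compares with a Hilbert-Schmidt norm.\<close>

definition level :: "'h set \<Rightarrow> nat \<Rightarrow> ('w \<Rightarrow> real) \<Rightarrow> 'w \<Rightarrow> real" where
  "level B k G \<omega> = (\<Sum>hs\<in>{hs. set hs \<subseteq> B \<and> length hs = k}. (iter_D D hs G \<omega>)\<^sup>2)"

lemma level_0: "level B 0 G \<omega> = (G \<omega>)\<^sup>2"
proof -
  have "{hs. set hs \<subseteq> B \<and> length hs = 0} = {[]}" by auto
  then show ?thesis by (simp add: level_def)
qed

lemma level_Suc: "level B (Suc k) G \<omega> = (\<Sum>b\<in>B. level B k (\<lambda>\<omega>. D G \<omega> \<bullet> b) \<omega>)"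
proof -
  let ?A = "{hs. set hs \<subseteq> B \<and> length hs = k}"
  have "level B (Suc k) G \<omega> = (\<Sum>(hs, b)\<in>?A \<times> B. (iter_D D (b # hs) G \<omega>)\<^sup>2)"
    unfolding level_def lists_length_Suc_eq
    by (subst sum.reindex) (auto intro!: inj_onI simp: case_prod_beta)
  also have "\<dots> = (\<Sum>hs\<in>?A. \<Sum>b\<in>B. (iter_D D (b # hs) G \<omega>)\<^sup>2)" by (simp add: sum.cartesian_product)
  also have "\<dots> = (\<Sum>b\<in>B. \<Sum>hs\<in>?A. (iter_D D (b # hs) G \<omega>)\<^sup>2)" by (rule sum.swap)
  finally show ?thesis by (simp add: level_def)
qed

lemma level_nonneg: "0 \<le> level B k G \<omega>"
  unfolding level_def by (intro sum_nonneg) simp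

lemma sq_eq_levels: "sq B m G \<omega> = (\<Sum>k\<le>m. level B k G \<omega>)"
proof (induction m arbitrary: G)
  case 0 show ?case by (simp add: level_0)
next
  case (Suc m)
  have "(\<Sum>k\<le>Suc m. level B k G \<omega>) = (G \<omega>)\<^sup>2 + (\<Sum>k\<le>m. \<Sum>b\<in>B. level B k (\<lambda>\<omega>. D G \<omega> \<bullet> b) \<omega>)"
    by (simp add: sum.atMost_Suc_shift level_0 level_Suc del: sum.atMost_Suc)
  also have "(\<Sum>k\<le>m. \<Sum>b\<in>B. level B k (\<lambda>\<omega>. D G \<omega> \<bullet> b) \<omega>) = (\<Sum>b\<in>B. \<Sum>k\<le>m. level B k (\<lambda>\<omega>. D G \<omega> \<bullet> b) \<omega>)"
    by (rule sum.swap)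
  finally show ?case by (simp add: Suc)
qed

lemma iter_D_S: "G \<in> S \<Longrightarrow> iter_D D hs G \<in> S"
  by (induction hs arbitrary: G) (auto intro: D_dir)

lemma level_S: "finite B \<Longrightarrow> G \<in> S \<Longrightarrow> level B k G \<in> S"
  unfolding level_def[abs_def] by (intro S_sum S_power iter_D_S finite_lists_length_eq)

lemma is_Dq_Dq: "G \<in> S \<Longrightarrow> 1 \<le> q \<Longrightarrow> is_Dq M D q G (Dq M D q G)"
  unfolding Dq_def by (rule someI_ex[OF Dq_exists])

lemma tensor_Dq: "G \<in> S \<Longrightarrow> 1 \<le> q \<Longrightarrow> 1 \<le> p \<Longrightarrow> tensor_Lp M q p (Dq M D q G)"
  using is_Dq_Dq by (auto simp: is_Dq_def)

lemma hs_tensor_Dq: "G \<in> S \<Longrightarrow> 1 \<le> q \<Longrightarrow> hs_tensor q (Dq M D q G \<omega>)"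
  using tensor_Dq[of G q 1] by (auto simp: tensor_Lp_def)

lemma hs_norm_Dq_nonneg: "G \<in> S \<Longrightarrow> 1 \<le> q \<Longrightarrow> 0 \<le> hs_norm q (Dq M D q G \<omega>)"
  using hs_tensor_Dq by (intro hs_norm_ge(2)[of _ _ "{}"]) (auto simp: hs_tensor_def orthonormal_def)

text \<open>The tensor agrees with each iterated directional derivative only off a null set
  depending on the word; a finite \<open>B\<close> has finitely many words of length
  \<open>k\<close>, so one null set suffices.\<close>

lemma level_le_hs_norm:
  assumes B: "orthonormal B" and G: "G \<in> S" and k: "1 \<le> k"
  shows "AE \<omega> in M. level B k G \<omega> \<le> (hs_norm k (Dq M D k G \<omega>))\<^sup>2"
proof -
  have "AE \<omega> in M. \<forall>hs\<in>{hs. set hs \<subseteq> B \<and> length hs = k}. Dq M D k G \<omega> hs = iter_D D hs G \<omega>"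
    using is_Dq_Dq[OF G k] B
    by (intro AE_finite_allI finite_lists_length_eq) (auto simp: is_Dq_def orthonormal_def)
  then show ?thesis
  proof eventually_elim
    case (elim \<omega>)
    then have "level B k G \<omega> = (\<Sum>hs\<in>{hs. set hs \<subseteq> B \<and> length hs = k}. (Dq M D k G \<omega> hs)\<^sup>2)"
      unfolding level_def by (intro sum.cong) auto
    also have "\<dots> \<le> (hs_norm k (Dq M D k G \<omega>))\<^sup>2"
      using hs_tensor_Dq[OF G k] by (intro hs_norm_ge B) (auto simp: hs_tensor_def)
    finally show ?case .
  qed
qed

lemma sq_le_abs_l:
  assumes B: "orthonormal B" and G: "G \<in> S" and l: "m \<le> l"
  shows "AE \<omega> in M. sq B m G \<omega> \<le> (abs_l (Dq M D) l (\<lambda>_::unit. G) \<omega>)\<^sup>2"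
proof -
  have "AE \<omega> in M. \<forall>k\<in>{1..m}. level B k G \<omega> \<le> (hs_norm k (Dq M D k G \<omega>))\<^sup>2"
    by (intro AE_finite_allI level_le_hs_norm B G) auto
  then show ?thesis
  proof eventually_elim
    case (elim \<omega>)
    define h where "h = (\<lambda>k. if k = 0 then \<bar>G \<omega>\<bar> else hs_norm k (Dq M D k G \<omega>))"
    have h: "0 \<le> h k" for k using hs_norm_Dq_nonneg[OF G] by (simp add: h_def)
    have "sq B m G \<omega> \<le> (\<Sum>k\<le>m. (h k)\<^sup>2)"
      unfolding sq_eq_levels using elim by (intro sum_mono) (auto simp: h_def level_0)
    also have "\<dots> \<le> (\<Sum>k\<le>l. (h k)\<^sup>2)" using l by (intro sum_mono2) auto
    also have "\<dots> \<le> (\<Sum>k\<le>l. h k)\<^sup>2" by (intro sum_squares_le_square_sum h) auto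
    also have "(\<Sum>k\<le>l. h k) = abs_l (Dq M D) l (\<lambda>_::unit. G) \<omega>"
    proof -
      have "{..l} = insert 0 {1..l}" by auto
      then have "(\<Sum>k\<le>l. h k) = h 0 + (\<Sum>k=1..l. h k)" by simp
      also have "(\<Sum>k=1..l. h k) = (\<Sum>k=1..l. hs_norm k (Dq M D k G \<omega>))" by (intro sum.cong) (auto simp: h_def)
      finally show ?thesis by (simp add: abs_l_def h_def UNIV_unit)
    qed
    finally show ?case .
  qed
qed

text \<open>The truncated bounds hold simultaneously for all \<open>N\<close> off one null set, and
  Parseval's identity passes them on to the full norm of \<open>D G\<close>.\<close>

lemma D_le_abs_l:
  assumes G: "G \<in> S" and l: "1 \<le> l"
  shows "AE \<omega> in M. (norm (D G \<omega>))\<^sup>2 \<le> (abs_l (Dq M D) l (\<lambda>_::unit. G) \<omega>)\<^sup>2"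
proof -
  have "AE \<omega> in M. \<forall>N. sq (onb N) 1 G \<omega> \<le> (abs_l (Dq M D) l (\<lambda>_::unit. G) \<omega>)\<^sup>2"
    unfolding AE_all_countable by (intro allI sq_le_abs_l orthonormal_onb G l)
  then show ?thesis
  proof eventually_elim
    case (elim \<omega>)
    have "(\<lambda>N. \<Sum>b\<in>onb N. (D G \<omega> \<bullet> b) * (D G \<omega> \<bullet> b)) \<longlonglongrightarrow> D G \<omega> \<bullet> D G \<omega>" by (rule onb_tendsto)
    moreover have "(\<Sum>b\<in>onb N. (D G \<omega> \<bullet> b) * (D G \<omega> \<bullet> b)) \<le> (abs_l (Dq M D) l (\<lambda>_::unit. G) \<omega>)\<^sup>2" for N
    proof -
      have "(\<Sum>b\<in>onb N. (D G \<omega> \<bullet> b) * (D G \<omega> \<bullet> b)) \<le> (G \<omega>)\<^sup>2 + (\<Sum>b\<in>onb N. (D G \<omega> \<bullet> b)\<^sup>2)"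
        by (simp add: power2_eq_square)
      also have "\<dots> = sq (onb N) 1 G \<omega>" by simp
      finally show ?thesis using elim by (meson order_trans)
    qed
    ultimately have "D G \<omega> \<bullet> D G \<omega> \<le> (abs_l (Dq M D) l (\<lambda>_::unit. G) \<omega>)\<^sup>2"
      by (intro LIMSEQ_le_const2) auto
    then show ?case by (simp add: dot_square_norm)
  qed
qed

text \<open>Each order is dominated by the Hilbert-Schmidt norm of the corresponding tensor, which
  has all moments and does not involve \<open>N\<close>; the finitely many orders are then
  added.\<close>

lemma sq_moment_bounded:
  assumes G: "G \<in> S" and K: "K \<ge> 1"
  shows "\<exists>R. \<forall>N. expectation (\<lambda>\<omega>. sq (onb N) K G \<omega> ^ K) \<le> R"
proof -
  have "\<exists>r. \<forall>N. expectation (\<lambda>\<omega>. level (onb N) k G \<omega> ^ K) \<le> r" for k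
  proof (cases "k = 0")
    case True
    then show ?thesis by (auto simp: level_0)
  next
    case False
    have "Lp_norm M (real (2 * K)) (\<lambda>\<omega>. hs_norm k (Dq M D k G \<omega>)) < \<infinity>"
      using tensor_Dq[OF G, of k "real (2 * K)"] False K by (simp add: tensor_Lp_def)
    then obtain e where e: "e > 0" "Lp_norm M (real (2 * K)) (\<lambda>\<omega>. hs_norm k (Dq M D k G \<omega>)) < ennreal e"
      using Lp_norm_finite_bound by blast
    have "expectation (\<lambda>\<omega>. level (onb N) k G \<omega> ^ K) \<le> (e\<^sup>2) ^ K" for N
      using False
      by (intro Lp_norm_dominated(2)[OF _ level_nonneg level_le_hs_norm e(2) K e(1)] S_borel level_S G orthonormal_onb finite_onb) auto
    then show ?thesis by blast
  qed
  then obtain r where r: "\<And>k N. expectation (\<lambda>\<omega>. level (onb N) k G \<omega> ^ K) \<le> r k" by metis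
  have i: "integrable M (\<lambda>\<omega>. level (onb N) k G \<omega> ^ K)" for N k
    by (intro S_integrable S_power level_S finite_onb G)
  have "expectation (\<lambda>\<omega>. sq (onb N) K G \<omega> ^ K) \<le> real (Suc K) ^ K * (\<Sum>k\<le>K. r k)" for N
  proof -
    have "expectation (\<lambda>\<omega>. sq (onb N) K G \<omega> ^ K) \<le> expectation (\<lambda>\<omega>. real (Suc K) ^ K * (\<Sum>k\<le>K. level (onb N) k G \<omega> ^ K))"
    proof (rule integral_mono)
      show "integrable M (\<lambda>\<omega>. sq (onb N) K G \<omega> ^ K)" by (intro S_integrable S_power sq_S finite_onb G)
      show "integrable M (\<lambda>\<omega>. real (Suc K) ^ K * (\<Sum>k\<le>K. level (onb N) k G \<omega> ^ K))"
        using i by (intro integrable_mult_right Bochner_Integration.integrable_sum)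
      show "sq (onb N) K G \<omega> ^ K \<le> real (Suc K) ^ K * (\<Sum>k\<le>K. level (onb N) k G \<omega> ^ K)" for \<omega>
        using sum_power_le_card[of "{..K}" "\<lambda>k. level (onb N) k G \<omega>" K] level_nonneg
        by (simp add: sq_eq_levels del: sum.atMost_Suc)
    qed
    also have "\<dots> = real (Suc K) ^ K * (\<Sum>k\<le>K. expectation (\<lambda>\<omega>. level (onb N) k G \<omega> ^ K))"
      using i by simp
    also have "\<dots> \<le> real (Suc K) ^ K * (\<Sum>k\<le>K. r k)"
      by (intro mult_left_mono sum_mono r) auto
    finally show ?thesis .
  qed
  then show ?thesis by blast
qed

text \<open>The constant is 2^K from \<open>sq_add\<close> times 2^K from taking the power of a sum
  of two terms.\<close>

lemma sq_moment_add:
  assumes "G \<in> S" "H \<in> S" "F \<in> S" "AE \<omega> in M. F \<omega> = G \<omega> + H \<omega>"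
  shows "expectation (\<lambda>\<omega>. sq (onb N) K F \<omega> ^ K) \<le>
    4 ^ K * (expectation (\<lambda>\<omega>. sq (onb N) K G \<omega> ^ K) + expectation (\<lambda>\<omega>. sq (onb N) K H \<omega> ^ K))"
proof -
  have i: "integrable M (\<lambda>\<omega>. sq (onb N) K G \<omega> ^ K)" if "G \<in> S" for G
    by (intro S_integrable S_power sq_S finite_onb that)
  have "AE \<omega> in M. sq (onb N) K F \<omega> = sq (onb N) K (\<lambda>\<omega>. G \<omega> + H \<omega>) \<omega>"
    using assms by (intro sq_cong S_add) auto
  moreover have "AE \<omega> in M. sq (onb N) K (\<lambda>\<omega>. G \<omega> + H \<omega>) \<omega> \<le> 2 * sq (onb N) K G \<omega> + 2 * sq (onb N) K H \<omega>"
    using assms by (intro sq_add) auto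
  ultimately have "AE \<omega> in M. sq (onb N) K F \<omega> ^ K \<le> 4 ^ K * (sq (onb N) K G \<omega> ^ K + sq (onb N) K H \<omega> ^ K)"
  proof eventually_elim
    case (elim \<omega>)
    let ?g = "sq (onb N) K G \<omega>" and ?h = "sq (onb N) K H \<omega>"
    have "sq (onb N) K F \<omega> ^ K \<le> (2 * (?g + ?h)) ^ K" using elim by (intro power_mono sq_nonneg) simp
    also have "\<dots> = 2 ^ K * (?g + ?h) ^ K" by (rule power_mult_distrib)
    also have "\<dots> \<le> 2 ^ K * (2 ^ K * (?g ^ K + ?h ^ K))"
      using sum_power_le_card[of "UNIV :: bool set" "\<lambda>b. if b then ?g else ?h" K]
      by (intro mult_left_mono) (auto simp: UNIV_bool add.commute sq_nonneg)
    also have "\<dots> = 4 ^ K * (?g ^ K + ?h ^ K)" by (simp add: power_mult_distrib[symmetric] mult.assoc[symmetric])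
    finally show ?case .
  qed
  then have "expectation (\<lambda>\<omega>. sq (onb N) K F \<omega> ^ K) \<le> expectation (\<lambda>\<omega>. 4 ^ K * (sq (onb N) K G \<omega> ^ K + sq (onb N) K H \<omega> ^ K))"
    using assms i by (intro integral_mono_AE) auto
  also have "\<dots> = 4 ^ K * (expectation (\<lambda>\<omega>. sq (onb N) K G \<omega> ^ K) + expectation (\<lambda>\<omega>. sq (onb N) K H \<omega> ^ K))"
    using assms i by simp
  finally show ?thesis .
qed

lemma D_inf_borel: "F \<in> D_inf M S D L \<Longrightarrow> F \<in> borel_measurable M"
  by (auto simp: D_inf_def D_lp_def)

lemma nn_integral_le_eps_power:
  assumes [measurable]: "Y \<in> borel_measurable M" and "\<And>\<omega>. 0 \<le> Y \<omega>" "e > 0" "k \<ge> 1"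
  shows "(\<integral>\<^sup>+ \<omega>. ennreal (Y \<omega>) \<partial>M) \<le> ennreal e + ennreal (1 / e ^ (k - 1)) * (\<integral>\<^sup>+ \<omega>. ennreal (Y \<omega> ^ k) \<partial>M)"
proof -
  have "ennreal (Y \<omega>) \<le> ennreal e + ennreal (1 / e ^ (k - 1)) * ennreal (Y \<omega> ^ k)" for \<omega>
    using le_eps_power[OF assms(2,3,4), of \<omega>] assms(2)[of \<omega>] assms(3)
    by (simp add: ennreal_mult[symmetric] ennreal_plus[symmetric] ennreal_leI del: ennreal_plus)
  then have "(\<integral>\<^sup>+ \<omega>. ennreal (Y \<omega>) \<partial>M) \<le> (\<integral>\<^sup>+ \<omega>. ennreal e + ennreal (1 / e ^ (k - 1)) * ennreal (Y \<omega> ^ k) \<partial>M)"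
    by (intro nn_integral_mono)
  also have "\<dots> = ennreal e + ennreal (1 / e ^ (k - 1)) * (\<integral>\<^sup>+ \<omega>. ennreal (Y \<omega> ^ k) \<partial>M)"
    by (subst nn_integral_add) (auto simp: nn_integral_cmult emeasure_space_1)
  finally show ?thesis .
qed

lemma D_inf_approx_Cauchy:
  assumes F: "F \<in> D_inf M S D L" and K: "K \<ge> 1"
  obtains G R where "\<And>n::nat. G n \<in> S"
    "\<And>n N. expectation (\<lambda>\<omega>. sq (onb N) K (G n) \<omega> ^ K) \<le> R"
    "\<And>n N. expectation (\<lambda>\<omega>. sq (onb N) K (L (G n)) \<omega> ^ K) \<le> R"
    "(\<lambda>n. \<integral>\<^sup>+ \<omega>. ennreal ((G n \<omega> - F \<omega>)\<^sup>2) \<partial>M) \<longlonglongrightarrow> 0"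
    "\<And>e. e > 0 \<Longrightarrow> \<exists>N0. \<forall>m\<ge>N0. \<forall>n\<ge>N0. (\<integral>\<^sup>+ \<omega>. ennreal ((norm (D (G m) \<omega> - D (G n) \<omega>))\<^sup>2) \<partial>M) < ennreal e"
proof -
  \<comment> \<open>The norm measures \<open>L G\<close> two orders below \<open>G\<close>, so order
    \<open>K + 2\<close> controls both to order \<open>K\<close>; the exponent is
    \<open>2 * K\<close> because \<open>sq\<close> is quadratic and enters with power
    \<open>K\<close>.\<close>
  let ?l = "K + 2" and ?p = "real (2 * K)"
  have [measurable]: "F \<in> borel_measurable M" by (rule D_inf_borel[OF F])
  have "F \<in> D_lp M S D L ?l ?p"
    using F K unfolding D_inf_def by (auto dest!: bspec[of _ _ ?l] bspec[of _ _ ?p])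
  then obtain H where H: "\<And>n. H n \<in> S" "(\<lambda>n. Lp_norm M ?p (\<lambda>\<omega>. H n \<omega> - F \<omega>)) \<longlonglongrightarrow> 0"
    and cau: "\<And>e. e > 0 \<Longrightarrow> \<exists>N. \<forall>m\<ge>N. \<forall>n\<ge>N.
        norm_L M (Dq M D) L ?l ?p (\<lambda>_::unit. \<lambda>\<omega>. H m \<omega> - H n \<omega>) < ennreal e"
    unfolding D_lp_def by blast
  have p: "?p > 0" using K by simp
  have diffS: "(\<lambda>\<omega>. H m \<omega> - H n \<omega>) \<in> S" for m n by (intro S_diff H)
  have split: "Lp_norm M ?p (abs_l (Dq M D) ?l (\<lambda>_::unit. \<lambda>\<omega>. H m \<omega> - H n \<omega>)) < ennreal e"
      "Lp_norm M ?p (abs_l (Dq M D) K (\<lambda>_::unit. L (\<lambda>\<omega>. H m \<omega> - H n \<omega>))) < ennreal e"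
    if "norm_L M (Dq M D) L ?l ?p (\<lambda>_::unit. \<lambda>\<omega>. H m \<omega> - H n \<omega>) < ennreal e" for m n e
    using that unfolding norm_L_def by (auto intro: le_less_trans[rotated] simp: add_increasing add_increasing2)
  \<comment> \<open>From \<open>N1\<close> on the sequence stays within distance 1 of
    \<open>H N1\<close>. As an element of \<open>S\<close> this has finite moments uniformly in the
    truncation, so the whole tail is bounded.\<close>
  obtain N1 where N1: "\<And>m n. m \<ge> N1 \<Longrightarrow> n \<ge> N1 \<Longrightarrow>
      norm_L M (Dq M D) L ?l ?p (\<lambda>_::unit. \<lambda>\<omega>. H m \<omega> - H n \<omega>) < ennreal 1" using cau[of 1] by auto
  obtain R1 R2 where R: "\<And>N. expectation (\<lambda>\<omega>. sq (onb N) K (H N1) \<omega> ^ K) \<le> R1"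
      "\<And>N. expectation (\<lambda>\<omega>. sq (onb N) K (L (H N1)) \<omega> ^ K) \<le> R2"
    using sq_moment_bounded[OF H(1) K] sq_moment_bounded[OF L_S[OF H(1)] K] by meson
  have bd: "expectation (\<lambda>\<omega>. sq (onb N) K (H n) \<omega> ^ K) \<le> 4 ^ K * (1 + R1)"
    "expectation (\<lambda>\<omega>. sq (onb N) K (L (H n)) \<omega> ^ K) \<le> 4 ^ K * (1 + R2)" if n: "n \<ge> N1" for n N
  proof -
    let ?d = "\<lambda>\<omega>. H n \<omega> - H N1 \<omega>"
    have "expectation (\<lambda>\<omega>. sq (onb N) K ?d \<omega> ^ K) \<le> (1\<^sup>2) ^ K"
      by (intro Lp_norm_dominated(2)[OF _ sq_nonneg sq_le_abs_l split(1)[OF N1] K] S_borel sq_S diffS orthonormal_onb finite_onb n) auto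
    moreover have "expectation (\<lambda>\<omega>. sq (onb N) K (H n) \<omega> ^ K) \<le> 4 ^ K *
        (expectation (\<lambda>\<omega>. sq (onb N) K ?d \<omega> ^ K) + expectation (\<lambda>\<omega>. sq (onb N) K (H N1) \<omega> ^ K))"
      by (intro sq_moment_add diffS H) auto
    ultimately show "expectation (\<lambda>\<omega>. sq (onb N) K (H n) \<omega> ^ K) \<le> 4 ^ K * (1 + R1)"
      using R(1)[of N] by (elim order_trans) (auto intro!: mult_left_mono)
    have "expectation (\<lambda>\<omega>. sq (onb N) K (L ?d) \<omega> ^ K) \<le> (1\<^sup>2) ^ K"
      by (intro Lp_norm_dominated(2)[OF _ sq_nonneg sq_le_abs_l split(2)[OF N1] K] S_borel sq_S L_S diffS orthonormal_onb finite_onb n) auto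
    moreover have "expectation (\<lambda>\<omega>. sq (onb N) K (L (H n)) \<omega> ^ K) \<le> 4 ^ K *
        (expectation (\<lambda>\<omega>. sq (onb N) K (L ?d) \<omega> ^ K) + expectation (\<lambda>\<omega>. sq (onb N) K (L (H N1)) \<omega> ^ K))"
    proof (intro sq_moment_add L_S diffS H)
      show "AE \<omega> in M. L (H n) \<omega> = L ?d \<omega> + L (H N1) \<omega>"
        using L_lin[OF H(1)[of n] H(1)[of N1], of 1 "-1"] by eventually_elim simp
    qed
    ultimately show "expectation (\<lambda>\<omega>. sq (onb N) K (L (H n)) \<omega> ^ K) \<le> 4 ^ K * (1 + R2)"
      using R(2)[of N] by (elim order_trans) (auto intro!: mult_left_mono)
  qed
  define G where "G = (\<lambda>n. H (n + N1))"
  show thesis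
  proof (rule that[of G "max (4 ^ K * (1 + R1)) (4 ^ K * (1 + R2))"])
    show "G n \<in> S" for n by (simp add: G_def H)
    show "expectation (\<lambda>\<omega>. sq (onb N) K (G n) \<omega> ^ K) \<le> max (4 ^ K * (1 + R1)) (4 ^ K * (1 + R2))" for n N
      using bd(1)[of "n + N1" N] by (simp add: G_def le_max_iff_disj)
    show "expectation (\<lambda>\<omega>. sq (onb N) K (L (G n)) \<omega> ^ K) \<le> max (4 ^ K * (1 + R1)) (4 ^ K * (1 + R2))" for n N
      using bd(2)[of "n + N1" N] by (simp add: G_def le_max_iff_disj)
    \<comment> \<open>Closeness is given in L^(2K) but wanted in L^2. The threshold is chosen such
      that \<open>le_eps_power\<close> with parameter \<open>e / 2\<close> produces two halves of
      \<open>e\<close>.\<close>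
    have small: "(\<integral>\<^sup>+ \<omega>. ennreal (Y \<omega>) \<partial>M) < ennreal e"
      if [measurable]: "Y \<in> borel_measurable M" and Y: "\<And>\<omega>. 0 \<le> Y \<omega>" and e: "e > 0"
        and s: "(\<integral>\<^sup>+ \<omega>. ennreal (Y \<omega> ^ K) \<partial>M) < ennreal (e / 2 * (e / 2) ^ (K - 1))" for Y e
    proof -
      let ?c = "(e / 2) ^ (K - 1)"
      have c: "?c > 0" using e by simp
      have "ennreal (1 / ?c) * (\<integral>\<^sup>+ \<omega>. ennreal (Y \<omega> ^ K) \<partial>M) < ennreal (1 / ?c) * ennreal (e / 2 * ?c)"
        using s c by (intro ennreal_mult_strict_left_mono) (auto simp: ennreal_mult_less_top)
      also have "\<dots> = ennreal (e / 2)" using c e by (simp add: ennreal_mult[symmetric])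
      finally have "ennreal (1 / ?c) * (\<integral>\<^sup>+ \<omega>. ennreal (Y \<omega> ^ K) \<partial>M) < ennreal (e / 2)" .
      then obtain r where r: "ennreal (1 / ?c) * (\<integral>\<^sup>+ \<omega>. ennreal (Y \<omega> ^ K) \<partial>M) = ennreal r" "0 \<le> r" "r < e / 2"
        by (cases "ennreal (1 / ?c) * (\<integral>\<^sup>+ \<omega>. ennreal (Y \<omega> ^ K) \<partial>M)") (auto simp: ennreal_less_iff)
      then have "ennreal (e / 2) + ennreal (1 / ?c) * (\<integral>\<^sup>+ \<omega>. ennreal (Y \<omega> ^ K) \<partial>M) < ennreal e"
        using e by (simp add: ennreal_plus[symmetric] ennreal_less_iff del: ennreal_plus)
      then show ?thesis
        using nn_integral_le_eps_power[OF that(1) Y _ K, of "e / 2"] e by (simp add: le_less_trans)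
    qed
    show "(\<lambda>n. \<integral>\<^sup>+ \<omega>. ennreal ((G n \<omega> - F \<omega>)\<^sup>2) \<partial>M) \<longlonglongrightarrow> 0"
      unfolding ennreal_tendsto_0_iff
    proof (intro allI impI)
      fix e :: real assume e: "e > 0"
      define t where "t = (e / 2 * (e / 2) ^ (K - 1)) powr (1 / ?p)"
      have t: "t > 0" "t powr ?p = e / 2 * (e / 2) ^ (K - 1)" using e p by (auto simp: t_def powr_powr)
      have "\<forall>\<^sub>F n in sequentially. Lp_norm M ?p (\<lambda>\<omega>. G n \<omega> - F \<omega>) < ennreal t"
        using LIMSEQ_ignore_initial_segment[OF H(2), of N1] t(1) unfolding ennreal_tendsto_0_iff G_def by blast
      then show "\<forall>\<^sub>F n in sequentially. (\<integral>\<^sup>+ \<omega>. ennreal ((G n \<omega> - F \<omega>)\<^sup>2) \<partial>M) < ennreal e"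
      proof eventually_elim
        case (elim n)
        have [measurable]: "G n \<in> borel_measurable M" by (simp add: G_def H S_borel)
        from elim have "(\<integral>\<^sup>+ \<omega>. ennreal (((G n \<omega> - F \<omega>)\<^sup>2) ^ K) \<partial>M) < ennreal (e / 2 * (e / 2) ^ (K - 1))"
          unfolding Lp_norm_less_iff[OF p t(1)] powr_two_times[OF K] t(2) .
        from small[OF _ _ e this] show ?case by simp
      qed
    qed
    fix e :: real assume e: "e > 0"
    define t where "t = (e / 2 * (e / 2) ^ (K - 1)) powr (1 / ?p)"
    have t: "t > 0" "t powr ?p = e / 2 * (e / 2) ^ (K - 1)" using e p by (auto simp: t_def powr_powr)
    obtain N2 where N2: "\<And>m n. m \<ge> N2 \<Longrightarrow> n \<ge> N2 \<Longrightarrow>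
      norm_L M (Dq M D) L ?l ?p (\<lambda>_::unit. \<lambda>\<omega>. H m \<omega> - H n \<omega>) < ennreal t" using cau[OF t(1)] by auto
    show "\<exists>N0. \<forall>m\<ge>N0. \<forall>n\<ge>N0. (\<integral>\<^sup>+ \<omega>. ennreal ((norm (D (G m) \<omega> - D (G n) \<omega>))\<^sup>2) \<partial>M) < ennreal e"
    proof (intro exI[of _ N2] allI impI)
      fix m n assume "m \<ge> N2" "n \<ge> N2"
      then have *: "norm_L M (Dq M D) L ?l ?p (\<lambda>_::unit. \<lambda>\<omega>. H (m + N1) \<omega> - H (n + N1) \<omega>) < ennreal t"
        by (intro N2) auto
      let ?d = "\<lambda>\<omega>. H (m + N1) \<omega> - H (n + N1) \<omega>"
      have [measurable]: "D (G n) \<in> borel_measurable M" for n by (simp add: G_def H D_borel)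
      have "AE \<omega> in M. (norm (D ?d \<omega>))\<^sup>2 \<le> (abs_l (Dq M D) ?l (\<lambda>_::unit. ?d) \<omega>)\<^sup>2"
        by (rule D_le_abs_l[OF diffS]) simp
      moreover have "AE \<omega> in M. D ?d \<omega> = D (G m) \<omega> - D (G n) \<omega>"
        unfolding G_def by (rule D_diff[OF H(1) H(1)])
      ultimately have "AE \<omega> in M. \<bar>norm (D (G m) \<omega> - D (G n) \<omega>)\<bar> \<le> \<bar>abs_l (Dq M D) ?l (\<lambda>_::unit. ?d) \<omega>\<bar>"
        by eventually_elim (subst abs_le_square_iff, simp)
      from Lp_norm_mono_AE[OF p this t(1) split(1)[OF *]]
      have "(\<integral>\<^sup>+ \<omega>. ennreal (((norm (D (G m) \<omega> - D (G n) \<omega>))\<^sup>2) ^ K) \<partial>M) < ennreal (e / 2 * (e / 2) ^ (K - 1))"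
        unfolding Lp_norm_less_iff[OF p t(1)] powr_two_times[OF K] t(2) .
      from small[OF _ _ e this]
      show "(\<integral>\<^sup>+ \<omega>. ennreal ((norm (D (G m) \<omega> - D (G n) \<omega>))\<^sup>2) \<partial>M) < ennreal e" by simp
    qed
  qed
qed

end

section \<open>Closability of \<open>D\<close> and convergence of its extension in L^2\<close>

lemma Lp_norm_two_finite_iff: "Lp_norm M 2 g < \<top> \<longleftrightarrow> (\<integral>\<^sup>+ \<omega>. ennreal ((g \<omega>)\<^sup>2) \<partial>M) < \<top>"
proof -
  have "\<bar>x\<bar> powr 2 = x\<^sup>2" for x :: real using powr_two_times[of 1 x] by simp
  then show ?thesis by (auto simp: Lp_norm_def Let_def less_top)
qed

lemma norm_diff_square_le: "(norm (a - b))\<^sup>2 \<le> 2 * (norm a)\<^sup>2 + 2 * (norm b)\<^sup>2"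
  for a b :: "'a::real_normed_vector"
proof -
  have "(norm (a - b))\<^sup>2 \<le> (norm a + norm b)\<^sup>2" by (intro power_mono norm_triangle_ineq4) simp
  also have "\<dots> \<le> 2 * (norm a)\<^sup>2 + 2 * (norm b)\<^sup>2"
    using sum_squares_bound[of "norm a" "norm b"] by (simp add: power2_sum)
  finally show ?thesis .
qed

lemma nn_integral_square_diff:
  fixes A B :: "'w \<Rightarrow> 'b::{real_normed_vector, second_countable_topology}"
  assumes [measurable]: "A \<in> borel_measurable M" "B \<in> borel_measurable M"
  shows "(\<integral>\<^sup>+ \<omega>. ennreal ((norm (A \<omega> - B \<omega>))\<^sup>2) \<partial>M)
    \<le> 2 * (\<integral>\<^sup>+ \<omega>. ennreal ((norm (A \<omega>))\<^sup>2) \<partial>M) + 2 * (\<integral>\<^sup>+ \<omega>. ennreal ((norm (B \<omega>))\<^sup>2) \<partial>M)"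
proof -
  have "(\<integral>\<^sup>+ \<omega>. ennreal ((norm (A \<omega> - B \<omega>))\<^sup>2) \<partial>M)
    \<le> (\<integral>\<^sup>+ \<omega>. ennreal (2 * (norm (A \<omega>))\<^sup>2 + 2 * (norm (B \<omega>))\<^sup>2) \<partial>M)"
    by (intro nn_integral_mono ennreal_leI norm_diff_square_le)
  also have "\<dots> = (\<integral>\<^sup>+ \<omega>. 2 * ennreal ((norm (A \<omega>))\<^sup>2) + 2 * ennreal ((norm (B \<omega>))\<^sup>2) \<partial>M)"
    by (intro nn_integral_cong) (simp add: ennreal_mult)
  also have "\<dots> = 2 * (\<integral>\<^sup>+ \<omega>. ennreal ((norm (A \<omega>))\<^sup>2) \<partial>M) + 2 * (\<integral>\<^sup>+ \<omega>. ennreal ((norm (B \<omega>))\<^sup>2) \<partial>M)"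
    by (subst nn_integral_add) (auto simp: nn_integral_cmult)
  finally show ?thesis .
qed

lemma nn_integral_square_diff_tendsto:
  fixes A B :: "nat \<Rightarrow> 'w \<Rightarrow> 'b::{real_normed_vector, second_countable_topology}"
  assumes [measurable]: "\<And>n. A n \<in> borel_measurable M" "\<And>n. B n \<in> borel_measurable M"
    and "(\<lambda>n. \<integral>\<^sup>+ \<omega>. ennreal ((norm (A n \<omega>))\<^sup>2) \<partial>M) \<longlonglongrightarrow> 0"
    and "(\<lambda>n. \<integral>\<^sup>+ \<omega>. ennreal ((norm (B n \<omega>))\<^sup>2) \<partial>M) \<longlonglongrightarrow> 0"
  shows "(\<lambda>n. \<integral>\<^sup>+ \<omega>. ennreal ((norm (A n \<omega> - B n \<omega>))\<^sup>2) \<partial>M) \<longlonglongrightarrow> 0"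
proof (rule tendsto_sandwich[where f = "\<lambda>_. 0"])
  have "(\<lambda>n. 2 * (\<integral>\<^sup>+ \<omega>. ennreal ((norm (A n \<omega>))\<^sup>2) \<partial>M) + 2 * (\<integral>\<^sup>+ \<omega>. ennreal ((norm (B n \<omega>))\<^sup>2) \<partial>M))
     \<longlonglongrightarrow> 2 * 0 + 2 * 0"
    by (intro tendsto_add ennreal_tendsto_cmult assms) auto
  then show "(\<lambda>n. 2 * (\<integral>\<^sup>+ \<omega>. ennreal ((norm (A n \<omega>))\<^sup>2) \<partial>M) + 2 * (\<integral>\<^sup>+ \<omega>. ennreal ((norm (B n \<omega>))\<^sup>2) \<partial>M)) \<longlonglongrightarrow> 0"
    by simp
qed (auto intro!: always_eventually nn_integral_square_diff)

context ibp_framework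
begin

text \<open>Equality holds almost surely for each direction; a countable dense set gives a common
  null set, and continuity of Hilbert-Schmidt forms of order one extends the equality to all
  directions.\<close>

lemma Dq_one:
  assumes H: "H \<in> S"
  shows "AE \<omega> in M. \<forall>h. Dq M D (Suc 0) H \<omega> [h] = D H \<omega> \<bullet> h"
proof -
  obtain E :: "'h set" where E: "countable E" "\<And>X. open X \<Longrightarrow> X \<noteq> {} \<Longrightarrow> \<exists>d\<in>E. d \<in> X"
    using countable_dense_exists by blast
  have "AE \<omega> in M. Dq M D (Suc 0) H \<omega> [d] = D H \<omega> \<bullet> d" for d
    using is_Dq_Dq[OF H order_refl, unfolded is_Dq_def, THEN conjunct2, rule_format, of "[d]"] by simp
  then have "AE \<omega> in M. \<forall>d\<in>E. Dq M D (Suc 0) H \<omega> [d] = D H \<omega> \<bullet> d"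
    by (simp add: AE_ball_countable[OF E(1)])
  then show ?thesis
  proof eventually_elim
    case (elim \<omega>)
    have "hs_tensor (Suc 0) (Dq M D (Suc 0) H \<omega>)" by (rule hs_tensor_Dq[OF H]) simp
    from hs_tensor_one_eq[OF this E(2)] elim show ?case by blast
  qed
qed

text \<open>The framework's closability is about tensors. \<open>X\<close> is read as the form of
  order one represented by it, and the isometry \<open>hs_norm_inner\<close> translates all three
  conditions.\<close>

lemma D_closable:
  assumes G: "\<And>n. G n \<in> S" and X[measurable]: "X \<in> borel_measurable M" and fin: "(\<integral>\<^sup>+ \<omega>. ennreal ((norm (X \<omega>))\<^sup>2) \<partial>M) < \<infinity>"
    and G0: "(\<lambda>n. \<integral>\<^sup>+ \<omega>. ennreal ((norm (G n \<omega>))\<^sup>2) \<partial>M) \<longlonglongrightarrow> 0"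
    and DG: "(\<lambda>n. \<integral>\<^sup>+ \<omega>. ennreal ((norm (D (G n) \<omega> - X \<omega>))\<^sup>2) \<partial>M) \<longlonglongrightarrow> 0"
  shows "AE \<omega> in M. X \<omega> = 0"
proof -
  let ?X = "\<lambda>\<omega> hs. X \<omega> \<bullet> hd hs"
  have "AE \<omega> in M. hs_norm (Suc 0) (?X \<omega>) = 0"
  proof (rule Dq_closable[of "Suc 0" G])
    show "tensor_Lp M (Suc 0) 2 ?X"
      using fin by (simp add: tensor_Lp_def hs_tensor_inner hs_norm_inner Lp_norm_two_finite_iff)
    show "(\<lambda>n. Lp_norm M 2 (G n)) \<longlonglongrightarrow> 0" using G0 by (simp add: Lp_norm_two_tendsto_iff)
    have "(\<integral>\<^sup>+ \<omega>. ennreal ((hs_norm (Suc 0) (\<lambda>hs. Dq M D (Suc 0) (G n) \<omega> hs - ?X \<omega> hs))\<^sup>2) \<partial>M)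
       = (\<integral>\<^sup>+ \<omega>. ennreal ((norm (D (G n) \<omega> - X \<omega>))\<^sup>2) \<partial>M)" for n
    proof (rule nn_integral_cong_AE)
      show "AE \<omega> in M. ennreal ((hs_norm (Suc 0) (\<lambda>hs. Dq M D (Suc 0) (G n) \<omega> hs - ?X \<omega> hs))\<^sup>2)
          = ennreal ((norm (D (G n) \<omega> - X \<omega>))\<^sup>2)"
        using Dq_one[OF G[of n]]
      proof eventually_elim
        case (elim \<omega>)
        have "hs_norm (Suc 0) (\<lambda>hs. Dq M D (Suc 0) (G n) \<omega> hs - ?X \<omega> hs) = hs_norm (Suc 0) (\<lambda>hs. (D (G n) \<omega> - X \<omega>) \<bullet> hd hs)"
          by (rule hs_norm_cong) (use elim in \<open>auto simp: length_Suc_conv inner_diff_left\<close>)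
        then show ?case by (simp add: hs_norm_inner)
      qed
    qed
    then show "(\<lambda>n. Lp_norm M 2 (\<lambda>\<omega>. hs_norm (Suc 0) (\<lambda>hs. Dq M D (Suc 0) (G n) \<omega> hs - ?X \<omega> hs))) \<longlonglongrightarrow> 0"
      using DG by (simp add: Lp_norm_two_tendsto_iff)
  qed (use G in auto)
  then show ?thesis by eventually_elim (simp add: hs_norm_inner)
qed

lemma D_square_finite: "G \<in> S \<Longrightarrow> (\<integral>\<^sup>+ \<omega>. ennreal ((norm (D G \<omega>))\<^sup>2) \<partial>M) < \<infinity>"
  using D_Lp[of G 2] by (simp add: in_Lp_def Lp_norm_two_finite_iff)

text \<open>The Riesz-Fischer argument for H-valued functions: Cauchy in L^2 implies Cauchy in L^1,
  and a subsequence converges almost surely by completeness of H.\<close>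

lemma D_complete:
  assumes G: "\<And>n. G n \<in> S"
    and cau: "\<And>e. e > 0 \<Longrightarrow> \<exists>N0. \<forall>m\<ge>N0. \<forall>n\<ge>N0. (\<integral>\<^sup>+ \<omega>. ennreal ((norm (D (G m) \<omega> - D (G n) \<omega>))\<^sup>2) \<partial>M) < ennreal e"
  obtains X where "X \<in> borel_measurable M" "(\<integral>\<^sup>+ \<omega>. ennreal ((norm (X \<omega>))\<^sup>2) \<partial>M) < \<infinity>"
    "(\<lambda>n. \<integral>\<^sup>+ \<omega>. ennreal ((norm (D (G n) \<omega> - X \<omega>))\<^sup>2) \<partial>M) \<longlonglongrightarrow> 0"
proof -
  have [measurable]: "D (G n) \<in> borel_measurable M" for n by (rule D_borel[OF G])
  have int: "integrable M (D (G n))" for n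
    using in_Lp_integrable_power[of M 1 "D (G n)"] D_Lp[OF G, of 1] by (auto intro: integrable_norm_cancel)
  have L1: "\<exists>N. \<forall>i\<ge>N. \<forall>j\<ge>N. (LINT \<omega>|M. norm (D (G i) \<omega> - D (G j) \<omega>)) < e" if e: "e > 0" for e
  proof -
    obtain N where N: "\<And>i j. i \<ge> N \<Longrightarrow> j \<ge> N \<Longrightarrow> (\<integral>\<^sup>+ \<omega>. ennreal ((norm (D (G i) \<omega> - D (G j) \<omega>))\<^sup>2) \<partial>M) < ennreal ((e / 2)\<^sup>2)"
      using cau[of "(e / 2)\<^sup>2"] e by (auto simp: zero_less_power2)
    have "(LINT \<omega>|M. norm (D (G i) \<omega> - D (G j) \<omega>)) < e" if ij: "i \<ge> N" "j \<ge> N" for i j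
    proof -
      let ?Y = "\<lambda>\<omega>. norm (D (G i) \<omega> - D (G j) \<omega>)"
      obtain s where s: "(\<integral>\<^sup>+ \<omega>. ennreal ((?Y \<omega>)\<^sup>2) \<partial>M) = ennreal s" "0 \<le> s" "s < (e / 2)\<^sup>2"
        using N[OF ij] by (cases "\<integral>\<^sup>+ \<omega>. ennreal ((?Y \<omega>)\<^sup>2) \<partial>M") (auto simp: ennreal_less_iff)
      have "(\<integral>\<^sup>+ \<omega>. ennreal (?Y \<omega>) \<partial>M) \<le> ennreal (e / 2) + ennreal (1 / (e / 2) ^ (2 - 1)) * ennreal s"
        unfolding s(1)[symmetric] using e by (intro nn_integral_le_eps_power) auto
      also have "\<dots> = ennreal (e / 2 + s / (e / 2))"
        using e s by (simp add: ennreal_mult[symmetric] ennreal_plus[symmetric] del: ennreal_plus)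
      finally have *: "(\<integral>\<^sup>+ \<omega>. ennreal (?Y \<omega>) \<partial>M) \<le> ennreal (e / 2 + s / (e / 2))" .
      have "(LINT \<omega>|M. ?Y \<omega>) = enn2real (\<integral>\<^sup>+ \<omega>. ennreal (?Y \<omega>) \<partial>M)" by (rule integral_eq_nn_integral) auto
      also have "\<dots> \<le> e / 2 + s / (e / 2)" by (rule enn2real_leI) (use * s e in auto)
      also have "s / (e / 2) < e / 2" using s e by (simp add: field_simps power2_eq_square)
      finally show ?thesis by simp
    qed
    then show ?thesis by blast
  qed
  obtain r where r: "strict_mono r" "AE \<omega> in M. Cauchy (\<lambda>i. D (G (r i)) \<omega>)"
    using cauchy_L1_AE_cauchy_subseq[OF int L1] by blast
  define X where "X = (\<lambda>\<omega>. lim (\<lambda>i. D (G (r i)) \<omega>))"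
  have X[measurable]: "X \<in> borel_measurable M" unfolding X_def by (rule borel_measurable_lim_metric) simp
  have lim: "AE \<omega> in M. (\<lambda>i. D (G (r i)) \<omega>) \<longlonglongrightarrow> X \<omega>"
    using r(2) by eventually_elim (simp add: X_def Cauchy_convergent convergent_LIMSEQ_iff[symmetric])
  \<comment> \<open>Fatou's lemma along the subsequence turns the Cauchy bound between members into
    a bound on the distance to the limit.\<close>
  have small: "(\<integral>\<^sup>+ \<omega>. ennreal ((norm (D (G n) \<omega> - X \<omega>))\<^sup>2) \<partial>M) \<le> ennreal e"
    if N: "\<And>m. m \<ge> N \<Longrightarrow> (\<integral>\<^sup>+ \<omega>. ennreal ((norm (D (G n) \<omega> - D (G m) \<omega>))\<^sup>2) \<partial>M) < ennreal e" for n N e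
  proof -
    have "(\<integral>\<^sup>+ \<omega>. ennreal ((norm (D (G n) \<omega> - X \<omega>))\<^sup>2) \<partial>M)
      = (\<integral>\<^sup>+ \<omega>. liminf (\<lambda>i. ennreal ((norm (D (G n) \<omega> - D (G (r i)) \<omega>))\<^sup>2)) \<partial>M)"
    proof (rule nn_integral_cong_AE)
      show "AE \<omega> in M. ennreal ((norm (D (G n) \<omega> - X \<omega>))\<^sup>2) = liminf (\<lambda>i. ennreal ((norm (D (G n) \<omega> - D (G (r i)) \<omega>))\<^sup>2))"
        using lim
      proof eventually_elim
        case (elim \<omega>)
        have "(\<lambda>i. ennreal ((norm (D (G n) \<omega> - D (G (r i)) \<omega>))\<^sup>2)) \<longlonglongrightarrow> ennreal ((norm (D (G n) \<omega> - X \<omega>))\<^sup>2)"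
          by (intro tendsto_ennrealI tendsto_intros elim)
        then show ?case by (intro lim_imp_Liminf[symmetric]) auto
      qed
    qed
    also have "\<dots> \<le> liminf (\<lambda>i. \<integral>\<^sup>+ \<omega>. ennreal ((norm (D (G n) \<omega> - D (G (r i)) \<omega>))\<^sup>2) \<partial>M)"
      by (rule nn_integral_liminf) simp
    also have "\<dots> \<le> limsup (\<lambda>i. \<integral>\<^sup>+ \<omega>. ennreal ((norm (D (G n) \<omega> - D (G (r i)) \<omega>))\<^sup>2) \<partial>M)"
      by (rule Liminf_le_Limsup) simp
    also have "\<dots> \<le> ennreal e"
    proof (rule Limsup_bounded)
      have "(\<integral>\<^sup>+ \<omega>. ennreal ((norm (D (G n) \<omega> - D (G (r i)) \<omega>))\<^sup>2) \<partial>M) \<le> ennreal e" if "i \<ge> N" for i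
        using N[of "r i"] seq_suble[OF r(1), of i] that by (simp add: less_imp_le)
      then show "\<forall>\<^sub>F i in sequentially. (\<integral>\<^sup>+ \<omega>. ennreal ((norm (D (G n) \<omega> - D (G (r i)) \<omega>))\<^sup>2) \<partial>M) \<le> ennreal e"
        by (auto simp: eventually_sequentially)
    qed
    finally show ?thesis .
  qed
  show thesis
  proof (rule that[OF X])
    show "(\<lambda>n. \<integral>\<^sup>+ \<omega>. ennreal ((norm (D (G n) \<omega> - X \<omega>))\<^sup>2) \<partial>M) \<longlonglongrightarrow> 0"
      unfolding ennreal_tendsto_0_iff
    proof (intro allI impI)
      fix e :: real assume e: "e > 0"
      obtain N where N: "\<And>m n. m \<ge> N \<Longrightarrow> n \<ge> N \<Longrightarrow> (\<integral>\<^sup>+ \<omega>. ennreal ((norm (D (G m) \<omega> - D (G n) \<omega>))\<^sup>2) \<partial>M) < ennreal (e / 2)"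
        using cau[of "e / 2"] e by auto
      have "(\<integral>\<^sup>+ \<omega>. ennreal ((norm (D (G n) \<omega> - X \<omega>))\<^sup>2) \<partial>M) < ennreal e" if n: "n \<ge> N" for n
      proof -
        have "(\<integral>\<^sup>+ \<omega>. ennreal ((norm (D (G n) \<omega> - X \<omega>))\<^sup>2) \<partial>M) \<le> ennreal (e / 2)" by (rule small[OF N[OF n]])
        also have "\<dots> < ennreal e" using e by (simp add: ennreal_less_iff)
        finally show ?thesis .
      qed
      then show "\<forall>\<^sub>F n in sequentially. (\<integral>\<^sup>+ \<omega>. ennreal ((norm (D (G n) \<omega> - X \<omega>))\<^sup>2) \<partial>M) < ennreal e"
        by (auto simp: eventually_sequentially)
    qed
    obtain N where N: "\<And>m n. m \<ge> N \<Longrightarrow> n \<ge> N \<Longrightarrow> (\<integral>\<^sup>+ \<omega>. ennreal ((norm (D (G m) \<omega> - D (G n) \<omega>))\<^sup>2) \<partial>M) < ennreal 1"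
      using cau[of 1] by auto
    have fin: "(\<integral>\<^sup>+ \<omega>. ennreal ((norm (D (G N) \<omega> - X \<omega>))\<^sup>2) \<partial>M) < \<infinity>"
      using small[of N N 1, OF N] by (auto intro: le_less_trans)
    have "(\<integral>\<^sup>+ \<omega>. ennreal ((norm (X \<omega>))\<^sup>2) \<partial>M) = (\<integral>\<^sup>+ \<omega>. ennreal ((norm (D (G N) \<omega> - (D (G N) \<omega> - X \<omega>)))\<^sup>2) \<partial>M)"
      by simp
    also have "\<dots> \<le> 2 * (\<integral>\<^sup>+ \<omega>. ennreal ((norm (D (G N) \<omega>))\<^sup>2) \<partial>M) + 2 * (\<integral>\<^sup>+ \<omega>. ennreal ((norm (D (G N) \<omega> - X \<omega>))\<^sup>2) \<partial>M)"
      by (rule nn_integral_square_diff) auto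
    also have "\<dots> < \<infinity>" using fin D_square_finite[OF G, of N] by (simp add: ennreal_mult_less_top)
    finally show "(\<integral>\<^sup>+ \<omega>. ennreal ((norm (X \<omega>))\<^sup>2) \<partial>M) < \<infinity>" .
  qed
qed

text \<open>Justifies the choice operator in \<open>D_bar\<close>: for \<open>F\<close> in
  \<open>D_inf\<close> the derivatives of an approximating sequence converge in L^2, so a value as
  required exists.\<close>

lemma D_bar_limit:
  assumes F: "F \<in> D_inf M S D L"
  obtains G where "D_bar M S D F \<in> borel_measurable M" "(\<integral>\<^sup>+ \<omega>. ennreal ((norm (D_bar M S D F \<omega>))\<^sup>2) \<partial>M) < \<infinity>"
    "\<And>n. G n \<in> S" "(\<lambda>n. \<integral>\<^sup>+ \<omega>. ennreal ((norm (G n \<omega> - F \<omega>))\<^sup>2) \<partial>M) \<longlonglongrightarrow> 0"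
    "(\<lambda>n. \<integral>\<^sup>+ \<omega>. ennreal ((norm (D (G n) \<omega> - D_bar M S D F \<omega>))\<^sup>2) \<partial>M) \<longlonglongrightarrow> 0"
proof -
  obtain G R where G: "\<And>n::nat. G n \<in> S" "(\<lambda>n. \<integral>\<^sup>+ \<omega>. ennreal ((G n \<omega> - F \<omega>)\<^sup>2) \<partial>M) \<longlonglongrightarrow> 0"
    "\<And>e. e > 0 \<Longrightarrow> \<exists>N0. \<forall>m\<ge>N0. \<forall>n\<ge>N0. (\<integral>\<^sup>+ \<omega>. ennreal ((norm (D (G m) \<omega> - D (G n) \<omega>))\<^sup>2) \<partial>M) < ennreal e"
    by (rule D_inf_approx_Cauchy[OF F order_refl]) blast
  obtain X where X: "X \<in> borel_measurable M" "(\<integral>\<^sup>+ \<omega>. ennreal ((norm (X \<omega>))\<^sup>2) \<partial>M) < \<infinity>"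
    "(\<lambda>n. \<integral>\<^sup>+ \<omega>. ennreal ((norm (D (G n) \<omega> - X \<omega>))\<^sup>2) \<partial>M) \<longlonglongrightarrow> 0"
    using D_complete[OF G(1,3)] by blast
  have "\<exists>X. in_Lp M 2 X \<and> (\<exists>G. (\<forall>n. G n \<in> S) \<and>
     (\<lambda>n. Lp_norm M 2 (\<lambda>\<omega>. G n \<omega> - F \<omega>)) \<longlonglongrightarrow> 0 \<and>
     (\<lambda>n. Lp_norm M 2 (\<lambda>\<omega>. norm (D (G n) \<omega> - X \<omega>))) \<longlonglongrightarrow> 0)"
    using G X by (intro exI[of _ X] conjI exI[of _ G]) (auto simp: in_Lp_def Lp_norm_two_finite_iff Lp_norm_two_tendsto_iff)
  from someI_ex[OF this, folded D_bar_def] obtain G' where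
    G': "in_Lp M 2 (D_bar M S D F)" "\<And>n. G' n \<in> S" "(\<lambda>n. Lp_norm M 2 (\<lambda>\<omega>. G' n \<omega> - F \<omega>)) \<longlonglongrightarrow> 0"
      "(\<lambda>n. Lp_norm M 2 (\<lambda>\<omega>. norm (D (G' n) \<omega> - D_bar M S D F \<omega>))) \<longlonglongrightarrow> 0"
    by blast
  show thesis
  proof (rule that[of G'])
    show "D_bar M S D F \<in> borel_measurable M" "(\<integral>\<^sup>+ \<omega>. ennreal ((norm (D_bar M S D F \<omega>))\<^sup>2) \<partial>M) < \<infinity>"
      using G'(1) by (simp_all add: in_Lp_def Lp_norm_two_finite_iff)
    show "G' n \<in> S" for n by (rule G'(2))
    show "(\<lambda>n. \<integral>\<^sup>+ \<omega>. ennreal ((norm (G' n \<omega> - F \<omega>))\<^sup>2) \<partial>M) \<longlonglongrightarrow> 0"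
      "(\<lambda>n. \<integral>\<^sup>+ \<omega>. ennreal ((norm (D (G' n) \<omega> - D_bar M S D F \<omega>))\<^sup>2) \<partial>M) \<longlonglongrightarrow> 0"
      using G'(3,4) by (simp_all add: Lp_norm_two_tendsto_iff)
  qed
qed

lemma D_bar_borel [measurable]: "F \<in> D_inf M S D L \<Longrightarrow> D_bar M S D F \<in> borel_measurable M"
  using D_bar_limit by blast

text \<open>The sequence bounded in the norms of order \<open>K\<close> need not be the one that
  witnesses \<open>D_bar\<close>. Their difference tends to 0 while its derivatives converge, so
  closability identifies the two limits.\<close>

lemma D_inf_approx:
  assumes F: "F \<in> D_inf M S D L" and K: "K \<ge> 1"
  shows "\<exists>G R. (\<forall>n::nat. G n \<in> S) \<and>
    (\<forall>n N. expectation (\<lambda>\<omega>. sq (onb N) K (G n) \<omega> ^ K) \<le> R \<and> expectation (\<lambda>\<omega>. sq (onb N) K (L (G n)) \<omega> ^ K) \<le> R) \<and>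
    (\<lambda>n. \<integral>\<^sup>+ \<omega>. ennreal ((norm (G n \<omega> - F \<omega>))\<^sup>2) \<partial>M) \<longlonglongrightarrow> 0 \<and>
    (\<lambda>n. \<integral>\<^sup>+ \<omega>. ennreal ((norm (D (G n) \<omega> - D_bar M S D F \<omega>))\<^sup>2) \<partial>M) \<longlonglongrightarrow> 0"
proof -
  have Fm[measurable]: "F \<in> borel_measurable M" by (rule D_inf_borel[OF F])
  obtain G R where G: "\<And>n::nat. G n \<in> S"
    "\<And>n N. expectation (\<lambda>\<omega>. sq (onb N) K (G n) \<omega> ^ K) \<le> R"
    "\<And>n N. expectation (\<lambda>\<omega>. sq (onb N) K (L (G n)) \<omega> ^ K) \<le> R"
    "(\<lambda>n. \<integral>\<^sup>+ \<omega>. ennreal ((G n \<omega> - F \<omega>)\<^sup>2) \<partial>M) \<longlonglongrightarrow> 0"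
    "\<And>e. e > 0 \<Longrightarrow> \<exists>N0. \<forall>m\<ge>N0. \<forall>n\<ge>N0. (\<integral>\<^sup>+ \<omega>. ennreal ((norm (D (G m) \<omega> - D (G n) \<omega>))\<^sup>2) \<partial>M) < ennreal e"
    by (rule D_inf_approx_Cauchy[OF F K]) blast
  obtain X where X: "X \<in> borel_measurable M" "(\<integral>\<^sup>+ \<omega>. ennreal ((norm (X \<omega>))\<^sup>2) \<partial>M) < \<infinity>"
    "(\<lambda>n. \<integral>\<^sup>+ \<omega>. ennreal ((norm (D (G n) \<omega> - X \<omega>))\<^sup>2) \<partial>M) \<longlonglongrightarrow> 0"
    using D_complete[OF G(1,5)] by blast
  obtain G' where Y: "D_bar M S D F \<in> borel_measurable M" "(\<integral>\<^sup>+ \<omega>. ennreal ((norm (D_bar M S D F \<omega>))\<^sup>2) \<partial>M) < \<infinity>"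
    and G': "\<And>n. G' n \<in> S" "(\<lambda>n. \<integral>\<^sup>+ \<omega>. ennreal ((norm (G' n \<omega> - F \<omega>))\<^sup>2) \<partial>M) \<longlonglongrightarrow> 0"
    "(\<lambda>n. \<integral>\<^sup>+ \<omega>. ennreal ((norm (D (G' n) \<omega> - D_bar M S D F \<omega>))\<^sup>2) \<partial>M) \<longlonglongrightarrow> 0"
    by (rule D_bar_limit[OF F]) blast
  note [measurable] = S_borel[OF G(1)] S_borel[OF G'(1)] D_borel[OF G(1)] D_borel[OF G'(1)] X(1) Y(1)
  have "AE \<omega> in M. X \<omega> - D_bar M S D F \<omega> = 0"
  proof (rule D_closable[where G = "\<lambda>n \<omega>. G n \<omega> - G' n \<omega>"])
    show "(\<lambda>\<omega>. G n \<omega> - G' n \<omega>) \<in> S" for n by (intro S_diff G G')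
    have "(\<integral>\<^sup>+ \<omega>. ennreal ((norm (X \<omega> - D_bar M S D F \<omega>))\<^sup>2) \<partial>M)
      \<le> 2 * (\<integral>\<^sup>+ \<omega>. ennreal ((norm (X \<omega>))\<^sup>2) \<partial>M) + 2 * (\<integral>\<^sup>+ \<omega>. ennreal ((norm (D_bar M S D F \<omega>))\<^sup>2) \<partial>M)"
      by (rule nn_integral_square_diff[OF X(1) Y(1)])
    also have "\<dots> < \<infinity>" using X(2) Y(2) by (simp add: ennreal_mult_less_top)
    finally show "(\<integral>\<^sup>+ \<omega>. ennreal ((norm (X \<omega> - D_bar M S D F \<omega>))\<^sup>2) \<partial>M) < \<infinity>" .
    have "(\<lambda>n. \<integral>\<^sup>+ \<omega>. ennreal ((norm ((G n \<omega> - F \<omega>) - (G' n \<omega> - F \<omega>)))\<^sup>2) \<partial>M) \<longlonglongrightarrow> 0"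
      by (rule nn_integral_square_diff_tendsto) (use G(4) G'(2) in auto)
    then show "(\<lambda>n. \<integral>\<^sup>+ \<omega>. ennreal ((norm (G n \<omega> - G' n \<omega>))\<^sup>2) \<partial>M) \<longlonglongrightarrow> 0" by simp
    have "(\<integral>\<^sup>+ \<omega>. ennreal ((norm (D (\<lambda>\<omega>. G n \<omega> - G' n \<omega>) \<omega> - (X \<omega> - D_bar M S D F \<omega>)))\<^sup>2) \<partial>M)
       = (\<integral>\<^sup>+ \<omega>. ennreal ((norm ((D (G n) \<omega> - X \<omega>) - (D (G' n) \<omega> - D_bar M S D F \<omega>)))\<^sup>2) \<partial>M)" for n
    proof (rule nn_integral_cong_AE)
      have "a - b - (c - d) = (a - c) - (b - d)" for a b c d :: 'h by simp
      then show "AE \<omega> in M. ennreal ((norm (D (\<lambda>\<omega>. G n \<omega> - G' n \<omega>) \<omega> - (X \<omega> - D_bar M S D F \<omega>)))\<^sup>2)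
        = ennreal ((norm ((D (G n) \<omega> - X \<omega>) - (D (G' n) \<omega> - D_bar M S D F \<omega>)))\<^sup>2)"
        using D_diff[OF G(1) G'(1), of n n] by (auto elim!: eventually_mono simp only:)
    qed
    moreover have "(\<lambda>n. \<integral>\<^sup>+ \<omega>. ennreal ((norm ((D (G n) \<omega> - X \<omega>) - (D (G' n) \<omega> - D_bar M S D F \<omega>)))\<^sup>2) \<partial>M) \<longlonglongrightarrow> 0"
      by (rule nn_integral_square_diff_tendsto) (use X(3) G'(3) in auto)
    ultimately show "(\<lambda>n. \<integral>\<^sup>+ \<omega>. ennreal ((norm (D (\<lambda>\<omega>. G n \<omega> - G' n \<omega>) \<omega> - (X \<omega> - D_bar M S D F \<omega>)))\<^sup>2) \<partial>M) \<longlonglongrightarrow> 0"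
      by simp
  qed simp
  then have "(\<integral>\<^sup>+ \<omega>. ennreal ((norm (D (G n) \<omega> - D_bar M S D F \<omega>))\<^sup>2) \<partial>M) = (\<integral>\<^sup>+ \<omega>. ennreal ((norm (D (G n) \<omega> - X \<omega>))\<^sup>2) \<partial>M)" for n
    by (intro nn_integral_cong_AE) (auto elim!: eventually_mono)
  then have "(\<lambda>n. \<integral>\<^sup>+ \<omega>. ennreal ((norm (D (G n) \<omega> - D_bar M S D F \<omega>))\<^sup>2) \<partial>M) \<longlonglongrightarrow> 0" using X(3) by simp
  with G show ?thesis by (intro exI[of _ G] exI[of _ R]) auto
qed

end

section \<open>Super kernels\<close>

lemma abs_prod_power_le:
  fixes y :: "real ^ 'd::finite"
  shows "\<bar>\<Prod>i\<in>UNIV. (y $ i) ^ a i\<bar> \<le> norm y ^ (\<Sum>i\<in>UNIV. a i)"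
  unfolding abs_prod power_sum by (intro prod_mono) (auto simp: power_abs intro!: power_mono component_le_norm_cart)

context
  fixes \<phi> :: "real ^ 'd::finite \<Rightarrow> real"
  assumes \<phi>: "super_kernel \<phi>"
begin

lemma super_kernel_borel [measurable]: "\<phi> \<in> borel_measurable borel"
proof -
  have "continuous_on UNIV (pderivs vec_shift [] \<phi>)"
    using \<phi> unfolding super_kernel_def schwartz_def Ck_on_def by (metis empty_iff empty_set le0 list.size(3) subsetI)
  then show ?thesis by (intro borel_measurable_continuous_onI) simp
qed

lemma super_kernel_moment: "integrable lborel (\<lambda>y. norm y ^ m * \<bar>\<phi> y\<bar>)"
  using \<phi> unfolding super_kernel_def by (metis pderivs.simps(1))

lemma super_kernel_dominated:
  assumes [measurable]: "g \<in> borel_measurable borel" and g: "\<And>y. \<bar>g y\<bar> \<le> c * norm y ^ m"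
  shows "integrable lborel (\<lambda>y. g y * \<phi> y)"
proof (rule Bochner_Integration.integrable_bound)
  show "integrable lborel (\<lambda>y. c * (norm y ^ m * \<bar>\<phi> y\<bar>))" by (intro integrable_mult_right super_kernel_moment)
  have "\<bar>g y\<bar> * \<bar>\<phi> y\<bar> \<le> \<bar>c * (norm y ^ m * \<bar>\<phi> y\<bar>)\<bar>" for y
    using mult_right_mono[OF g, of "\<bar>\<phi> y\<bar>" y] by (simp add: mult.assoc)
  then show "AE y in lborel. norm (g y * \<phi> y) \<le> norm (c * (norm y ^ m * \<bar>\<phi> y\<bar>))"
    by (simp add: abs_mult)
qed simp

lemma super_kernel_integrable: "integrable lborel \<phi>"
  using super_kernel_dominated[of "\<lambda>_. 1" 1 0] by simp

text \<open>One factor of the inner product at a time is expanded in coordinates and absorbed into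
  the monomial; what remains are vanishing moments of the kernel. The monomial is present to make
  the induction work.\<close>

lemma super_kernel_inner_moment:
  assumes "k + (\<Sum>i\<in>UNIV. a i) \<ge> 1"
  shows "(\<integral>y. (\<xi> \<bullet> y) ^ k * (\<Prod>i\<in>UNIV. (y $ i) ^ a i) * \<phi> y \<partial>lborel) = 0"
  using assms
proof (induction k arbitrary: a)
  case 0
  then show ?case using \<phi> unfolding super_kernel_def by simp
next
  case (Suc k)
  define e where "e = (\<lambda>i. a(i := Suc (a i)))"
  have e: "(\<Prod>j\<in>UNIV. (y $ j) ^ e i j) = y $ i * (\<Prod>j\<in>UNIV. (y $ j) ^ a j)" for i and y :: "real ^ 'd"
  proof -
    have "(\<Prod>j\<in>UNIV. (y $ j) ^ e i j) = (y $ i) ^ Suc (a i) * (\<Prod>j\<in>UNIV - {i}. (y $ j) ^ e i j)"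
      by (subst prod.remove[of UNIV i]) (auto simp: e_def)
    also have "(\<Prod>j\<in>UNIV - {i}. (y $ j) ^ e i j) = (\<Prod>j\<in>UNIV - {i}. (y $ j) ^ a j)"
      by (intro prod.cong) (auto simp: e_def)
    also have "(y $ i) ^ Suc (a i) * \<dots> = y $ i * ((y $ i) ^ a i * (\<Prod>j\<in>UNIV - {i}. (y $ j) ^ a j))" by simp
    also have "(y $ i) ^ a i * (\<Prod>j\<in>UNIV - {i}. (y $ j) ^ a j) = (\<Prod>j\<in>UNIV. (y $ j) ^ a j)"
      by (subst prod.remove[of UNIV i]) auto
    finally show ?thesis .
  qed
  have int: "integrable lborel (\<lambda>y. (\<xi> \<bullet> y) ^ k * (\<Prod>j\<in>UNIV. (y $ j) ^ e i j) * \<phi> y)" for i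
  proof (rule super_kernel_dominated)
    fix y :: "real ^ 'd"
    have "\<bar>(\<xi> \<bullet> y) ^ k * (\<Prod>j\<in>UNIV. (y $ j) ^ e i j)\<bar> \<le> (norm \<xi> * norm y) ^ k * norm y ^ (\<Sum>j\<in>UNIV. e i j)"
      unfolding abs_mult power_abs by (intro mult_mono power_mono Cauchy_Schwarz_ineq2 abs_prod_power_le) auto
    then show "\<bar>(\<xi> \<bullet> y) ^ k * (\<Prod>j\<in>UNIV. (y $ j) ^ e i j)\<bar> \<le> norm \<xi> ^ k * norm y ^ (k + (\<Sum>j\<in>UNIV. e i j))"
      by (simp add: power_mult_distrib power_add mult.assoc)
  qed simp
  have "(\<integral>y. (\<xi> \<bullet> y) ^ Suc k * (\<Prod>i\<in>UNIV. (y $ i) ^ a i) * \<phi> y \<partial>lborel) =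
    (\<integral>y. (\<Sum>i\<in>UNIV. \<xi> $ i * ((\<xi> \<bullet> y) ^ k * (\<Prod>j\<in>UNIV. (y $ j) ^ e i j) * \<phi> y)) \<partial>lborel)"
    unfolding e power_Suc
    by (intro Bochner_Integration.integral_cong refl)
      (subst (1) inner_vec_def, simp add: sum_distrib_left sum_distrib_right ac_simps)
  also have "\<dots> = (\<Sum>i\<in>UNIV. \<xi> $ i * (\<integral>y. (\<xi> \<bullet> y) ^ k * (\<Prod>j\<in>UNIV. (y $ j) ^ e i j) * \<phi> y \<partial>lborel))"
    using int by simp
  also have "\<dots> = 0"
  proof (intro sum.neutral ballI)
    fix i
    have "1 \<le> e i i" by (simp add: e_def)
    also have "e i i \<le> (\<Sum>j\<in>UNIV. e i j)" by (intro member_le_sum) auto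
    finally show "\<xi> $ i * (\<integral>y. (\<xi> \<bullet> y) ^ k * (\<Prod>j\<in>UNIV. (y $ j) ^ e i j) * \<phi> y \<partial>lborel) = 0"
      using Suc.IH[of "e i"] by simp
  qed
  finally show ?case .
qed

lemma super_kernel_inner_power:
  "integrable lborel (\<lambda>y. (\<xi> \<bullet> y) ^ k * \<phi> y)"
  "(\<integral>y. (\<xi> \<bullet> y) ^ k * \<phi> y \<partial>lborel) = (if k = 0 then 1 else 0)"
proof -
  show "integrable lborel (\<lambda>y. (\<xi> \<bullet> y) ^ k * \<phi> y)"
  proof (rule super_kernel_dominated)
    fix y :: "real ^ 'd"
    show "\<bar>(\<xi> \<bullet> y) ^ k\<bar> \<le> norm \<xi> ^ k * norm y ^ k"
      unfolding power_abs power_mult_distrib[symmetric] by (intro power_mono Cauchy_Schwarz_ineq2) auto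
  qed simp
  show "(\<integral>y. (\<xi> \<bullet> y) ^ k * \<phi> y \<partial>lborel) = (if k = 0 then 1 else 0)"
    using super_kernel_inner_moment[of k "\<lambda>_. 0" \<xi>] \<phi> by (simp add: super_kernel_def)
qed

lemma regularise_eq:
  assumes [measurable]: "f \<in> borel_measurable borel" and \<delta>: "\<delta> > 0"
  shows "regularise \<phi> \<delta> f x = (\<integral>z. f (x - \<delta> *\<^sub>R z) * \<phi> z \<partial>lborel)"
proof -
  have "regularise \<phi> \<delta> f x = (\<integral>y. f (x - y) * scaled \<phi> \<delta> y \<partial>(density (distr lborel borel (\<lambda>z. 0 + \<delta> *\<^sub>R z)) (\<lambda>_. \<bar>\<delta>\<bar> ^ DIM(real ^ 'd))))"
    unfolding regularise_def using lborel_affine[of \<delta> "0 :: real ^ 'd"] \<delta> by simp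
  also have "\<dots> = (\<integral>z. \<bar>\<delta>\<bar> ^ DIM(real ^ 'd) * (f (x - \<delta> *\<^sub>R z) * scaled \<phi> \<delta> (\<delta> *\<^sub>R z)) \<partial>lborel)"
    by (subst integral_density) (auto simp: integral_distr scaled_def)
  also have "\<dots> = (\<integral>z. f (x - \<delta> *\<^sub>R z) * \<phi> z \<partial>lborel)"
    using \<delta> by (intro Bochner_Integration.integral_cong) (auto simp: scaled_def)
  finally show ?thesis .
qed

end

section \<open>Trigonometric polynomials are dense\<close>

text \<open>The formula 2 cos a cos b = cos (a - b) + cos (a + b), applied entry by entry. Sums and
  products being available, polynomials in sines are trigonometric polynomials.\<close>

lemma trig_mult_ex: "\<exists>l''. \<forall>x. trig_fun l'' x = trig_fun l x * trig_fun l' x"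
proof (induction l)
  case Nil show ?case by (auto intro: exI[of _ "[]"])
next
  case (Cons t l)
  obtain c \<xi> \<theta> where t: "t = (c, \<xi>, \<theta>)" by (cases t)
  have "\<exists>k. \<forall>x. trig_fun k x = c * cos (\<xi> \<bullet> x + \<theta>) * trig_fun l' x"
  proof (induction l')
    case Nil show ?case by (auto intro: exI[of _ "[]"])
  next
    case (Cons t' l')
    then obtain k where k: "\<And>x. trig_fun k x = c * cos (\<xi> \<bullet> x + \<theta>) * trig_fun l' x" by auto
    obtain c' \<xi>' \<theta>' where t': "t' = (c', \<xi>', \<theta>')" by (cases t')
    have "trig_fun ((c * c' / 2, \<xi> - \<xi>', \<theta> - \<theta>') # (c * c' / 2, \<xi> + \<xi>', \<theta> + \<theta>') # k) x
      = c * cos (\<xi> \<bullet> x + \<theta>) * trig_fun (t' # l') x" for x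
    proof -
      have 1: "(\<xi> - \<xi>') \<bullet> x + (\<theta> - \<theta>') = (\<xi> \<bullet> x + \<theta>) - (\<xi>' \<bullet> x + \<theta>')"
        "(\<xi> + \<xi>') \<bullet> x + (\<theta> + \<theta>') = (\<xi> \<bullet> x + \<theta>) + (\<xi>' \<bullet> x + \<theta>')" by (simp_all add: inner_simps)
      show ?thesis unfolding trig_fun_Cons t' 1 k cos_diff cos_add by (simp add: algebra_simps)
    qed
    then show ?case by blast
  qed
  then obtain k where "\<And>x. trig_fun k x = c * cos (\<xi> \<bullet> x + \<theta>) * trig_fun l' x" by auto
  moreover obtain k' where "\<And>x. trig_fun k' x = trig_fun l x * trig_fun l' x" using Cons by auto
  ultimately have "\<forall>x. trig_fun (k @ k') x = trig_fun (t # l) x * trig_fun l' x"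
    by (simp add: t algebra_simps)
  then show ?case by blast
qed

lemma trig_sum_ex:
  assumes "finite A" "\<And>a. a \<in> A \<Longrightarrow> \<exists>l. \<forall>x. trig_fun l x = g a x"
  shows "\<exists>l. \<forall>x. trig_fun l x = (\<Sum>a\<in>A. g a x)"
  using assms
proof (induction A rule: finite_induct)
  case empty show ?case by (auto intro: exI[of _ "[]"])
next
  case (insert a A)
  then obtain l l' where "\<And>x. trig_fun l x = g a x" "\<And>x. trig_fun l' x = (\<Sum>a\<in>A. g a x)" by (metis insertCI)
  then show ?case using insert.hyps by (intro exI[of _ "l @ l'"]) simp
qed

lemma trig_polynomial_sin:
  fixes p :: "real ^ 'd::finite \<Rightarrow> real"
  assumes "real_polynomial_function p"
  shows "\<exists>l. \<forall>x. trig_fun l x = p (\<chi> i. sin (x $ i / r))"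
  using assms
proof (induction p rule: real_polynomial_function.induct)
  case (linear h)
  have h: "h s = (\<Sum>i\<in>UNIV. s $ i * h (axis i 1))" for s
  proof -
    have "h s = h (\<Sum>i\<in>UNIV. s $ i *\<^sub>R axis i 1)" using basis_expansion[of s] by (simp add: scalar_mult_eq_scaleR)
    then show ?thesis using linear by (simp add: bounded_linear.linear linear_sum linear_scale)
  qed
  have "\<exists>l. \<forall>x. trig_fun l x = sin (x $ i / r) * h (axis i 1)" for i
  proof -
    \<comment> \<open>A sine is a cosine with phase - pi / 2.\<close>
    have "trig_fun [(h (axis i 1), axis i (1 / r), - (pi / 2))] x = sin (x $ i / r) * h (axis i 1)" for x :: "real ^ 'd"
    proof -
      have "axis i (1 / r) \<bullet> x = x $ i / r" by (simp add: inner_axis')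
      then show ?thesis using cos_add[of "x $ i / r" "- (pi / 2)"] by (simp add: mult.commute)
    qed
    then show ?thesis by blast
  qed
  from trig_sum_ex[of UNIV "\<lambda>i x. sin (x $ i / r) * h (axis i 1)", OF finite this] obtain l where
    l: "\<And>x. trig_fun l x = (\<Sum>i\<in>UNIV. sin (x $ i / r) * h (axis i 1))" by blast
  show ?case
  proof (intro exI allI)
    fix x
    show "trig_fun l x = h (\<chi> i. sin (x $ i / r))"
      unfolding l by (subst h) simp
  qed
next
  case (const c)
  have "trig_fun [(c, 0, 0)] x = c" for x :: "real ^ 'd" by simp
  then show ?case by blast
next
  case (add f g)
  then obtain l l' where "\<And>x. trig_fun l x = f (\<chi> i. sin (x $ i / r))" "\<And>x. trig_fun l' x = g (\<chi> i. sin (x $ i / r))"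
    by auto
  then show ?case by (intro exI[of _ "l @ l'"]) simp
next
  case (mult f g)
  then obtain l l' where "\<And>x. trig_fun l x = f (\<chi> i. sin (x $ i / r))" "\<And>x. trig_fun l' x = g (\<chi> i. sin (x $ i / r))"
    by auto
  then show ?case using trig_mult_ex[of l l'] by simp
qed

text \<open>
  The substitution \<open>x\<^sub>i = n arcsin s\<^sub>i\<close> turns \<open>f\<close> on a large cube into a continuous function of \<open>s\<close> on
  the unit cube, which is approximated by polynomials; in \<open>x\<close> these are trigonometric polynomials, and
  they keep the bound on \<open>f\<close> everywhere.
\<close>

lemma trig_approx:
  fixes f :: "real ^ 'd::finite \<Rightarrow> real"
  assumes f: "continuous_on UNIV f" and B: "\<And>x. \<bar>f x\<bar> \<le> B"
  obtains l where "\<And>n x. \<bar>trig_fun (l n) x\<bar> \<le> B + 1 / real (Suc n)" "\<And>x. (\<lambda>n. trig_fun (l n) x) \<longlonglongrightarrow> f x"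
proof -
  have "\<exists>l. (\<forall>x. \<bar>trig_fun l x\<bar> \<le> B + 1 / real (Suc n)) \<and>
     (\<forall>x. norm x \<le> real (Suc n) \<longrightarrow> \<bar>trig_fun l x - f x\<bar> \<le> 1 / real (Suc n))" for n
  proof -
    define r where "r = real (Suc n)"
    have r: "r > 0" by (simp add: r_def)
    let ?C = "cbox (- 1) 1 :: (real ^ 'd) set"
    let ?g = "\<lambda>s :: real ^ 'd. f (\<chi> i. r * arcsin (s $ i))"
    have C: "s \<in> ?C \<longleftrightarrow> (\<forall>i. -1 \<le> s $ i \<and> s $ i \<le> 1)" for s by (simp add: mem_box_cart)
    have arc: "continuous_on ?C (\<lambda>s. arcsin (s $ i))" for i
      by (rule continuous_on_arcsin) (auto simp: C intro!: continuous_intros)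
    have "continuous_on ?C ?g"
      by (rule continuous_on_compose2[OF f]) (auto intro!: continuous_intros arc)
    then obtain p where p: "real_polynomial_function p" "\<And>s. s \<in> ?C \<Longrightarrow> \<bar>?g s - p s\<bar> < 1 / r"
      using Stone_Weierstrass_real_polynomial_function[of ?C ?g "1 / r"] r by auto
    obtain l where l: "\<And>x. trig_fun l x = p (\<chi> i. sin (x $ i / r))" using trig_polynomial_sin[OF p(1)] by blast
    have sC: "(\<chi> i. sin (x $ i / r)) \<in> ?C" for x :: "real ^ 'd" by (simp add: C)
    have "\<bar>trig_fun l x\<bar> \<le> B + 1 / r" for x
      using p(2)[OF sC, of x] B[of "\<chi> i. r * arcsin (sin (x $ i / r))"] by (simp add: l)
    moreover have "\<bar>trig_fun l x - f x\<bar> \<le> 1 / r" if x: "norm x \<le> r" for x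
    proof -
      \<comment> \<open>In the ball of radius \<open>r\<close> the rescaled coordinates are at most
        1 in absolute value, hence within the range up to pi / 2 on which arcsin inverts
        sin.\<close>
      have "arcsin (sin (x $ i / r)) = x $ i / r" for i
      proof (rule arcsin_sin)
        have "\<bar>x $ i\<bar> \<le> r" using component_le_norm_cart[of x i] x by simp
        then have "\<bar>x $ i / r\<bar> \<le> 1" using r by (simp add: abs_divide)
        then show "- (pi / 2) \<le> x $ i / r" "x $ i / r \<le> pi / 2" using pi_ge_two by linarith+
      qed
      then have "(\<chi> i. r * arcsin (sin (x $ i / r))) = x" using r by (simp add: vec_eq_iff)
      then show ?thesis using p(2)[OF sC, of x] by (simp add: l abs_minus_commute)
    qed
    ultimately show ?thesis unfolding r_def by blast
  qed
  then obtain l where l: "\<And>n x. \<bar>trig_fun (l n) x\<bar> \<le> B + 1 / real (Suc n)"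
    "\<And>n x. norm x \<le> real (Suc n) \<Longrightarrow> \<bar>trig_fun (l n) x - f x\<bar> \<le> 1 / real (Suc n)" by metis
  show thesis
  proof (rule that[OF l(1)])
    fix x :: "real ^ 'd"
    have "eventually (\<lambda>n. norm x \<le> real (Suc n)) sequentially"
      by (rule eventually_sequentiallyI[of "nat \<lceil>norm x\<rceil>"]) linarith
    then have "eventually (\<lambda>n. norm (trig_fun (l n) x - f x) \<le> 1 / real (Suc n)) sequentially"
      by eventually_elim (use l(2) in auto)
    moreover have "(\<lambda>n. 1 / real (Suc n)) \<longlonglongrightarrow> 0" using LIMSEQ_inverse_real_of_nat by (simp add: inverse_eq_divide)
    ultimately have "(\<lambda>n. trig_fun (l n) x - f x) \<longlonglongrightarrow> 0" by (rule Lim_null_comparison)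
    then show "(\<lambda>n. trig_fun (l n) x) \<longlonglongrightarrow> f x" by (simp add: LIM_zero_iff)
  qed
qed

section \<open>Regularisation error from the estimate on derivatives\<close>

text \<open>A translation changes phases only and preserves supremum bounds. The remainder in
  Taylor's formula, taken at an intermediate point, is thus covered by the estimate at the
  untranslated variable.\<close>

definition trig_shift :: "real ^ 'd \<Rightarrow> 'd::finite trig \<Rightarrow> 'd trig" where
  "trig_shift w l = map (\<lambda>(c, \<xi>, \<theta>). (c, \<xi>, \<theta> + \<xi> \<bullet> w)) l"

lemma trig_fun_shift: "trig_fun (trig_shift w l) x = trig_fun l (x + w)"
  by (induction l) (auto simp: trig_shift_def inner_simps algebra_simps)

lemma trig_deriv_shift: "trig_deriv v (trig_shift w l) = trig_shift w (trig_deriv v l)"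
  by (induction l) (auto simp: trig_shift_def)

lemma trig_deriv_power_shift: "(trig_deriv v ^^ k) (trig_shift w l) = trig_shift w ((trig_deriv v ^^ k) l)"
  by (induction k) (auto simp: trig_deriv_shift)

lemma trig_deriv_power_Nil: "(trig_deriv v ^^ k) [] = []"
  by (induction k) auto

lemma trig_deriv_power_Cons:
  "(trig_deriv v ^^ k) ((c, \<xi>, \<theta>) # l) = (c * (\<xi> \<bullet> v) ^ k, \<xi>, \<theta> + real k * (pi / 2)) # (trig_deriv v ^^ k) l"
  by (induction k) (auto simp: algebra_simps)

section \<open>Taylor expansion of translated weighted expectations\<close>

context prob_space
begin

context
  fixes Y :: "'a \<Rightarrow> real ^ 'd::finite" and Z :: "'a \<Rightarrow> real"
  assumes Y [measurable]: "Y \<in> borel_measurable M" and Z [measurable]: "Z \<in> borel_measurable M"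
    and Z1: "\<And>\<omega>. \<bar>Z \<omega>\<bar> \<le> 1"
begin

lemma integrable_mult_bounded:
  assumes [measurable]: "g \<in> borel_measurable borel" and "\<And>x. \<bar>g x\<bar> \<le> B"
  shows "integrable M (\<lambda>\<omega>. Z \<omega> * g (Y \<omega>))"
proof (rule integrable_const_bound[where B = B])
  have "\<bar>Z \<omega>\<bar> * \<bar>g (Y \<omega>)\<bar> \<le> 1 * B" for \<omega> by (intro mult_mono Z1 assms) auto
  then show "AE \<omega> in M. norm (Z \<omega> * g (Y \<omega>)) \<le> B" by (simp add: abs_mult)
qed simp

lemma integrable_cos_sin:
  "integrable M (\<lambda>\<omega>. Z \<omega> * cos (\<xi> \<bullet> Y \<omega> + \<theta>))" "integrable M (\<lambda>\<omega>. Z \<omega> * sin (\<xi> \<bullet> Y \<omega> + \<theta>))"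
  using integrable_mult_bounded[of "\<lambda>x. cos (\<xi> \<bullet> x + \<theta>)" 1] integrable_mult_bounded[of "\<lambda>x. sin (\<xi> \<bullet> x + \<theta>)" 1]
  by auto

text \<open>As a function of the translation \<open>v\<close> this is a trigonometric polynomial
  whose coefficients are expectations of \<open>Z\<close> times a cosine or sine of
  \<open>Y\<close>. Differentiation and integration in \<open>v\<close> are therefore done term by
  term.\<close>

definition trig_exp :: "'d trig \<Rightarrow> real ^ 'd \<Rightarrow> real" where
  "trig_exp l v = expectation (\<lambda>\<omega>. Z \<omega> * trig_fun l (Y \<omega> + v))"

lemma trig_exp_Nil [simp]: "trig_exp [] v = 0"
  by (simp add: trig_exp_def)

lemma cos_inner_add: "cos (\<xi> \<bullet> (x + v) + \<theta>) = cos (\<xi> \<bullet> v) * cos (\<xi> \<bullet> x + \<theta>) - sin (\<xi> \<bullet> v) * sin (\<xi> \<bullet> x + \<theta>)"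
  for \<xi> :: "real ^ 'd"
  using cos_add[of "\<xi> \<bullet> v" "\<xi> \<bullet> x + \<theta>"] by (simp add: inner_add_right add.commute add.left_commute)

lemma trig_integrable: "integrable M (\<lambda>\<omega>. Z \<omega> * trig_fun l (Y \<omega> + v))"
proof (induction l)
  case (Cons t l)
  obtain c \<xi> \<theta> where t: "t = (c, \<xi>, \<theta>)" by (cases t)
  have "integrable M (\<lambda>\<omega>. c * (cos (\<xi> \<bullet> v) * (Z \<omega> * cos (\<xi> \<bullet> Y \<omega> + \<theta>)) - sin (\<xi> \<bullet> v) * (Z \<omega> * sin (\<xi> \<bullet> Y \<omega> + \<theta>)))
     + Z \<omega> * trig_fun l (Y \<omega> + v))"
    by (intro Bochner_Integration.integrable_add integrable_mult_right Bochner_Integration.integrable_diff integrable_cos_sin Cons)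
  then show ?case unfolding t trig_fun_Cons cos_inner_add by (simp add: algebra_simps)
qed simp

lemma trig_exp_Cons:
  "trig_exp ((c, \<xi>, \<theta>) # l) v =
    c * (cos (\<xi> \<bullet> v) * expectation (\<lambda>\<omega>. Z \<omega> * cos (\<xi> \<bullet> Y \<omega> + \<theta>))
       - sin (\<xi> \<bullet> v) * expectation (\<lambda>\<omega>. Z \<omega> * sin (\<xi> \<bullet> Y \<omega> + \<theta>))) + trig_exp l v"
proof -
  have "trig_exp ((c, \<xi>, \<theta>) # l) v =
    expectation (\<lambda>\<omega>. c * (cos (\<xi> \<bullet> v) * (Z \<omega> * cos (\<xi> \<bullet> Y \<omega> + \<theta>)) - sin (\<xi> \<bullet> v) * (Z \<omega> * sin (\<xi> \<bullet> Y \<omega> + \<theta>)))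
     + Z \<omega> * trig_fun l (Y \<omega> + v))"
    unfolding trig_exp_def trig_fun_Cons cos_inner_add
    by (intro Bochner_Integration.integral_cong) (simp_all add: algebra_simps)
  then show ?thesis using integrable_cos_sin trig_integrable by (simp add: trig_exp_def)
qed

lemma trig_exp_deriv:
  "((\<lambda>t. trig_exp l (t *\<^sub>R v)) has_real_derivative trig_exp (trig_deriv v l) (t *\<^sub>R v)) (at t)"
proof (induction l)
  case (Cons u l)
  obtain c \<xi> \<theta> where u: "u = (c, \<xi>, \<theta>)" by (cases u)
  let ?P = "expectation (\<lambda>\<omega>. Z \<omega> * cos (\<xi> \<bullet> Y \<omega> + \<theta>))" and ?R = "expectation (\<lambda>\<omega>. Z \<omega> * sin (\<xi> \<bullet> Y \<omega> + \<theta>))"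
  have "cos (\<xi> \<bullet> Y \<omega> + (\<theta> + pi / 2)) = - sin (\<xi> \<bullet> Y \<omega> + \<theta>)"
    "sin (\<xi> \<bullet> Y \<omega> + (\<theta> + pi / 2)) = cos (\<xi> \<bullet> Y \<omega> + \<theta>)" for \<omega>
    unfolding add.assoc[symmetric] by (simp_all add: cos_add[of _ "pi / 2"] sin_add[of _ "pi / 2"])
  then have PR: "expectation (\<lambda>\<omega>. Z \<omega> * cos (\<xi> \<bullet> Y \<omega> + (\<theta> + pi / 2))) = - ?R"
    "expectation (\<lambda>\<omega>. Z \<omega> * sin (\<xi> \<bullet> Y \<omega> + (\<theta> + pi / 2))) = ?P" by simp_all
  have "((\<lambda>t. c * (cos (t * (\<xi> \<bullet> v)) * ?P - sin (t * (\<xi> \<bullet> v)) * ?R) + trig_exp l (t *\<^sub>R v)) has_real_derivative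
     c * (\<xi> \<bullet> v) * (cos (t * (\<xi> \<bullet> v)) * (- ?R) - sin (t * (\<xi> \<bullet> v)) * ?P) + trig_exp (trig_deriv v l) (t *\<^sub>R v)) (at t)"
    by (auto intro!: derivative_eq_intros Cons simp: algebra_simps)
  then show ?case by (simp add: u trig_exp_Cons PR)
qed simp

lemma trig_exp_Taylor:
  assumes "q \<ge> 1"
  obtains t where "0 < t" "t < 1"
    "trig_exp l v = (\<Sum>k<q. trig_exp ((trig_deriv v ^^ k) l) 0 / fact k) + trig_exp ((trig_deriv v ^^ q) l) (t *\<^sub>R v) / fact q"
proof -
  have "\<exists>t>0. t < 1 \<and> trig_exp l (1 *\<^sub>R v) = (\<Sum>k<q. trig_exp ((trig_deriv v ^^ k) l) (0 *\<^sub>R v) / fact k * 1 ^ k)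
     + trig_exp ((trig_deriv v ^^ q) l) (t *\<^sub>R v) / fact q * 1 ^ q"
    by (rule Maclaurin[where diff = "\<lambda>k t. trig_exp ((trig_deriv v ^^ k) l) (t *\<^sub>R v)"])
      (use assms trig_exp_deriv in auto)
  then show ?thesis using that by auto
qed

context
  fixes q :: nat and c :: real
  assumes q: "q \<ge> 1" and c: "0 \<le> c"
    and est: "\<And>l y B. (\<And>x. \<bar>trig_fun l x\<bar> \<le> B) \<Longrightarrow>
      \<bar>expectation (\<lambda>\<omega>. trig_fun ((trig_deriv y ^^ q) l) (Y \<omega>) * Z \<omega>)\<bar> \<le> c * norm y ^ q * B"
begin

lemma trig_exp_estimate:
  assumes "\<And>x. \<bar>trig_fun l x\<bar> \<le> B"
  shows "\<bar>trig_exp ((trig_deriv v ^^ q) l) w\<bar> \<le> c * norm v ^ q * B"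
proof -
  have "trig_exp ((trig_deriv v ^^ q) l) w = expectation (\<lambda>\<omega>. trig_fun ((trig_deriv v ^^ q) (trig_shift w l)) (Y \<omega>) * Z \<omega>)"
    unfolding trig_exp_def trig_deriv_power_shift trig_fun_shift by (simp add: mult.commute)
  also have "\<bar>\<dots>\<bar> \<le> c * norm v ^ q * B" by (rule est) (simp add: trig_fun_shift assms)
  finally show ?thesis .
qed

context
  fixes \<phi> :: "real ^ 'd \<Rightarrow> real" and \<delta> :: real
  assumes \<phi>: "super_kernel \<phi>" and \<delta>: "\<delta> > 0"
begin

lemma kernel_cos_sin:
  "integrable lborel (\<lambda>z. cos (\<xi> \<bullet> (- \<delta> *\<^sub>R z)) * \<phi> z)" "integrable lborel (\<lambda>z. sin (\<xi> \<bullet> (- \<delta> *\<^sub>R z)) * \<phi> z)"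
  by (rule super_kernel_dominated[OF \<phi>, of _ 1 0]; simp)+

lemma kernel_trig_integrable: "integrable lborel (\<lambda>z. trig_fun l (x - \<delta> *\<^sub>R z) * \<phi> z)"
proof (induction l)
  case (Cons u l)
  obtain c \<xi> \<theta> where u: "u = (c, \<xi>, \<theta>)" by (cases u)
  have "integrable lborel (\<lambda>z. c * (cos (\<xi> \<bullet> x + \<theta>) * (cos (\<xi> \<bullet> (- \<delta> *\<^sub>R z)) * \<phi> z) - sin (\<xi> \<bullet> x + \<theta>) * (sin (\<xi> \<bullet> (- \<delta> *\<^sub>R z)) * \<phi> z))
     + trig_fun l (x - \<delta> *\<^sub>R z) * \<phi> z)"
    by (intro Bochner_Integration.integrable_add integrable_mult_right Bochner_Integration.integrable_diff kernel_cos_sin Cons)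
  moreover have "c * (cos (\<xi> \<bullet> x + \<theta>) * (cos (\<xi> \<bullet> (- \<delta> *\<^sub>R z)) * \<phi> z) - sin (\<xi> \<bullet> x + \<theta>) * (sin (\<xi> \<bullet> (- \<delta> *\<^sub>R z)) * \<phi> z))
     + trig_fun l (x - \<delta> *\<^sub>R z) * \<phi> z = trig_fun (u # l) (x - \<delta> *\<^sub>R z) * \<phi> z" for z
  proof -
    have "trig_fun (u # l) (x - \<delta> *\<^sub>R z) = c * cos (\<xi> \<bullet> (x + - \<delta> *\<^sub>R z) + \<theta>) + trig_fun l (x - \<delta> *\<^sub>R z)"
      by (simp add: u)
    then show ?thesis unfolding cos_inner_add by (simp add: algebra_simps)
  qed
  ultimately show ?case by (simp only:)
qed simp

text \<open>The interchange of integral and expectation is linearity here: each cosine of Y -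
  \<delta> z splits into products of a function of \<open>z\<close> and a function of the random
  point.\<close>

lemma kernel_trig_exp:
  "integrable lborel (\<lambda>z. trig_exp l (- \<delta> *\<^sub>R z) * \<phi> z)"
  "integrable M (\<lambda>\<omega>. Z \<omega> * (\<integral>z. trig_fun l (Y \<omega> - \<delta> *\<^sub>R z) * \<phi> z \<partial>lborel))"
  "(\<integral>z. trig_exp l (- \<delta> *\<^sub>R z) * \<phi> z \<partial>lborel) = expectation (\<lambda>\<omega>. Z \<omega> * (\<integral>z. trig_fun l (Y \<omega> - \<delta> *\<^sub>R z) * \<phi> z \<partial>lborel))"
proof (induction l)
  case (Cons u l)
  obtain c \<xi> \<theta> where u: "u = (c, \<xi>, \<theta>)" by (cases u)
  let ?P = "expectation (\<lambda>\<omega>. Z \<omega> * cos (\<xi> \<bullet> Y \<omega> + \<theta>))" and ?R = "expectation (\<lambda>\<omega>. Z \<omega> * sin (\<xi> \<bullet> Y \<omega> + \<theta>))"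
  let ?a = "\<integral>z. cos (\<xi> \<bullet> (- \<delta> *\<^sub>R z)) * \<phi> z \<partial>lborel" and ?b = "\<integral>z. sin (\<xi> \<bullet> (- \<delta> *\<^sub>R z)) * \<phi> z \<partial>lborel"
  have eq1: "trig_exp (u # l) (- \<delta> *\<^sub>R z) * \<phi> z =
    c * (?P * (cos (\<xi> \<bullet> (- \<delta> *\<^sub>R z)) * \<phi> z) - ?R * (sin (\<xi> \<bullet> (- \<delta> *\<^sub>R z)) * \<phi> z)) + trig_exp l (- \<delta> *\<^sub>R z) * \<phi> z" for z
    unfolding u trig_exp_Cons by (simp add: algebra_simps)
  show 1: "integrable lborel (\<lambda>z. trig_exp (u # l) (- \<delta> *\<^sub>R z) * \<phi> z)"
    unfolding eq1
    by (intro Bochner_Integration.integrable_add integrable_mult_right Bochner_Integration.integrable_diff kernel_cos_sin Cons)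
  have eq2: "(\<integral>z. trig_fun (u # l) (x - \<delta> *\<^sub>R z) * \<phi> z \<partial>lborel) =
    c * (cos (\<xi> \<bullet> x + \<theta>) * ?a - sin (\<xi> \<bullet> x + \<theta>) * ?b) + (\<integral>z. trig_fun l (x - \<delta> *\<^sub>R z) * \<phi> z \<partial>lborel)" for x
  proof -
    have "(\<integral>z. trig_fun (u # l) (x - \<delta> *\<^sub>R z) * \<phi> z \<partial>lborel) =
      (\<integral>z. c * (cos (\<xi> \<bullet> x + \<theta>) * (cos (\<xi> \<bullet> (- \<delta> *\<^sub>R z)) * \<phi> z) - sin (\<xi> \<bullet> x + \<theta>) * (sin (\<xi> \<bullet> (- \<delta> *\<^sub>R z)) * \<phi> z))
       + trig_fun l (x - \<delta> *\<^sub>R z) * \<phi> z \<partial>lborel)"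
    proof (rule Bochner_Integration.integral_cong)
      fix z
      have "trig_fun (u # l) (x - \<delta> *\<^sub>R z) = c * cos (\<xi> \<bullet> (x + - \<delta> *\<^sub>R z) + \<theta>) + trig_fun l (x - \<delta> *\<^sub>R z)"
        by (simp add: u)
      then show "trig_fun (u # l) (x - \<delta> *\<^sub>R z) * \<phi> z =
        c * (cos (\<xi> \<bullet> x + \<theta>) * (cos (\<xi> \<bullet> (- \<delta> *\<^sub>R z)) * \<phi> z) - sin (\<xi> \<bullet> x + \<theta>) * (sin (\<xi> \<bullet> (- \<delta> *\<^sub>R z)) * \<phi> z))
         + trig_fun l (x - \<delta> *\<^sub>R z) * \<phi> z"
        unfolding cos_inner_add by (simp add: algebra_simps)
    qed simp
    also have "\<dots> = c * (cos (\<xi> \<bullet> x + \<theta>) * ?a - sin (\<xi> \<bullet> x + \<theta>) * ?b) + (\<integral>z. trig_fun l (x - \<delta> *\<^sub>R z) * \<phi> z \<partial>lborel)"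
      using kernel_cos_sin kernel_trig_integrable by simp
    finally show ?thesis .
  qed
  have eq3: "Z \<omega> * (\<integral>z. trig_fun (u # l) (Y \<omega> - \<delta> *\<^sub>R z) * \<phi> z \<partial>lborel) =
    c * (?a * (Z \<omega> * cos (\<xi> \<bullet> Y \<omega> + \<theta>)) - ?b * (Z \<omega> * sin (\<xi> \<bullet> Y \<omega> + \<theta>)))
      + Z \<omega> * (\<integral>z. trig_fun l (Y \<omega> - \<delta> *\<^sub>R z) * \<phi> z \<partial>lborel)" for \<omega>
    unfolding eq2 by (simp add: algebra_simps)
  show 2: "integrable M (\<lambda>\<omega>. Z \<omega> * (\<integral>z. trig_fun (u # l) (Y \<omega> - \<delta> *\<^sub>R z) * \<phi> z \<partial>lborel))"
    unfolding eq3
    by (intro Bochner_Integration.integrable_add integrable_mult_right Bochner_Integration.integrable_diff integrable_cos_sin Cons)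
  have "(\<integral>z. trig_exp (u # l) (- \<delta> *\<^sub>R z) * \<phi> z \<partial>lborel) = c * (?P * ?a - ?R * ?b) + (\<integral>z. trig_exp l (- \<delta> *\<^sub>R z) * \<phi> z \<partial>lborel)"
    unfolding eq1 using kernel_cos_sin Cons(1) by simp
  also have "\<dots> = expectation (\<lambda>\<omega>. Z \<omega> * (\<integral>z. trig_fun (u # l) (Y \<omega> - \<delta> *\<^sub>R z) * \<phi> z \<partial>lborel))"
  proof -
    have "expectation (\<lambda>\<omega>. c * (?a * (Z \<omega> * cos (\<xi> \<bullet> Y \<omega> + \<theta>)) - ?b * (Z \<omega> * sin (\<xi> \<bullet> Y \<omega> + \<theta>)))
      + Z \<omega> * (\<integral>z. trig_fun l (Y \<omega> - \<delta> *\<^sub>R z) * \<phi> z \<partial>lborel)) =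
      c * (?a * ?P - ?b * ?R) + expectation (\<lambda>\<omega>. Z \<omega> * (\<integral>z. trig_fun l (Y \<omega> - \<delta> *\<^sub>R z) * \<phi> z \<partial>lborel))"
      using integrable_cos_sin Cons(2) by simp
    then show ?thesis unfolding eq3 Cons(3) by (simp only: mult.commute)
  qed
  finally show "(\<integral>z. trig_exp (u # l) (- \<delta> *\<^sub>R z) * \<phi> z \<partial>lborel) = expectation (\<lambda>\<omega>. Z \<omega> * (\<integral>z. trig_fun (u # l) (Y \<omega> - \<delta> *\<^sub>R z) * \<phi> z \<partial>lborel))" .
qed simp_all

text \<open>For one cosine the k-th Taylor term in the direction - \<delta> z is a constant times
  the k-th power of the inner product of the frequency with \<open>z\<close>; for
  \<open>k \<ge> 1\<close> its integral against the kernel vanishes.\<close>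

lemma kernel_trig_moment:
  "integrable lborel (\<lambda>z. trig_exp ((trig_deriv (- \<delta> *\<^sub>R z) ^^ k) l) 0 * \<phi> z)"
  "(\<integral>z. trig_exp ((trig_deriv (- \<delta> *\<^sub>R z) ^^ k) l) 0 * \<phi> z \<partial>lborel) = (if k = 0 then trig_exp l 0 else 0)"
proof (induction l)
  case Nil
  { case 1 show ?case by (simp add: trig_deriv_power_Nil) }
  { case 2 show ?case by (simp add: trig_deriv_power_Nil) }
next
  case (Cons u l)
  obtain c \<xi> \<theta> where u: "u = (c, \<xi>, \<theta>)" by (cases u)
  let ?P = "expectation (\<lambda>\<omega>. Z \<omega> * cos (\<xi> \<bullet> Y \<omega> + (\<theta> + real k * (pi / 2))))"
  have "(\<xi> \<bullet> (- \<delta> *\<^sub>R z)) ^ k = (- \<delta>) ^ k * (\<xi> \<bullet> z) ^ k" for z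
    by (metis inner_scaleR_right power_mult_distrib)
  then have eq: "trig_exp ((trig_deriv (- \<delta> *\<^sub>R z) ^^ k) (u # l)) 0 * \<phi> z =
      c * (- \<delta>) ^ k * ?P * ((\<xi> \<bullet> z) ^ k * \<phi> z) + trig_exp ((trig_deriv (- \<delta> *\<^sub>R z) ^^ k) l) 0 * \<phi> z" for z
    unfolding u trig_deriv_power_Cons trig_exp_Cons by (simp add: algebra_simps)
  { case 1 show ?case unfolding eq
      by (intro Bochner_Integration.integrable_add integrable_mult_right super_kernel_inner_power[OF \<phi>] Cons) }
  { case 2
    have "(\<integral>z. trig_exp ((trig_deriv (- \<delta> *\<^sub>R z) ^^ k) (u # l)) 0 * \<phi> z \<partial>lborel) =
      c * (- \<delta>) ^ k * ?P * (if k = 0 then 1 else 0) + (if k = 0 then trig_exp l 0 else 0)"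
      unfolding eq using super_kernel_inner_power[OF \<phi>, of \<xi> k] Cons by simp
    then show ?case by (simp add: u trig_exp_Cons) }
qed

text \<open>Integrated against the kernel, the Taylor polynomial reduces to its constant term, the
  unregularised expectation. The remainder is a q-th derivative in the direction - \<delta> z, which
  yields \<delta>^q times the absolute q-th moment of the kernel.\<close>

lemma trig_regularise_error:
  assumes B: "\<And>x. \<bar>trig_fun l x\<bar> \<le> B"
  shows "\<bar>expectation (\<lambda>\<omega>. Z \<omega> * trig_fun l (Y \<omega>)) - expectation (\<lambda>\<omega>. Z \<omega> * (\<integral>z. trig_fun l (Y \<omega> - \<delta> *\<^sub>R z) * \<phi> z \<partial>lborel))\<bar>
    \<le> c * \<delta> ^ q * (\<integral>z. norm z ^ q * \<bar>\<phi> z\<bar> \<partial>lborel) * B"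
proof -
  let ?r = "\<lambda>z. trig_exp l (- \<delta> *\<^sub>R z) - (\<Sum>k<q. trig_exp ((trig_deriv (- \<delta> *\<^sub>R z) ^^ k) l) 0 / fact k)"
  have B0: "0 \<le> B" using B abs_ge_zero order_trans by blast
  have int: "integrable lborel (\<lambda>z. trig_exp ((trig_deriv (- \<delta> *\<^sub>R z) ^^ k) l) 0 / fact k * \<phi> z)" for k
    using integrable_mult_right[OF kernel_trig_moment(1)[of k l], of "1 / fact k"] by (simp add: ac_simps)
  have val: "(\<integral>z. trig_exp ((trig_deriv (- \<delta> *\<^sub>R z) ^^ k) l) 0 / fact k * \<phi> z \<partial>lborel) = (if k = 0 then trig_exp l 0 else 0)" for k
  proof -
    have "(\<integral>z. trig_exp ((trig_deriv (- \<delta> *\<^sub>R z) ^^ k) l) 0 / fact k * \<phi> z \<partial>lborel)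
      = (\<integral>z. (1 / fact k) * (trig_exp ((trig_deriv (- \<delta> *\<^sub>R z) ^^ k) l) 0 * \<phi> z) \<partial>lborel)" by simp
    also have "\<dots> = (1 / fact k) * (if k = 0 then trig_exp l 0 else 0)"
      by (simp only: integral_mult_right_zero kernel_trig_moment(2))
    finally show ?thesis by simp
  qed
  have r: "(\<lambda>z. ?r z * \<phi> z) = (\<lambda>z. trig_exp l (- \<delta> *\<^sub>R z) * \<phi> z - (\<Sum>k<q. trig_exp ((trig_deriv (- \<delta> *\<^sub>R z) ^^ k) l) 0 / fact k * \<phi> z))"
    by (simp add: left_diff_distrib sum_distrib_right)
  have rint: "integrable lborel (\<lambda>z. ?r z * \<phi> z)"
    unfolding r by (intro Bochner_Integration.integrable_diff Bochner_Integration.integrable_sum kernel_trig_exp int)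
  have "(\<integral>z. ?r z * \<phi> z \<partial>lborel) = (\<integral>z. trig_exp l (- \<delta> *\<^sub>R z) * \<phi> z \<partial>lborel) - (\<Sum>k<q. (if k = 0 then trig_exp l 0 else 0))"
    unfolding r using int kernel_trig_exp(1)[of l] val by (simp del: divide_minus_left)
  also have "(\<Sum>k<q. (if k = 0 then trig_exp l 0 else 0)) = trig_exp l 0"
    using q by simp
  finally have eq: "(\<integral>z. ?r z * \<phi> z \<partial>lborel) = (\<integral>z. trig_exp l (- \<delta> *\<^sub>R z) * \<phi> z \<partial>lborel) - trig_exp l 0" .
  have rb: "\<bar>?r z\<bar> \<le> c * \<delta> ^ q * B * norm z ^ q" for z
  proof -
    obtain t where "trig_exp l (- \<delta> *\<^sub>R z) = (\<Sum>k<q. trig_exp ((trig_deriv (- \<delta> *\<^sub>R z) ^^ k) l) 0 / fact k)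
       + trig_exp ((trig_deriv (- \<delta> *\<^sub>R z) ^^ q) l) (t *\<^sub>R (- \<delta> *\<^sub>R z)) / fact q"
      by (rule trig_exp_Taylor[OF q])
    then have "\<bar>?r z\<bar> = \<bar>trig_exp ((trig_deriv (- \<delta> *\<^sub>R z) ^^ q) l) (t *\<^sub>R (- \<delta> *\<^sub>R z))\<bar> / fact q"
      by (simp add: abs_divide)
    also have "\<dots> \<le> \<bar>trig_exp ((trig_deriv (- \<delta> *\<^sub>R z) ^^ q) l) (t *\<^sub>R (- \<delta> *\<^sub>R z))\<bar> / 1"
      by (intro divide_left_mono) auto
    also have "\<dots> \<le> c * norm (- \<delta> *\<^sub>R z) ^ q * B" using trig_exp_estimate[OF B] by (simp only: div_by_1)
    also have "\<dots> = c * \<delta> ^ q * B * norm z ^ q" using \<delta> by (simp add: power_mult_distrib)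
    finally show ?thesis .
  qed
  have "\<bar>\<integral>z. ?r z * \<phi> z \<partial>lborel\<bar> \<le> (\<integral>z. \<bar>?r z * \<phi> z\<bar> \<partial>lborel)" by (rule integral_abs_bound)
  also have "\<dots> \<le> (\<integral>z. c * \<delta> ^ q * B * (norm z ^ q * \<bar>\<phi> z\<bar>) \<partial>lborel)"
  proof (rule integral_mono)
    show "integrable lborel (\<lambda>z. \<bar>?r z * \<phi> z\<bar>)" by (rule integrable_abs[OF rint])
    show "integrable lborel (\<lambda>z. c * \<delta> ^ q * B * (norm z ^ q * \<bar>\<phi> z\<bar>))" by (intro integrable_mult_right super_kernel_moment[OF \<phi>])
    fix z
    have "\<bar>?r z\<bar> * \<bar>\<phi> z\<bar> \<le> c * \<delta> ^ q * B * norm z ^ q * \<bar>\<phi> z\<bar>" by (rule mult_right_mono[OF rb]) simp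
    then show "\<bar>?r z * \<phi> z\<bar> \<le> c * \<delta> ^ q * B * (norm z ^ q * \<bar>\<phi> z\<bar>)" by (simp only: abs_mult mult.assoc)
  qed
  also have "\<dots> = c * \<delta> ^ q * (\<integral>z. norm z ^ q * \<bar>\<phi> z\<bar> \<partial>lborel) * B" by simp
  finally show ?thesis
    unfolding eq kernel_trig_exp(3) by (simp add: trig_exp_def abs_minus_commute)
qed

text \<open>The estimate contains no derivative of the function, so pointwise approximation by
  trigonometric polynomials with supremum at most B + 1/(n + 1) suffices; dominated convergence is
  applied inside the regularisation and again in the expectation.\<close>

lemma regularise_error:
  assumes f: "continuous_on UNIV f" and B: "\<And>x. \<bar>f x\<bar> \<le> B"
  shows "\<bar>expectation (\<lambda>\<omega>. Z \<omega> * f (Y \<omega>)) - expectation (\<lambda>\<omega>. Z \<omega> * regularise \<phi> \<delta> f (Y \<omega>))\<bar>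
    \<le> c * \<delta> ^ q * (\<integral>z. norm z ^ q * \<bar>\<phi> z\<bar> \<partial>lborel) * B"
proof -
  obtain l where l: "\<And>n x. \<bar>trig_fun (l n) x\<bar> \<le> B + 1 / real (Suc n)" "\<And>x. (\<lambda>n. trig_fun (l n) x) \<longlonglongrightarrow> f x"
    by (rule trig_approx[OF f B]) blast
  have l1: "\<bar>trig_fun (l n) x\<bar> \<le> B + 1" for n x
    using l(1)[of n x] by (rule order_trans) (simp add: divide_le_eq)
  have B0: "0 \<le> B" using B abs_ge_zero order_trans by blast
  have [measurable]: "f \<in> borel_measurable borel" using f by (rule borel_measurable_continuous_onI)
  have [measurable]: "trig_fun l \<in> borel_measurable borel" for l :: "'d trig"
    using trig_fun_continuous by (rule borel_measurable_continuous_onI)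
  note [measurable] = super_kernel_borel[OF \<phi>]
  have \<phi>i: "integrable lborel \<phi>" by (rule super_kernel_integrable[OF \<phi>])
  let ?K = "\<integral>z. \<bar>\<phi> z\<bar> \<partial>lborel"
  let ?R = "\<lambda>g x. \<integral>z. g (x - \<delta> *\<^sub>R z) * \<phi> z \<partial>lborel"
  have Rlim: "(\<lambda>n. ?R (trig_fun (l n)) x) \<longlonglongrightarrow> ?R f x" for x
  proof (rule integral_dominated_convergence[where w = "\<lambda>z. (B + 1) * \<bar>\<phi> z\<bar>"])
    show "integrable lborel (\<lambda>z. (B + 1) * \<bar>\<phi> z\<bar>)" using \<phi>i by auto
    show "AE z in lborel. norm (trig_fun (l n) (x - \<delta> *\<^sub>R z) * \<phi> z) \<le> (B + 1) * \<bar>\<phi> z\<bar>" for n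
      using l1 by (intro AE_I2) (auto simp: abs_mult intro!: mult_right_mono)
    show "AE z in lborel. (\<lambda>n. trig_fun (l n) (x - \<delta> *\<^sub>R z) * \<phi> z) \<longlonglongrightarrow> f (x - \<delta> *\<^sub>R z) * \<phi> z"
      by (intro AE_I2 tendsto_mult l tendsto_const)
  qed auto
  have Rbd: "\<bar>?R (trig_fun (l n)) x\<bar> \<le> (B + 1) * ?K" for n x
  proof -
    have "\<bar>?R (trig_fun (l n)) x\<bar> \<le> (\<integral>z. \<bar>trig_fun (l n) (x - \<delta> *\<^sub>R z) * \<phi> z\<bar> \<partial>lborel)" by (rule integral_abs_bound)
    also have "\<dots> \<le> (\<integral>z. (B + 1) * \<bar>\<phi> z\<bar> \<partial>lborel)"
      using l1 \<phi>i kernel_trig_integrable[of "l n" x]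
      by (intro integral_mono integrable_abs) (auto simp: abs_mult intro!: mult_right_mono)
    finally show ?thesis by simp
  qed
  have Rm[measurable]: "(\<lambda>\<omega>. ?R (trig_fun (l n)) (Y \<omega>)) \<in> borel_measurable M" for n
    by (rule lborel.borel_measurable_lebesgue_integral) measurable
  have Rfm[measurable]: "(\<lambda>\<omega>. ?R f (Y \<omega>)) \<in> borel_measurable M"
    by (rule lborel.borel_measurable_lebesgue_integral) measurable
  have 1: "(\<lambda>n. expectation (\<lambda>\<omega>. Z \<omega> * trig_fun (l n) (Y \<omega>))) \<longlonglongrightarrow> expectation (\<lambda>\<omega>. Z \<omega> * f (Y \<omega>))"
  proof (rule integral_dominated_convergence[where w = "\<lambda>_. B + 1"])
    show "AE \<omega> in M. norm (Z \<omega> * trig_fun (l n) (Y \<omega>)) \<le> B + 1" for n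
    proof (rule AE_I2)
      fix \<omega>
      have "\<bar>Z \<omega>\<bar> * \<bar>trig_fun (l n) (Y \<omega>)\<bar> \<le> 1 * (B + 1)" by (intro mult_mono Z1 l1) auto
      then show "norm (Z \<omega> * trig_fun (l n) (Y \<omega>)) \<le> B + 1" by (simp add: abs_mult)
    qed
    show "AE \<omega> in M. (\<lambda>n. Z \<omega> * trig_fun (l n) (Y \<omega>)) \<longlonglongrightarrow> Z \<omega> * f (Y \<omega>)" by (intro AE_I2 tendsto_mult l tendsto_const)
  qed auto
  have 2: "(\<lambda>n. expectation (\<lambda>\<omega>. Z \<omega> * ?R (trig_fun (l n)) (Y \<omega>))) \<longlonglongrightarrow> expectation (\<lambda>\<omega>. Z \<omega> * ?R f (Y \<omega>))"
  proof (rule integral_dominated_convergence[where w = "\<lambda>_. (B + 1) * ?K"])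
    show "AE \<omega> in M. norm (Z \<omega> * ?R (trig_fun (l n)) (Y \<omega>)) \<le> (B + 1) * ?K" for n
    proof (rule AE_I2)
      fix \<omega>
      have "\<bar>Z \<omega>\<bar> * \<bar>?R (trig_fun (l n)) (Y \<omega>)\<bar> \<le> 1 * ((B + 1) * ?K)" by (intro mult_mono Z1 Rbd) auto
      then show "norm (Z \<omega> * ?R (trig_fun (l n)) (Y \<omega>)) \<le> (B + 1) * ?K" by (simp add: abs_mult)
    qed
    show "AE \<omega> in M. (\<lambda>n. Z \<omega> * ?R (trig_fun (l n)) (Y \<omega>)) \<longlonglongrightarrow> Z \<omega> * ?R f (Y \<omega>)" by (intro AE_I2 tendsto_mult Rlim tendsto_const)
  qed auto
  let ?c = "c * \<delta> ^ q * (\<integral>z. norm z ^ q * \<bar>\<phi> z\<bar> \<partial>lborel)"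
  have "(\<lambda>n. 1 / real (Suc n)) \<longlonglongrightarrow> 0" using LIMSEQ_inverse_real_of_nat by (simp add: inverse_eq_divide)
  then have rhs: "(\<lambda>n. ?c * (B + 1 / real (Suc n))) \<longlonglongrightarrow> ?c * (B + 0)" by (intro tendsto_intros)
  have lhs: "(\<lambda>n. \<bar>expectation (\<lambda>\<omega>. Z \<omega> * trig_fun (l n) (Y \<omega>)) - expectation (\<lambda>\<omega>. Z \<omega> * ?R (trig_fun (l n)) (Y \<omega>))\<bar>)
     \<longlonglongrightarrow> \<bar>expectation (\<lambda>\<omega>. Z \<omega> * f (Y \<omega>)) - expectation (\<lambda>\<omega>. Z \<omega> * ?R f (Y \<omega>))\<bar>"
    by (intro tendsto_rabs tendsto_diff 1 2)
  have "\<bar>expectation (\<lambda>\<omega>. Z \<omega> * f (Y \<omega>)) - expectation (\<lambda>\<omega>. Z \<omega> * ?R f (Y \<omega>))\<bar> \<le> ?c * (B + 0)"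
    by (rule LIMSEQ_le[OF lhs rhs]) (use trig_regularise_error[OF l(1)] in auto)
  then show ?thesis using regularise_eq[OF \<phi> _ \<delta>, of f] by simp
qed

end

end

end

end

section \<open>The regularised function, and the complement of the cutoff\<close>

lemma regularise_bounded:
  assumes \<phi>: "super_kernel \<phi>" and \<delta>: "\<delta> > 0" and [measurable]: "f \<in> borel_measurable borel"
    and B: "\<And>x. \<bar>f x\<bar> \<le> B"
  shows "\<bar>regularise \<phi> \<delta> f x\<bar> \<le> B * (\<integral>z. \<bar>\<phi> z\<bar> \<partial>lborel)"
proof -
  note [measurable] = super_kernel_borel[OF \<phi>]
  have \<phi>i: "integrable lborel \<phi>" by (rule super_kernel_integrable[OF \<phi>])
  have bd: "\<bar>f (x - \<delta> *\<^sub>R z) * \<phi> z\<bar> \<le> B * \<bar>\<phi> z\<bar>" for z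
    using B by (simp add: abs_mult mult_right_mono)
  have "integrable lborel (\<lambda>z. f (x - \<delta> *\<^sub>R z) * \<phi> z)"
    by (rule Bochner_Integration.integrable_bound[of _ "\<lambda>z. B * \<bar>\<phi> z\<bar>"])
      (use \<phi>i in \<open>auto intro!: AE_I2 order_trans[OF bd abs_ge_self]\<close>)
  then have "(\<integral>z. \<bar>f (x - \<delta> *\<^sub>R z) * \<phi> z\<bar> \<partial>lborel) \<le> (\<integral>z. B * \<bar>\<phi> z\<bar> \<partial>lborel)"
    using \<phi>i bd by (intro integral_mono integrable_abs integrable_mult_right)
  moreover have "\<bar>regularise \<phi> \<delta> f x\<bar> \<le> (\<integral>z. \<bar>f (x - \<delta> *\<^sub>R z) * \<phi> z\<bar> \<partial>lborel)"
    unfolding regularise_eq[OF \<phi> assms(3) \<delta>] by (rule integral_abs_bound)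
  ultimately show ?thesis by simp
qed

lemma regularise_borel:
  assumes \<phi>: "super_kernel \<phi>" and \<delta>: "\<delta> > 0" and [measurable]: "f \<in> borel_measurable borel"
  shows "regularise \<phi> \<delta> f \<in> borel_measurable borel"
proof -
  note [measurable] = super_kernel_borel[OF \<phi>]
  have "(\<lambda>x. \<integral>z. f (x - \<delta> *\<^sub>R z) * \<phi> z \<partial>lborel) \<in> borel_measurable borel"
    by (rule lborel.borel_measurable_lebesgue_integral) measurable
  then show ?thesis using regularise_eq[OF \<phi> assms(3) \<delta>] by (simp cong: measurable_cong)
qed

lemma Cb_sup_norm:
  assumes "Cb k f"
  shows "continuous_on UNIV f" "\<bar>f x\<bar> \<le> sup_norm f"
proof -
  have "continuous_on UNIV (pderivs vec_shift [] f)" "bounded (range (pderivs vec_shift [] f))"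
    using assms unfolding Cb_def Ck_on_def by (auto simp del: pderivs.simps)
  then have f: "continuous_on UNIV f" "bounded (range f)" by simp_all
  then obtain b where b: "\<And>x. \<bar>f x\<bar> \<le> b" by (auto simp: bounded_iff)
  show "continuous_on UNIV f" by (rule f)
  show "\<bar>f x\<bar> \<le> sup_norm f" unfolding sup_norm_def
    by (rule cSUP_upper) (auto intro!: bdd_aboveI2 b)
qed

lemma cutoff_range:
  assumes "even m" "0 < \<eta>"
  shows "0 \<le> cutoff m \<eta> m 1 x" "cutoff m \<eta> m 1 x \<le> 1" "1 - cutoff m \<eta> m 1 x = \<eta> ^ m / (x ^ m + \<eta> ^ m)"
proof -
  have p: "0 < x ^ m + \<eta> ^ m" by (rule cutoff_pos[OF assms])
  have x: "0 \<le> x ^ m" using assms by (simp add: zero_le_even_power)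
  show "0 \<le> cutoff m \<eta> m 1 x" using p x by (simp add: cutoff_def)
  show "cutoff m \<eta> m 1 x \<le> 1" using p assms by (simp add: cutoff_def divide_le_eq)
  show "1 - cutoff m \<eta> m 1 x = \<eta> ^ m / (x ^ m + \<eta> ^ m)" using p by (simp add: cutoff_def field_simps)
qed

text \<open>Reduces parameters beyond a fixed one to that one when the mass of the complement is
  bounded from below.\<close>

lemma cutoff_antimono:
  assumes "even m" "0 < \<eta>" "\<eta> \<le> \<eta>'"
  shows "cutoff m \<eta>' m 1 x \<le> cutoff m \<eta> m 1 x"
proof -
  have "x ^ m + \<eta> ^ m \<le> x ^ m + \<eta>' ^ m" using assms by (intro add_left_mono power_mono) auto
  moreover have "0 \<le> x ^ m" using assms by (simp add: zero_le_even_power)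
  ultimately show ?thesis unfolding cutoff_def using cutoff_pos[OF assms(1,2), of x] by (simp add: divide_left_mono frac_le)
qed

text \<open>Either \<open>z\<close> is small, or \<open>x\<close> is far from \<open>z\<close>, or \<open>x\<close> is comparable to \<open>z\<close> and the cutoff is close to one.\<close>

lemma one_minus_cutoff_le:
  fixes x z :: real
  assumes m: "even m" and \<eta>: "0 < \<eta>" and \<kappa>: "1 \<le> \<kappa>" "\<kappa> \<le> real m" and p: "1 \<le> p"
  shows "ennreal (1 - cutoff m \<eta> m 1 x) \<le> ennreal (2 powr \<kappa>) *
    (ennreal (\<eta> powr (- p)) * ennreal (\<bar>x - z\<bar> powr p) +
     ennreal (\<eta> powr \<kappa>) * (if z = 0 then \<infinity> else ennreal (\<bar>z\<bar> powr (- \<kappa>))))"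
proof (cases "z = 0")
  case True
  then show ?thesis using \<eta> by (simp add: ennreal_mult_top)
next
  case False
  have r1: "1 - cutoff m \<eta> m 1 x \<le> 1" using cutoff_range[OF m \<eta>, of x] by simp
  have "1 - cutoff m \<eta> m 1 x \<le> 2 powr \<kappa> * (\<eta> powr (- p) * \<bar>x - z\<bar> powr p + \<eta> powr \<kappa> * \<bar>z\<bar> powr (- \<kappa>))"
  proof -
    have A: "2 powr \<kappa> * (\<eta> powr \<kappa> * \<bar>z\<bar> powr (- \<kappa>)) = (2 * \<eta> / \<bar>z\<bar>) powr \<kappa>"
      using \<eta> False by (simp add: powr_divide powr_mult powr_minus field_simps)
    have nn: "0 \<le> 2 powr \<kappa> * (\<eta> powr (- p) * \<bar>x - z\<bar> powr p)" "0 \<le> 2 powr \<kappa> * (\<eta> powr \<kappa> * \<bar>z\<bar> powr (- \<kappa>))" by simp_all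
    \<comment> \<open>Half of the threshold \<open>2 * \<eta>\<close> is \<eta>: in the second case
      the distance of \<open>x\<close> and \<open>z\<close> exceeds \<eta>. In the third |x| is
      known to be at least |z| / 2 only, which produces the base 2 \<eta> / |z|; it is below 1, so
      the exponent \<open>m\<close> may be lowered to \<kappa>. This is the source of
      \<open>2 powr \<kappa>\<close>.\<close>
    consider "\<bar>z\<bar> \<le> 2 * \<eta>" | "\<bar>z\<bar> > 2 * \<eta>" "\<bar>x - z\<bar> \<ge> \<bar>z\<bar> / 2" | "\<bar>z\<bar> > 2 * \<eta>" "\<bar>x - z\<bar> < \<bar>z\<bar> / 2" by linarith
    then show ?thesis
    proof cases
      case 1
      then have "1 \<le> (2 * \<eta> / \<bar>z\<bar>) powr \<kappa>" using False \<kappa> by (intro ge_one_powr_ge_zero) auto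
      then show ?thesis using r1 nn unfolding distrib_left A by linarith
    next
      case 2
      then have "\<eta> \<le> \<bar>x - z\<bar>" by linarith
      then have "\<eta> powr p \<le> \<bar>x - z\<bar> powr p" using \<eta> p by (intro powr_mono2) auto
      then have "1 \<le> \<eta> powr (- p) * \<bar>x - z\<bar> powr p" using \<eta> by (simp add: powr_minus field_simps)
      moreover have "1 \<le> 2 powr \<kappa>" using \<kappa> by (intro ge_one_powr_ge_zero) auto
      ultimately have "1 * 1 \<le> 2 powr \<kappa> * (\<eta> powr (- p) * \<bar>x - z\<bar> powr p)" by (intro mult_mono) auto
      then show ?thesis using r1 nn unfolding distrib_left by linarith
    next
      case 3
      then have x: "\<bar>z\<bar> / 2 \<le> \<bar>x\<bar>" "\<bar>x\<bar> > 0" using \<eta> by linarith+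
      have xm: "x ^ m = \<bar>x\<bar> ^ m" using m by (simp add: power_even_abs)
      have "1 - cutoff m \<eta> m 1 x \<le> \<eta> ^ m / \<bar>x\<bar> ^ m"
        unfolding cutoff_range(3)[OF m \<eta>] xm using x \<eta> by (intro divide_left_mono) (auto intro!: mult_pos_pos add_pos_pos)
      also have "\<dots> = (\<eta> / \<bar>x\<bar>) ^ m" by (simp add: power_divide)
      also have "\<dots> \<le> (2 * \<eta> / \<bar>z\<bar>) ^ m"
      proof (rule power_mono)
        have "\<eta> / \<bar>x\<bar> \<le> \<eta> / (\<bar>z\<bar> / 2)" using x \<eta> False by (intro divide_left_mono) auto
        then show "\<eta> / \<bar>x\<bar> \<le> 2 * \<eta> / \<bar>z\<bar>" by (simp add: mult.commute)
      qed (use \<eta> in simp)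
      also have "\<dots> = (2 * \<eta> / \<bar>z\<bar>) powr real m" using \<eta> False by (simp add: powr_realpow)
      also have "\<dots> \<le> (2 * \<eta> / \<bar>z\<bar>) powr \<kappa>"
        using 3(1) \<eta> \<kappa>(2) by (intro powr_mono') auto
      finally show ?thesis using nn unfolding distrib_left A by linarith
    qed
  qed
  then have "ennreal (1 - cutoff m \<eta> m 1 x) \<le> ennreal (2 powr \<kappa> * (\<eta> powr (- p) * \<bar>x - z\<bar> powr p + \<eta> powr \<kappa> * \<bar>z\<bar> powr (- \<kappa>)))"
    by (rule ennreal_leI)
  also have "\<dots> = ennreal (2 powr \<kappa>) *
    (ennreal (\<eta> powr (- p)) * ennreal (\<bar>x - z\<bar> powr p) + ennreal (\<eta> powr \<kappa>) * ennreal (\<bar>z\<bar> powr (- \<kappa>)))"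
    by (simp add: ennreal_mult ennreal_plus)
  finally show ?thesis using False by simp
qed

lemma tendsto_det:
  fixes A :: "nat \<Rightarrow> real ^ 'n ^ 'n::finite"
  assumes "\<And>i j. (\<lambda>n. A n $ i $ j) \<longlonglongrightarrow> B $ i $ j"
  shows "(\<lambda>n. det (A n)) \<longlonglongrightarrow> det B"
  unfolding det_def by (intro tendsto_intros assms)

lemma rv_vec_borel:
  assumes "\<And>i. F i \<in> borel_measurable M"
  shows "rv_vec F \<in> borel_measurable M"
  using assms by (subst borel_measurable_euclidean_space) (auto simp: Basis_vec_def rv_vec_def inner_axis)

section \<open>Passage of the integration by parts estimate to smooth functionals\<close>

context ibp_framework
begin

lemma det_cov_borel [measurable]:
  assumes "\<And>i. F i \<in> D_inf M S D L"
  shows "(\<lambda>\<omega>. det (cov_matrix M S D F \<omega>)) \<in> borel_measurable M"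
proof -
  note [measurable] = D_bar_borel[OF assms]
  show ?thesis unfolding det_def cov_matrix_def by simp
qed

text \<open>The approximating vectors share one norm bound and hence one constant. Along a
  subsequence their values and first derivatives converge almost surely, and the integrands are
  bounded and continuous in them, so the estimate survives. \<open>L\<close> and higher derivatives
  act only through the constant.\<close>

lemma smooth_functional_estimate:
  fixes F :: "'d::finite \<Rightarrow> 'w \<Rightarrow> real"
  assumes F: "\<And>i. F i \<in> D_inf M S D L" and m: "even m" "m \<ge> 2" "2 * q \<le> m" and \<eta>0: "\<eta>0 > 0"
  obtains C where "C \<ge> 0" "\<And>\<eta> l y B. 0 < \<eta> \<Longrightarrow> \<eta> \<le> \<eta>0 \<Longrightarrow> (\<And>x. \<bar>trig_fun l x\<bar> \<le> B) \<Longrightarrow>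
    \<bar>expectation (\<lambda>\<omega>. trig_fun ((trig_deriv y ^^ q) l) (rv_vec F \<omega>) * cutoff m \<eta> m 1 (det (cov_matrix M S D F \<omega>)))\<bar>
      \<le> C * norm y ^ q * B * \<eta> powr (- (2 * real q))"
proof -
  \<comment> \<open>For weight 1 and exponents \<open>m\<close>, 1 the cutoff has degree 0, leaving
    the power - 2 q of \<eta>.\<close>
  have "unif_bound (ibp_estimate \<eta>0 m q (\<lambda>(F::'d \<Rightarrow> 'w \<Rightarrow> real) \<omega>. 1) m 1)"
    using m by (intro ibp_estimate_tame \<eta>0 tame_const) auto
  then obtain K where K: "\<And>R. \<exists>C\<ge>0. \<forall>F. norm_bd K R F \<longrightarrow> ibp_estimate \<eta>0 m q (\<lambda>(F::'d \<Rightarrow> 'w \<Rightarrow> real) \<omega>. 1) m 1 F C"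
    unfolding unif_bound_def by blast
  define K' where "K' = max K 1"
  define P where "P = (\<lambda>i G R. (\<forall>n::nat. G n \<in> S) \<and>
    (\<forall>n N. expectation (\<lambda>\<omega>. sq (onb N) K' (G n) \<omega> ^ K') \<le> R \<and> expectation (\<lambda>\<omega>. sq (onb N) K' (L (G n)) \<omega> ^ K') \<le> R) \<and>
    (\<lambda>n. \<integral>\<^sup>+ \<omega>. ennreal ((norm (G n \<omega> - F i \<omega>))\<^sup>2) \<partial>M) \<longlonglongrightarrow> 0 \<and>
    (\<lambda>n. \<integral>\<^sup>+ \<omega>. ennreal ((norm (D (G n) \<omega> - D_bar M S D (F i) \<omega>))\<^sup>2) \<partial>M) \<longlonglongrightarrow> 0)"
  have "\<exists>G R. P i G R" for i
    unfolding P_def by (intro D_inf_approx F) (simp add: K'_def)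
  then obtain G R where GR: "\<And>i. P i (G i) (R i)" by metis
  have G: "G i n \<in> S" for i n using GR[of i] unfolding P_def by blast
  have R: "expectation (\<lambda>\<omega>. sq (onb N) K' (G i n) \<omega> ^ K') \<le> R i"
      "expectation (\<lambda>\<omega>. sq (onb N) K' (L (G i n)) \<omega> ^ K') \<le> R i" for i n N
    using GR[of i] unfolding P_def by blast+
  have lim: "(\<lambda>n. \<integral>\<^sup>+ \<omega>. ennreal ((norm (G i n \<omega> - F i \<omega>))\<^sup>2) \<partial>M) \<longlonglongrightarrow> 0"
      "(\<lambda>n. \<integral>\<^sup>+ \<omega>. ennreal ((norm (D (G i n) \<omega> - D_bar M S D (F i) \<omega>))\<^sup>2) \<partial>M) \<longlonglongrightarrow> 0" for i
    using GR[of i] unfolding P_def by blast+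
  define Fn where "Fn = (\<lambda>n i. G i n)"
  have FnS: "\<forall>i. Fn n i \<in> S" for n by (simp add: Fn_def G)
  define R' where "R' = Max (range R)"
  have R': "R i \<le> R'" for i unfolding R'_def by (intro Max_ge) auto
  have "norm_bd K' R' (Fn n)" for n
    unfolding norm_bd_def Fn_def using G R R' by (meson order_trans)
  then have bd: "norm_bd K (1 + R') (Fn n)" for n
    by (rule norm_bd_mono) (simp add: K'_def)
  obtain C where C: "C \<ge> 0" "\<And>n. ibp_estimate \<eta>0 m q (\<lambda>(F::'d \<Rightarrow> 'w \<Rightarrow> real) \<omega>. 1) m 1 (Fn n) C"
    using K[of "1 + R'"] bd by blast
  note [measurable] = S_borel[OF G] D_borel[OF G] D_bar_borel[OF F] D_inf_borel[OF F]
  \<comment> \<open>All squared errors of values and derivatives are collected in one function, so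
    that a single subsequence works for every component.\<close>
  define u where "u = (\<lambda>n \<omega>. \<Sum>i\<in>UNIV. (norm (G i n \<omega> - F i \<omega>))\<^sup>2 + (norm (D (G i n) \<omega> - D_bar M S D (F i) \<omega>))\<^sup>2)"
  have u0: "0 \<le> u n \<omega>" for n \<omega> by (auto simp: u_def intro!: sum_nonneg)
  have [measurable]: "u n \<in> borel_measurable M" for n unfolding u_def by measurable
  have ulim: "(\<lambda>n. \<integral>\<^sup>+ \<omega>. ennreal (u n \<omega>) \<partial>M) \<longlonglongrightarrow> 0"
  proof -
    have "(\<integral>\<^sup>+ \<omega>. ennreal (u n \<omega>) \<partial>M) = (\<Sum>i\<in>UNIV. (\<integral>\<^sup>+ \<omega>. ennreal ((norm (G i n \<omega> - F i \<omega>))\<^sup>2) \<partial>M)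
        + (\<integral>\<^sup>+ \<omega>. ennreal ((norm (D (G i n) \<omega> - D_bar M S D (F i) \<omega>))\<^sup>2) \<partial>M))" for n
    proof -
      have "(\<integral>\<^sup>+ \<omega>. ennreal (u n \<omega>) \<partial>M) = (\<integral>\<^sup>+ \<omega>. (\<Sum>i\<in>UNIV. ennreal ((norm (G i n \<omega> - F i \<omega>))\<^sup>2)
        + ennreal ((norm (D (G i n) \<omega> - D_bar M S D (F i) \<omega>))\<^sup>2)) \<partial>M)"
        unfolding u_def by (intro nn_integral_cong) (simp add: sum_ennreal[symmetric] ennreal_plus)
      also have "\<dots> = (\<Sum>i\<in>UNIV. \<integral>\<^sup>+ \<omega>. (ennreal ((norm (G i n \<omega> - F i \<omega>))\<^sup>2)
        + ennreal ((norm (D (G i n) \<omega> - D_bar M S D (F i) \<omega>))\<^sup>2)) \<partial>M)"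
        by (rule nn_integral_sum) simp
      also have "\<dots> = (\<Sum>i\<in>UNIV. (\<integral>\<^sup>+ \<omega>. ennreal ((norm (G i n \<omega> - F i \<omega>))\<^sup>2) \<partial>M)
        + (\<integral>\<^sup>+ \<omega>. ennreal ((norm (D (G i n) \<omega> - D_bar M S D (F i) \<omega>))\<^sup>2) \<partial>M))"
        by (intro sum.cong refl nn_integral_add) auto
      finally show ?thesis .
    qed
    moreover have "(\<lambda>n. \<Sum>i\<in>UNIV. (\<integral>\<^sup>+ \<omega>. ennreal ((norm (G i n \<omega> - F i \<omega>))\<^sup>2) \<partial>M)
        + (\<integral>\<^sup>+ \<omega>. ennreal ((norm (D (G i n) \<omega> - D_bar M S D (F i) \<omega>))\<^sup>2) \<partial>M)) \<longlonglongrightarrow> (\<Sum>i\<in>(UNIV::'d set). 0 + 0)"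
      by (intro tendsto_sum tendsto_add lim)
    ultimately show ?thesis by simp
  qed
  obtain N where N: "\<And>n. n \<ge> N \<Longrightarrow> (\<integral>\<^sup>+ \<omega>. ennreal (u n \<omega>) \<partial>M) < ennreal 1"
    using ulim unfolding ennreal_tendsto_0_iff eventually_sequentially by (metis zero_less_one)
  have ui: "integrable M (u (n + N))" for n
    using N[of "n + N"] u0 by (intro integrableI_nonneg) (auto intro: less_trans)
  have "(\<lambda>n. LINT \<omega>|M. norm (u (n + N) \<omega>)) \<longlonglongrightarrow> 0"
  proof -
    have "(LINT \<omega>|M. norm (u (n + N) \<omega>)) = enn2real (\<integral>\<^sup>+ \<omega>. ennreal (u (n + N) \<omega>) \<partial>M)" for n
      using u0 by (simp add: integral_eq_nn_integral)
    moreover have "(\<lambda>n. enn2real (\<integral>\<^sup>+ \<omega>. ennreal (u (n + N) \<omega>) \<partial>M)) \<longlonglongrightarrow> 0"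
      using LIMSEQ_ignore_initial_segment[OF ulim, of N] by (intro tendsto_enn2real) auto
    ultimately show ?thesis by simp
  qed
  from tendsto_L1_AE_subseq[OF ui this] obtain r where
    r: "AE \<omega> in M. (\<lambda>n. u (r n + N) \<omega>) \<longlonglongrightarrow> 0" by blast
  define s where "s = (\<lambda>n. r n + N)"
  have conv: "AE \<omega> in M. (\<lambda>n. rv_vec (Fn (s n)) \<omega>) \<longlonglongrightarrow> rv_vec F \<omega> \<and>
      (\<lambda>n. det (cov (Fn (s n)) \<omega>)) \<longlonglongrightarrow> det (cov_matrix M S D F \<omega>)"
    using r
  proof eventually_elim
    case (elim \<omega>)
    have le: "(norm (G i n \<omega> - F i \<omega>))\<^sup>2 \<le> u n \<omega>" "(norm (D (G i n) \<omega> - D_bar M S D (F i) \<omega>))\<^sup>2 \<le> u n \<omega>" for i n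
    proof -
      have "(norm (G i n \<omega> - F i \<omega>))\<^sup>2 + (norm (D (G i n) \<omega> - D_bar M S D (F i) \<omega>))\<^sup>2 \<le> u n \<omega>"
        unfolding u_def by (rule member_le_sum[where f = "\<lambda>i. (norm (G i n \<omega> - F i \<omega>))\<^sup>2 + (norm (D (G i n) \<omega> - D_bar M S D (F i) \<omega>))\<^sup>2"]) auto
      then show "(norm (G i n \<omega> - F i \<omega>))\<^sup>2 \<le> u n \<omega>" "(norm (D (G i n) \<omega> - D_bar M S D (F i) \<omega>))\<^sup>2 \<le> u n \<omega>"
        using zero_le_power2[of "norm (G i n \<omega> - F i \<omega>)"] zero_le_power2[of "norm (D (G i n) \<omega> - D_bar M S D (F i) \<omega>)"]
        by linarith+
    qed
    have "(\<lambda>n. sqrt (u (s n) \<omega>)) \<longlonglongrightarrow> sqrt 0" unfolding s_def by (intro tendsto_real_sqrt elim)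
    then have sq: "(\<lambda>n. sqrt (u (s n) \<omega>)) \<longlonglongrightarrow> 0" by simp
    have "(\<lambda>n. G i (s n) \<omega> - F i \<omega>) \<longlonglongrightarrow> 0" for i
      by (rule Lim_null_comparison[OF _ sq]) (auto intro!: always_eventually real_le_rsqrt le[simplified])
    then have 1: "(\<lambda>n. G i (s n) \<omega>) \<longlonglongrightarrow> F i \<omega>" for i by (simp add: LIM_zero_iff)
    have "(\<lambda>n. D (G i (s n)) \<omega> - D_bar M S D (F i) \<omega>) \<longlonglongrightarrow> 0" for i
      by (rule Lim_null_comparison[OF _ sq]) (auto intro!: always_eventually real_le_rsqrt le)
    then have 2: "(\<lambda>n. D (G i (s n)) \<omega>) \<longlonglongrightarrow> D_bar M S D (F i) \<omega>" for i by (simp add: LIM_zero_iff)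
    have "(\<lambda>n. rv_vec (Fn (s n)) \<omega>) \<longlonglongrightarrow> rv_vec F \<omega>"
      unfolding rv_vec_def Fn_def by (intro vec_tendstoI) (simp add: 1)
    moreover have "(\<lambda>n. det (cov (Fn (s n)) \<omega>)) \<longlonglongrightarrow> det (cov_matrix M S D F \<omega>)"
      by (rule tendsto_det) (simp add: cov_def cov_matrix_def \<Gamma>_def Fn_def tendsto_inner 2)
    ultimately show ?case ..
  qed
  show thesis
  proof (rule that[OF C(1)])
    fix \<eta> B :: real and l :: "'d trig" and y :: "real ^ 'd"
    assume \<eta>: "0 < \<eta>" "\<eta> \<le> \<eta>0" and B: "\<And>x. \<bar>trig_fun l x\<bar> \<le> B"
    let ?g = "trig_fun ((trig_deriv y ^^ q) l)"
    let ?h = "\<lambda>x. cutoff m \<eta> m 1 x"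
    obtain b where b: "\<And>x. \<bar>?g x\<bar> \<le> b"
    proof -
      have "\<exists>b. \<forall>x. \<bar>trig_fun l x\<bar> \<le> b" for l :: "'d trig"
      proof (induction l)
        case Nil show ?case by auto
      next
        case (Cons t l)
        then obtain b where b: "\<And>x. \<bar>trig_fun l x\<bar> \<le> b" by blast
        obtain c \<xi> \<theta> where t: "t = (c, \<xi>, \<theta>)" by (cases t)
        have "\<bar>trig_fun (t # l) x\<bar> \<le> \<bar>c\<bar> + b" for x
        proof -
          have "\<bar>c * cos (\<xi> \<bullet> x + \<theta>)\<bar> \<le> \<bar>c\<bar>"
            using mult_left_mono[OF abs_cos_le_one[of "\<xi> \<bullet> x + \<theta>"], of "\<bar>c\<bar>"] by (simp add: abs_mult)
          then show ?thesis using b[of x] unfolding t trig_fun_Cons by linarith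
        qed
        then show ?case by blast
      qed
      then show ?thesis using that by blast
    qed
    have gc: "isCont ?g x" for x
      using trig_fun_continuous[of UNIV "(trig_deriv y ^^ q) l"] by (simp add: continuous_on_eq_continuous_at)
    have hc: "isCont ?h x" for x
      unfolding cutoff_def using cutoff_pos[OF m(1) \<eta>(1), of x] by (intro continuous_intros) auto
    have [measurable]: "?g \<in> borel_measurable borel"
      by (rule borel_measurable_continuous_onI[OF trig_fun_continuous])
    have [measurable]: "?h \<in> borel_measurable borel"
      unfolding cutoff_def by measurable
    have Ym[measurable]: "rv_vec F \<in> borel_measurable M"
      by (intro rv_vec_borel D_inf_borel F)
    have "(\<lambda>n. expectation (\<lambda>\<omega>. ?g (rv_vec (Fn (s n)) \<omega>) * (1 * ?h (det (cov (Fn (s n)) \<omega>)))))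
      \<longlonglongrightarrow> expectation (\<lambda>\<omega>. ?g (rv_vec F \<omega>) * ?h (det (cov_matrix M S D F \<omega>)))"
    proof (rule integral_dominated_convergence[where w = "\<lambda>_. b"])
      show "(\<lambda>\<omega>. ?g (rv_vec F \<omega>) * ?h (det (cov_matrix M S D F \<omega>))) \<in> borel_measurable M"
        using det_cov_borel[of F, OF F] by measurable
      show "(\<lambda>\<omega>. ?g (rv_vec (Fn (s n)) \<omega>) * (1 * ?h (det (cov (Fn (s n)) \<omega>)))) \<in> borel_measurable M" for n
        by (intro S_borel S_mult trig_fun_S[OF FnS] S_const cutoff_det_S[OF FnS m(1) \<eta>(1)])
      show "AE \<omega> in M. (\<lambda>n. ?g (rv_vec (Fn (s n)) \<omega>) * (1 * ?h (det (cov (Fn (s n)) \<omega>)))) \<longlonglongrightarrow>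
         ?g (rv_vec F \<omega>) * ?h (det (cov_matrix M S D F \<omega>))"
        using conv
      proof eventually_elim
        case (elim \<omega>)
        then show ?case using isCont_tendsto_compose[OF gc] isCont_tendsto_compose[OF hc]
          by (auto intro!: tendsto_mult)
      qed
      show "AE \<omega> in M. norm (?g (rv_vec (Fn (s n)) \<omega>) * (1 * ?h (det (cov (Fn (s n)) \<omega>)))) \<le> b" for n
      proof (rule AE_I2)
        fix \<omega>
        have "\<bar>?g (rv_vec (Fn (s n)) \<omega>)\<bar> * \<bar>?h (det (cov (Fn (s n)) \<omega>))\<bar> \<le> b * 1"
        proof (rule mult_mono[OF b])
          show "\<bar>?h (det (cov (Fn (s n)) \<omega>))\<bar> \<le> 1"
            using cutoff_range(1,2)[OF m(1) \<eta>(1), of "det (cov (Fn (s n)) \<omega>)"] by linarith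
          show "0 \<le> b" using b[of 0] by linarith
        qed simp
        then show "norm (?g (rv_vec (Fn (s n)) \<omega>) * (1 * ?h (det (cov (Fn (s n)) \<omega>)))) \<le> b" by (simp add: abs_mult)
      qed
    qed simp
    moreover have "\<bar>expectation (\<lambda>\<omega>. ?g (rv_vec (Fn n) \<omega>) * (1 * ?h (det (cov (Fn n) \<omega>))))\<bar>
        \<le> C * norm y ^ q * B * \<eta> powr (- (2 * real q))" for n
      using C(2)[of n, unfolded ibp_estimate_def, THEN spec[of _ \<eta>], THEN spec[of _ l], THEN spec[of _ y], THEN spec[of _ B]] \<eta> B
      by simp
    ultimately show "\<bar>expectation (\<lambda>\<omega>. ?g (rv_vec F \<omega>) * ?h (det (cov_matrix M S D F \<omega>)))\<bar>
      \<le> C * norm y ^ q * B * \<eta> powr (- (2 * real q))"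
      by (intro LIMSEQ_le_const2[OF tendsto_rabs]) auto
  qed
qed

end

section \<open>Choice of the constants and combination of the two parts\<close>

theorem lemma3p5:
  fixes M :: "'w measure"
    and S :: "('w \<Rightarrow> real) set"
    and D :: "('w \<Rightarrow> real) \<Rightarrow> 'w \<Rightarrow> 'h::{real_inner, banach, second_countable_topology}"
    and L :: "('w \<Rightarrow> real) \<Rightarrow> 'w \<Rightarrow> real"
    and \<phi> :: "real ^ 'd::finite \<Rightarrow> real"
    and F :: "'d \<Rightarrow> 'w \<Rightarrow> real"
    and q :: nat and \<kappa> p :: real
  assumes "ibp_framework M S D L"
    and "super_kernel \<phi>"
    and "q \<ge> 1" and "\<kappa> \<ge> 1" and "p \<ge> 1"
    and "\<And>i. F i \<in> D_inf M S D L"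
    and "norm_L M (Dq_bar M S D) (L_bar M S L) (q + 2) (real ((4 * CARD('d) + 1) * q)) F < \<infinity>"
  shows "\<exists>C\<ge>0. \<forall>Q :: 'd \<Rightarrow> 'w \<Rightarrow> real.
    (\<forall>i. Q i \<in> D_inf M S D L) \<and> Sigma_inv M S D \<kappa> Q < \<infinity> \<longrightarrow>
    (\<forall>\<eta>>0. \<forall>\<delta>>0. \<forall>f :: real ^ 'd \<Rightarrow> real. Cb q f \<longrightarrow>
      ennreal \<bar>(\<integral>\<omega>. f (\<chi> i. F i \<omega>) \<partial>M) - (\<integral>\<omega>. regularise \<phi> \<delta> f (\<chi> i. F i \<omega>) \<partial>M)\<bar>
      \<le> ennreal (C * sup_norm f) *
          (ennreal (\<delta> ^ q / \<eta> ^ (2 * q))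
           + ennreal (\<eta> powr (- p)) *
               (\<integral>\<^sup>+ \<omega>. ennreal (\<bar>det (cov_matrix M S D F \<omega>) - det (cov_matrix M S D Q \<omega>)\<bar> powr p) \<partial>M)
           + ennreal (\<eta> powr \<kappa>) * Sigma_inv M S D \<kappa> Q))"
proof -
  interpret ibp_framework M S D L by fact
  note \<phi> = assms(2) and F = assms(6)
  \<comment> \<open>\<open>m\<close> is even, at least 2 q for \<open>q\<close> integrations by
    parts, and at least \<kappa> for the comparison with the determinant of
    \<open>Q\<close>.\<close>
  define m where "m = 2 * (q + nat \<lceil>\<kappa>\<rceil>)"
  have m: "even m" "m \<ge> 2" "2 * q \<le> m" and \<kappa>m: "\<kappa> \<le> real m"
    using assms(3,4) by (auto simp: m_def) linarith
  define \<Delta> where "\<Delta> = (\<lambda>\<omega>. det (cov_matrix M S D F \<omega>))"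
  define Z where "Z = (\<lambda>\<eta> \<omega>. cutoff m \<eta> m 1 (\<Delta> \<omega>))"
  have \<Delta>m[measurable]: "\<Delta> \<in> borel_measurable M" unfolding \<Delta>_def by (rule det_cov_borel[OF F])
  have Ym[measurable]: "rv_vec F \<in> borel_measurable M" by (intro rv_vec_borel D_inf_borel F)
  have Zm[measurable]: "Z \<eta> \<in> borel_measurable M" for \<eta> unfolding Z_def cutoff_def by measurable
  have Z01: "0 \<le> Z \<eta> \<omega>" "Z \<eta> \<omega> \<le> 1" if "\<eta> > 0" for \<eta> \<omega>
    unfolding Z_def by (rule cutoff_range[OF m(1) that])+
  have Zi: "integrable M (Z \<eta>)" if "\<eta> > 0" for \<eta>
    by (rule integrable_const_bound[where B = 1]) (use Z01[OF that] in auto)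
  \<comment> \<open>The cutoff tends to 0 pointwise as its parameter grows, hence also in
    expectation. Below 1/2 it leaves the complement at least half of the mass, for all larger
    parameters as well.\<close>
  obtain \<eta>0 where \<eta>0: "\<eta>0 > 0" "expectation (Z \<eta>0) < 1 / 2"
  proof -
    have "(\<lambda>n. expectation (Z (real (Suc n)))) \<longlonglongrightarrow> expectation (\<lambda>\<omega>. 0)"
    proof (rule integral_dominated_convergence[where w = "\<lambda>_. 1"])
      have "(\<lambda>n. cutoff m (real (Suc n)) m 1 x) \<longlonglongrightarrow> 0" for x
      proof (rule Lim_null_comparison[where g = "\<lambda>n. x ^ m * (1 / real (Suc n))"])
        have "norm (cutoff m (real (Suc n)) m 1 x) \<le> x ^ m * (1 / real (Suc n))" for n
        proof -
          have x: "0 \<le> x ^ m" using m(1) by (simp add: zero_le_even_power)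
          have "real (Suc n) ^ 1 \<le> real (Suc n) ^ m" using m(2) by (intro power_increasing) auto
          then have "real (Suc n) \<le> x ^ m + real (Suc n) ^ m" using x by simp
          then have "x ^ m / (x ^ m + real (Suc n) ^ m) \<le> x ^ m / real (Suc n)"
            using x by (intro frac_le) auto
          then have "cutoff m (real (Suc n)) m 1 x \<le> x ^ m * (1 / real (Suc n))" by (simp add: cutoff_def)
          moreover have "0 \<le> cutoff m (real (Suc n)) m 1 x" by (rule cutoff_range(1)[OF m(1)]) simp
          ultimately show ?thesis by (simp only: real_norm_def abs_of_nonneg)
        qed
        then show "\<forall>\<^sub>F n in sequentially. norm (cutoff m (real (Suc n)) m 1 x) \<le> x ^ m * (1 / real (Suc n))" by simp
        show "(\<lambda>n. x ^ m * (1 / real (Suc n))) \<longlonglongrightarrow> 0"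
          using tendsto_mult_right_zero[OF LIMSEQ_inverse_real_of_nat, of "x ^ m"] by (simp add: inverse_eq_divide)
      qed
      then show "AE \<omega> in M. (\<lambda>n. Z (real (Suc n)) \<omega>) \<longlonglongrightarrow> 0" by (simp add: Z_def)
      show "AE \<omega> in M. norm (Z (real (Suc n)) \<omega>) \<le> 1" for n using Z01[of "real (Suc n)"] by simp
    qed auto
    then have "(\<lambda>n. expectation (Z (real (Suc n)))) \<longlonglongrightarrow> 0" by simp
    from order_tendstoD(2)[OF this, of "1 / 2"] obtain n where "expectation (Z (real (Suc n))) < 1 / 2"
      by (auto simp: eventually_sequentially)
    then show ?thesis using that[of "real (Suc n)"] by simp
  qed
  obtain C1 where C1: "C1 \<ge> 0" "\<And>\<eta> l y B. 0 < \<eta> \<Longrightarrow> \<eta> \<le> \<eta>0 \<Longrightarrow> (\<And>x. \<bar>trig_fun l x\<bar> \<le> B) \<Longrightarrow>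
    \<bar>expectation (\<lambda>\<omega>. trig_fun ((trig_deriv y ^^ q) l) (rv_vec F \<omega>) * Z \<eta> \<omega>)\<bar> \<le> C1 * norm y ^ q * B * \<eta> powr (- (2 * real q))"
    unfolding Z_def \<Delta>_def by (rule smooth_functional_estimate[of F m q \<eta>0, OF _ m \<eta>0(1)]) (rule F, blast)
  define K where "K = (\<integral>z. \<bar>\<phi> z\<bar> \<partial>lborel)"
  define Mq where "Mq = (\<integral>z. norm z ^ q * \<bar>\<phi> z\<bar> \<partial>lborel)"
  have K0: "0 \<le> K" "0 \<le> Mq" by (simp_all add: K_def Mq_def)
  \<comment> \<open>\<open>1 + K\<close> times the supremum of \<open>f\<close> bounds the
    difference of \<open>f\<close> and its regularisation; the factor 2 compensates for the mass 1/2
    of the complement when \<eta> exceeds \<open>\<eta>0\<close>.\<close>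
  define b where "b = 2 * (1 + K)"
  have main: "\<bar>expectation (\<lambda>\<omega>. f (rv_vec F \<omega>)) - expectation (\<lambda>\<omega>. regularise \<phi> \<delta> f (rv_vec F \<omega>))\<bar>
     \<le> sup_norm f * (C1 * Mq * (\<delta> ^ q / \<eta> ^ (2 * q)) + b * expectation (\<lambda>\<omega>. 1 - Z \<eta> \<omega>))"
    if \<eta>: "\<eta> > 0" and \<delta>: "\<delta> > 0" and f: "Cb q f" for \<eta> \<delta> and f :: "real ^ 'd \<Rightarrow> real"
  proof -
    note fc = Cb_sup_norm(1)[OF f] and fb = Cb_sup_norm(2)[OF f]
    have B0: "0 \<le> sup_norm f" using fb[of 0] by linarith
    have fm[measurable]: "f \<in> borel_measurable borel" using fc by (rule borel_measurable_continuous_onI)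
    have rm[measurable]: "regularise \<phi> \<delta> f \<in> borel_measurable borel" by (rule regularise_borel[OF \<phi> \<delta> fm])
    have rb: "\<bar>regularise \<phi> \<delta> f x\<bar> \<le> sup_norm f * K" for x
      unfolding K_def by (rule regularise_bounded[OF \<phi> \<delta> fm fb])
    let ?g = "\<lambda>\<omega>. f (rv_vec F \<omega>)" and ?r = "\<lambda>\<omega>. regularise \<phi> \<delta> f (rv_vec F \<omega>)"
    have gi: "integrable M ?g" by (rule integrable_const_bound[where B = "sup_norm f"]) (use fb in auto)
    have ri: "integrable M ?r" by (rule integrable_const_bound[where B = "sup_norm f * K"]) (use rb in auto)
    have diff: "\<bar>?g \<omega> - ?r \<omega>\<bar> \<le> sup_norm f * (1 + K)" for \<omega>
      using fb[of "rv_vec F \<omega>"] rb[of "rv_vec F \<omega>"] unfolding distrib_left by linarith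
    have Zgi: "integrable M (\<lambda>\<omega>. Z \<eta> \<omega> * ?g \<omega>)"
      by (rule Bochner_Integration.integrable_bound[OF gi])
        (use Z01[OF \<eta>] in \<open>auto simp: abs_mult intro!: AE_I2 mult_left_le_one_le\<close>)
    have Zri: "integrable M (\<lambda>\<omega>. Z \<eta> \<omega> * ?r \<omega>)"
      by (rule Bochner_Integration.integrable_bound[OF ri])
        (use Z01[OF \<eta>] in \<open>auto simp: abs_mult intro!: AE_I2 mult_left_le_one_le\<close>)
    show ?thesis
    proof (cases "\<eta> \<le> \<eta>0")
      case True
      have "\<bar>expectation (\<lambda>\<omega>. Z \<eta> \<omega> * ?g \<omega>) - expectation (\<lambda>\<omega>. Z \<eta> \<omega> * ?r \<omega>)\<bar> \<le> (C1 * \<eta> powr (- (2 * real q))) * \<delta> ^ q * Mq * sup_norm f"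
        unfolding Mq_def
      proof (rule regularise_error[OF Ym Zm _ assms(3) _ _ \<phi> \<delta> fc fb])
        show "\<bar>Z \<eta> \<omega>\<bar> \<le> 1" for \<omega> using Z01[OF \<eta>, of \<omega>] by linarith
        show "0 \<le> C1 * \<eta> powr (- (2 * real q))" using C1(1) by simp
        show "\<bar>expectation (\<lambda>\<omega>. trig_fun ((trig_deriv y ^^ q) l) (rv_vec F \<omega>) * Z \<eta> \<omega>)\<bar> \<le> C1 * \<eta> powr (- (2 * real q)) * norm y ^ q * B"
          if "\<And>x. \<bar>trig_fun l x\<bar> \<le> B" for l y B
          using C1(2)[OF \<eta> True that, of y] by (simp add: ac_simps)
      qed
      also have "\<dots> = sup_norm f * (C1 * Mq * (\<delta> ^ q / \<eta> ^ (2 * q)))"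
        using powr_realpow[OF \<eta>, of "2 * q"] \<eta> by (simp add: powr_minus field_simps)
      finally have 1: "\<bar>expectation (\<lambda>\<omega>. Z \<eta> \<omega> * ?g \<omega>) - expectation (\<lambda>\<omega>. Z \<eta> \<omega> * ?r \<omega>)\<bar> \<le> sup_norm f * (C1 * Mq * (\<delta> ^ q / \<eta> ^ (2 * q)))" .
      have "\<bar>expectation (\<lambda>\<omega>. (1 - Z \<eta> \<omega>) * (?g \<omega> - ?r \<omega>))\<bar> \<le> expectation (\<lambda>\<omega>. \<bar>(1 - Z \<eta> \<omega>) * (?g \<omega> - ?r \<omega>)\<bar>)"
        by (rule integral_abs_bound)
      also have "\<dots> \<le> expectation (\<lambda>\<omega>. sup_norm f * (1 + K) * (1 - Z \<eta> \<omega>))"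
      proof (rule integral_mono)
        have "(\<lambda>\<omega>. (1 - Z \<eta> \<omega>) * (?g \<omega> - ?r \<omega>)) = (\<lambda>\<omega>. (?g \<omega> - ?r \<omega>) - (Z \<eta> \<omega> * ?g \<omega> - Z \<eta> \<omega> * ?r \<omega>))"
          by (simp add: algebra_simps)
        then show "integrable M (\<lambda>\<omega>. \<bar>(1 - Z \<eta> \<omega>) * (?g \<omega> - ?r \<omega>)\<bar>)"
          using gi ri Zgi Zri by (auto intro!: integrable_abs)
        show "integrable M (\<lambda>\<omega>. sup_norm f * (1 + K) * (1 - Z \<eta> \<omega>))" using Zi[OF \<eta>] by simp
        fix \<omega>
        have "(1 - Z \<eta> \<omega>) * \<bar>?g \<omega> - ?r \<omega>\<bar> \<le> (1 - Z \<eta> \<omega>) * (sup_norm f * (1 + K))"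
          using Z01[OF \<eta>, of \<omega>] by (intro mult_left_mono diff) auto
        then show "\<bar>(1 - Z \<eta> \<omega>) * (?g \<omega> - ?r \<omega>)\<bar> \<le> sup_norm f * (1 + K) * (1 - Z \<eta> \<omega>)"
          using Z01[OF \<eta>, of \<omega>] by (simp add: abs_mult mult.commute)
      qed
      also have "\<dots> = sup_norm f * (1 + K) * expectation (\<lambda>\<omega>. 1 - Z \<eta> \<omega>)" by (rule integral_mult_right_zero)
      also have "\<dots> \<le> sup_norm f * b * expectation (\<lambda>\<omega>. 1 - Z \<eta> \<omega>)"
        using B0 K0 Z01[OF \<eta>] by (intro mult_right_mono mult_left_mono Bochner_Integration.integral_nonneg) (auto simp: b_def)
      finally have 2: "\<bar>expectation (\<lambda>\<omega>. (1 - Z \<eta> \<omega>) * (?g \<omega> - ?r \<omega>))\<bar> \<le> sup_norm f * b * expectation (\<lambda>\<omega>. 1 - Z \<eta> \<omega>)" .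
      have "expectation (\<lambda>\<omega>. (1 - Z \<eta> \<omega>) * (?g \<omega> - ?r \<omega>)) =
         expectation (\<lambda>\<omega>. (?g \<omega> - ?r \<omega>) - (Z \<eta> \<omega> * ?g \<omega> - Z \<eta> \<omega> * ?r \<omega>))"
        by (intro Bochner_Integration.integral_cong) (auto simp: algebra_simps)
      also have "\<dots> = (expectation ?g - expectation ?r) - (expectation (\<lambda>\<omega>. Z \<eta> \<omega> * ?g \<omega>) - expectation (\<lambda>\<omega>. Z \<eta> \<omega> * ?r \<omega>))"
        using gi ri Zgi Zri by simp
      finally show ?thesis using 1 2 unfolding distrib_left mult.assoc by linarith
    next
      case False
      have "\<bar>expectation ?g - expectation ?r\<bar> = \<bar>expectation (\<lambda>\<omega>. ?g \<omega> - ?r \<omega>)\<bar>" using gi ri by simp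
      also have "\<dots> \<le> expectation (\<lambda>\<omega>. \<bar>?g \<omega> - ?r \<omega>\<bar>)" by (rule integral_abs_bound)
      also have "\<dots> \<le> expectation (\<lambda>\<omega>. sup_norm f * (1 + K))"
        using gi ri diff by (intro integral_mono) auto
      also have "\<dots> = sup_norm f * (1 + K)" by (simp add: prob_space)
      finally have 1: "\<bar>expectation ?g - expectation ?r\<bar> \<le> sup_norm f * (1 + K)" .
      have "expectation (Z \<eta>) \<le> expectation (Z \<eta>0)"
        using False unfolding Z_def
        by (intro integral_mono Zi[unfolded Z_def] \<eta> \<eta>0 cutoff_antimono m) auto
      then have "1 / 2 \<le> expectation (\<lambda>\<omega>. 1 - Z \<eta> \<omega>)"
        using \<eta>0(2) Zi[OF \<eta>] by (simp add: prob_space)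
      then have "sup_norm f * b * (1 / 2) \<le> sup_norm f * b * expectation (\<lambda>\<omega>. 1 - Z \<eta> \<omega>)"
        using B0 K0 by (intro mult_left_mono) (auto simp: b_def)
      moreover have "0 \<le> sup_norm f * (C1 * Mq * (\<delta> ^ q / \<eta> ^ (2 * q)))"
        using B0 K0 C1(1) \<eta> \<delta> by simp
      moreover have "sup_norm f * b * (1 / 2) = sup_norm f * (1 + K)" by (simp add: b_def)
      ultimately show ?thesis using 1 unfolding distrib_left mult.assoc by linarith
    qed
  qed
  define C where "C = C1 * Mq + b * 2 powr \<kappa>"
  have b0: "0 \<le> b" using K0 by (simp add: b_def)
  have C0: "0 \<le> C" "C1 * Mq \<le> C" "b * 2 powr \<kappa> \<le> C" using K0 C1(1) b0 by (simp_all add: C_def)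
  show ?thesis
  proof (intro exI[of _ C] conjI C0 allI impI)
    fix Q :: "'d \<Rightarrow> 'w \<Rightarrow> real" and \<eta> \<delta> :: real and f :: "real ^ 'd \<Rightarrow> real"
    assume Q: "(\<forall>i. Q i \<in> D_inf M S D L) \<and> Sigma_inv M S D \<kappa> Q < \<infinity>" and \<eta>: "0 < \<eta>" and \<delta>: "0 < \<delta>" and f: "Cb q f"
    let ?\<Delta>Q = "\<lambda>\<omega>. det (cov_matrix M S D Q \<omega>)"
    have [measurable]: "?\<Delta>Q \<in> borel_measurable M" using Q by (intro det_cov_borel) auto
    have B0: "0 \<le> sup_norm f" using Cb_sup_norm(2)[OF f, of 0] by linarith
    define X where "X = \<delta> ^ q / \<eta> ^ (2 * q)"
    have X0: "0 \<le> X" using \<eta> \<delta> by (simp add: X_def)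
    define E where "E = expectation (\<lambda>\<omega>. 1 - Z \<eta> \<omega>)"
    have E0: "0 \<le> E" using Z01[OF \<eta>] by (simp add: E_def)
    define I1 where "I1 = ennreal (\<eta> powr (- p)) * (\<integral>\<^sup>+ \<omega>. ennreal (\<bar>\<Delta> \<omega> - ?\<Delta>Q \<omega>\<bar> powr p) \<partial>M)"
    define I2 where "I2 = ennreal (\<eta> powr \<kappa>) * Sigma_inv M S D \<kappa> Q"
    \<comment> \<open>The moment of the difference of determinants may be infinite, so the pointwise
      comparison is integrated in \<open>ennreal\<close>.\<close>
    have "ennreal E = (\<integral>\<^sup>+ \<omega>. ennreal (1 - Z \<eta> \<omega>) \<partial>M)"
      unfolding E_def using Z01[OF \<eta>] Zi[OF \<eta>] by (intro nn_integral_eq_integral[symmetric]) auto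
    also have "\<dots> \<le> (\<integral>\<^sup>+ \<omega>. ennreal (2 powr \<kappa>) * (ennreal (\<eta> powr (- p)) * ennreal (\<bar>\<Delta> \<omega> - ?\<Delta>Q \<omega>\<bar> powr p) +
       ennreal (\<eta> powr \<kappa>) * (if ?\<Delta>Q \<omega> = 0 then \<infinity> else ennreal (\<bar>?\<Delta>Q \<omega>\<bar> powr (- \<kappa>)))) \<partial>M)"
      unfolding Z_def by (intro nn_integral_mono one_minus_cutoff_le m \<eta> assms(4,5) \<kappa>m)
    also have "\<dots> = ennreal (2 powr \<kappa>) * (I1 + I2)"
      unfolding I1_def I2_def Sigma_inv_def
      by (subst nn_integral_cmult, measurable) (subst nn_integral_add, auto simp: nn_integral_cmult)
    finally have E: "ennreal E \<le> ennreal (2 powr \<kappa>) * (I1 + I2)" .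
    have "ennreal \<bar>expectation (\<lambda>\<omega>. f (rv_vec F \<omega>)) - expectation (\<lambda>\<omega>. regularise \<phi> \<delta> f (rv_vec F \<omega>))\<bar>
      \<le> ennreal (sup_norm f * (C1 * Mq * X + b * E))"
      unfolding X_def E_def by (rule ennreal_leI[OF main[OF \<eta> \<delta> f]])
    also have "\<dots> = ennreal (sup_norm f) * (ennreal (C1 * Mq) * ennreal X + ennreal b * ennreal E)"
      using B0 C1(1) K0 X0 b0 E0 by (simp add: ennreal_mult ennreal_plus)
    also have "\<dots> \<le> ennreal (sup_norm f) * (ennreal C * ennreal X + ennreal C * (I1 + I2))"
    proof (intro mult_left_mono add_mono)
      show "ennreal (C1 * Mq) * ennreal X \<le> ennreal C * ennreal X" by (intro mult_right_mono ennreal_leI C0) simp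
      have "ennreal b * ennreal E \<le> ennreal b * (ennreal (2 powr \<kappa>) * (I1 + I2))" by (rule mult_left_mono[OF E]) simp
      also have "\<dots> = ennreal (b * 2 powr \<kappa>) * (I1 + I2)" using b0 by (simp add: ennreal_mult mult.assoc)
      also have "\<dots> \<le> ennreal C * (I1 + I2)" by (intro mult_right_mono ennreal_leI C0) simp
      finally show "ennreal b * ennreal E \<le> ennreal C * (I1 + I2)" .
    qed simp
    also have "\<dots> = ennreal (C * sup_norm f) * (ennreal X + I1 + I2)"
      using B0 C0 by (simp add: ennreal_mult algebra_simps)
    finally show "ennreal \<bar>(\<integral>\<omega>. f (\<chi> i. F i \<omega>) \<partial>M) - (\<integral>\<omega>. regularise \<phi> \<delta> f (\<chi> i. F i \<omega>) \<partial>M)\<bar>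
      \<le> ennreal (C * sup_norm f) *
          (ennreal (\<delta> ^ q / \<eta> ^ (2 * q))
           + ennreal (\<eta> powr (- p)) *
               (\<integral>\<^sup>+ \<omega>. ennreal (\<bar>det (cov_matrix M S D F \<omega>) - det (cov_matrix M S D Q \<omega>)\<bar> powr p) \<partial>M)
           + ennreal (\<eta> powr \<kappa>) * Sigma_inv M S D \<kappa> Q)"
      unfolding rv_vec_def X_def I1_def I2_def \<Delta>_def .
  qed
qed

end
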